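(* There are universal constants $c,C>0$ such that for every integer $n\ge 2$ and every isotropic convex body $K\subset\mathbb{R}^n$: (i) $M(K)\ \ge\ \dfrac{c}{\sqrt{n\log n}\;\tau_n}$; (ii) $M^*(K)\ \ge\ \dfrac{c\,\sqrt n}{\sqrt{\log n}\;\tau_n}$; (iii) $L_K\ \le\ C\,\tau_n\,(\log n)^{3/2}$.
   Context: A convex body $K\subset\mathbb{R}^n$ is a compact convex set whose interior contains the origin (it is not assumed symmetric). Its gauge is $\Vert x\Vert_K=\inf\{\lambda\ge 0:\ x\in\lambda K\}$, and its polar body is $K^\circ=\{y\in\mathbb{R}^n:\ \langle x,y\rangle\le 1\ \ \forall x\in K\}$. Let $\sigma$ be the rotation-invariant (Haar) probability measure on the Euclidean unit sphere $\mathbb{S}^{n-1}$. Define $$M(K)=\int_{\mathbb{S}^{n-1}}\Vert x\Vert_K\,\sigma(dx),\qquad M^*(K)=\int_{\mathbb{S}^{n-1}}\Vert x\Vert_{K^\circ}\,\sigma(dx).$$ A random vector $X$ in $\mathbb{R}^n$ is log-concave if its law has a density of the form $\exp(-H)$ with $H:\mathbb{R}^n\to\mathbb{R}\cup\{+\infty\}$ convex; it is isotropic if $\mathbb{E}(X)=0$ and $\mathrm{cov}(X)=\mathrm{id}$. A convex body $K$ is isotropic if a random vector uniformly distributed on $K$ is isotropic in this sense. For isotropic $K$, the isotropic constant is $L_K=|K|^{-1/n}$, where $|K|$ is the Lebesgue measure of $K$. The constant $\tau_n\ge0$ is defined by $$\tau_n^2=\sup_X\ \sup_{\theta\in\mathbb{S}^{n-1}}\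 \sum_{i,j=1}^n \bigl(\mathbb{E}\bigl[X_iX_j\langle X,\theta\rangle\bigr]\bigr)^2,$$ where the first supremum runs over all isotropic log-concave random vectors $X=(X_1,\dots,X_n)$ in $\mathbb{R}^n$. "Universal constants" means that $c,C$ do not depend on $n$ or $K$. *)

theory Defs
  imports "HOL-Probability.Probability"
begin

text \<open>
  The dimension is quantified after the universal constants, so it cannot be a type.
  We use the library's \<^const>\<open>Euclidean_space\<close>: a vector of dimension \<open>n\<close> is a function
  \<open>nat \<Rightarrow> real\<close> that vanishes at all indices \<open>i \<ge> n\<close>.  This set is closed under the pointwise
  linear operations, which are written out below.
\<close>

abbreviation space_n :: "nat \<Rightarrow> (nat \<Rightarrow> real) set" where
  "space_n n \<equiv> topspace (Euclidean_space n)"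

definition inner_n :: "nat \<Rightarrow> (nat \<Rightarrow> real) \<Rightarrow> (nat \<Rightarrow> real) \<Rightarrow> real" where
  "inner_n n x y = (\<Sum>i<n. x i * y i)"

definition sphere_n :: "nat \<Rightarrow> (nat \<Rightarrow> real) set" where
  "sphere_n n = {x \<in> space_n n. sqrt (inner_n n x x) = 1}"

text \<open>Lebesgue measure, as a measure on the Borel sets of \<open>nat \<Rightarrow> real\<close> (product topology)
  carried by the closed set \<open>space_n n\<close>.\<close>

definition extend_zero :: "nat \<Rightarrow> (nat \<Rightarrow> real) \<Rightarrow> nat \<Rightarrow> real" where
  "extend_zero n x = (\<lambda>i. if i < n then x i else 0)"

definition lebesgue_n :: "nat \<Rightarrow> (nat \<Rightarrow> real) measure" where
  "lebesgue_n n = distr (\<Pi>\<^sub>M i\<in>{..<n}. (lborel :: real measure)) borel (extend_zero n)"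

lemma measurable_extend_zero:
  "extend_zero n \<in> borel_measurable (\<Pi>\<^sub>M i\<in>{..<n}. (lborel :: real measure))"
proof (rule measurable_coordinatewise_then_product)
  fix i
  show "(\<lambda>x. extend_zero n x i) \<in> borel_measurable (\<Pi>\<^sub>M i\<in>{..<n}. (lborel :: real measure))"
  proof (cases "i < n")
    case True
    then have "(\<lambda>x. x i) \<in> measurable (\<Pi>\<^sub>M i\<in>{..<n}. (lborel :: real measure)) lborel"
      by (intro measurable_component_singleton) auto
    then show ?thesis using True by (simp add: extend_zero_def)
  qed (simp add: extend_zero_def)
qed

lemma emeasure_lebesgue_n:
  assumes "A \<in> sets borel"
  shows "emeasure (lebesgue_n n) A =
    emeasure (\<Pi>\<^sub>M i\<in>{..<n}. (lborel :: real measure))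
      (extend_zero n -` A \<inter> space (\<Pi>\<^sub>M i\<in>{..<n}. (lborel :: real measure)))"
  unfolding lebesgue_n_def using assms by (simp add: emeasure_distr measurable_extend_zero)

lemma emeasure_lebesgue_n_box:
  assumes "\<And>i. i < n \<Longrightarrow> a i \<le> b i"
  shows "emeasure (lebesgue_n n) {x. \<forall>i<n. a i \<le> x i \<and> x i \<le> b i} = ennreal (\<Prod>i<n. b i - a i)"
proof -
  interpret product_sigma_finite "\<lambda>_::nat. lborel :: real measure" ..
  have eq: "extend_zero n -` {x. \<forall>i<n. a i \<le> x i \<and> x i \<le> b i} \<inter>
      space (\<Pi>\<^sub>M i\<in>{..<n}. (lborel :: real measure)) = (\<Pi>\<^sub>E i\<in>{..<n}. {a i..b i})"
    unfolding space_PiM PiE_def Pi_def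
    by (rule set_eqI) (simp add: extend_zero_def conj_commute)
  have "closed {x :: nat \<Rightarrow> real. a i \<le> x i \<and> x i \<le> b i}" for i
    by (intro closed_Collect_conj closed_Collect_le continuous_on_const
        continuous_on_product_coordinates)
  then have "closed (\<Inter>i\<in>{..<n}. {x :: nat \<Rightarrow> real. a i \<le> x i \<and> x i \<le> b i})"
    by (intro closed_INT ballI)
  also have "(\<Inter>i\<in>{..<n}. {x. a i \<le> x i \<and> x i \<le> b i}) = {x. \<forall>i<n. a i \<le> x i \<and> x i \<le> b i}"
    by blast
  finally have meas: "{x. \<forall>i<n. a i \<le> x i \<and> x i \<le> b i} \<in> sets borel"
    by (rule borel_closed)
  have "emeasure (lebesgue_n n) {x. \<forall>i<n. a i \<le> x i \<and> x i \<le> b i} =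
      emeasure (\<Pi>\<^sub>M i\<in>{..<n}. (lborel :: real measure)) (\<Pi>\<^sub>E i\<in>{..<n}. {a i..b i})"
    by (simp only: emeasure_lebesgue_n[OF meas] eq)
  also have "\<dots> = (\<Prod>i<n. emeasure lborel {a i..b i})"
    by (rule emeasure_PiM) simp_all
  also have "\<dots> = (\<Prod>i<n. ennreal (b i - a i))"
    using assms by (intro prod.cong) simp_all
  also have "\<dots> = ennreal (\<Prod>i<n. b i - a i)"
    using assms by (intro prod_ennreal) simp
  finally show ?thesis .
qed

definition convex_body :: "nat \<Rightarrow> (nat \<Rightarrow> real) set \<Rightarrow> bool" where
  "convex_body n K \<longleftrightarrow>
     compactin (Euclidean_space n) K \<and>
     (\<forall>x\<in>K. \<forall>y\<in>K. \<forall>t\<in>{0..1}. (\<lambda>i. (1 - t) * x i + t * y i) \<in> K) \<and>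
     (\<lambda>_. 0) \<in> (Euclidean_space n) interior_of K"

definition gauge_norm :: "(nat \<Rightarrow> real) set \<Rightarrow> (nat \<Rightarrow> real) \<Rightarrow> real" where
  "gauge_norm K x = Inf {l. 0 \<le> l \<and> x \<in> (\<lambda>y i. l * y i) ` K}"

definition polar_body :: "nat \<Rightarrow> (nat \<Rightarrow> real) set \<Rightarrow> (nat \<Rightarrow> real) set" where
  "polar_body n K = {y \<in> space_n n. \<forall>x\<in>K. inner_n n x y \<le> 1}"

definition mat_apply :: "nat \<Rightarrow> (nat \<Rightarrow> nat \<Rightarrow> real) \<Rightarrow> (nat \<Rightarrow> real) \<Rightarrow> nat \<Rightarrow> real" where
  "mat_apply n A x = (\<lambda>i. if i < n then \<Sum>j<n. A i j * x j else 0)"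

definition orthogonal_n :: "nat \<Rightarrow> (nat \<Rightarrow> nat \<Rightarrow> real) \<Rightarrow> bool" where
  "orthogonal_n n A \<longleftrightarrow> (\<forall>i<n. \<forall>j<n. (\<Sum>k<n. A k i * A k j) = (if i = j then 1 else 0))"

text \<open>Invariance is required under the whole orthogonal group.  For \<open>n \<ge> 2\<close> the unique
  \<open>SO(n)\<close>-invariant probability measure is also \<open>O(n)\<close>-invariant, so both readings agree.\<close>

definition is_haar_sphere :: "nat \<Rightarrow> (nat \<Rightarrow> real) measure \<Rightarrow> bool" where
  "is_haar_sphere n \<sigma> \<longleftrightarrow>
     prob_space \<sigma> \<and> sets \<sigma> = sets (restrict_space borel (sphere_n n)) \<and>
     (\<forall>A. orthogonal_n n A \<longrightarrow> distr \<sigma> \<sigma> (mat_apply n A) = \<sigma>)"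

definition haar_sphere :: "nat \<Rightarrow> (nat \<Rightarrow> real) measure" where
  "haar_sphere n = (THE \<sigma>. is_haar_sphere n \<sigma>)"

definition M_mean :: "nat \<Rightarrow> (nat \<Rightarrow> real) set \<Rightarrow> real" where
  "M_mean n K = (\<integral>x. gauge_norm K x \<partial>haar_sphere n)"

definition M_star :: "nat \<Rightarrow> (nat \<Rightarrow> real) set \<Rightarrow> real" where
  "M_star n K = (\<integral>x. gauge_norm (polar_body n K) x \<partial>haar_sphere n)"

text \<open>Random vectors enter only through their laws, which are measures \<open>\<mu>\<close> on the Borel sets of
  \<open>nat \<Rightarrow> real\<close>.\<close>

definition mean_n :: "(nat \<Rightarrow> real) measure \<Rightarrow> nat \<Rightarrow> real" where
  "mean_n \<mu> i = (\<integral>x. x i \<partial>\<mu>)"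

definition cov_n :: "(nat \<Rightarrow> real) measure \<Rightarrow> nat \<Rightarrow> nat \<Rightarrow> real" where
  "cov_n \<mu> i j = (\<integral>x. (x i - mean_n \<mu> i) * (x j - mean_n \<mu> j) \<partial>\<mu>)"

text \<open>No integrability clause is needed for a probability measure \<open>\<mu>\<close>: a non-integrable function
  has integral \<open>0\<close>, so \<open>cov_n \<mu> i i = 1\<close> forces square integrability of each coordinate.\<close>

definition isotropic_law :: "nat \<Rightarrow> (nat \<Rightarrow> real) measure \<Rightarrow> bool" where
  "isotropic_law n \<mu> \<longleftrightarrow>
     (\<forall>i<n. mean_n \<mu> i = 0) \<and>
     (\<forall>i<n. \<forall>j<n. cov_n \<mu> i j = (if i = j then 1 else 0))"

definition exp_neg :: "ereal \<Rightarrow> ennreal" where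
  "exp_neg h = (if h = \<infinity> then 0 else ennreal (exp (- real_of_ereal h)))"

text \<open>Borel measurability of \<open>H\<close> does not restrict the class of laws: replacing a convex \<open>H\<close> by its
  lower semicontinuous hull changes it only on a Lebesgue null set.\<close>

definition log_concave_law :: "nat \<Rightarrow> (nat \<Rightarrow> real) measure \<Rightarrow> bool" where
  "log_concave_law n \<mu> \<longleftrightarrow>
     prob_space \<mu> \<and>
     (\<exists>H :: (nat \<Rightarrow> real) \<Rightarrow> ereal.
        H \<in> borel_measurable borel \<and>
        (\<forall>x\<in>space_n n. H x \<noteq> -\<infinity>) \<and>
        (\<forall>x\<in>space_n n. \<forall>y\<in>space_n n. \<forall>t\<in>{0<..<1}.
           H (\<lambda>i. (1 - t) * x i + t * y i) \<le> ereal (1 - t) * H x + ereal t * H y) \<and>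
        \<mu> = density (lebesgue_n n) (\<lambda>x. exp_neg (H x)))"

definition isotropic_convex_body :: "nat \<Rightarrow> (nat \<Rightarrow> real) set \<Rightarrow> bool" where
  "isotropic_convex_body n K \<longleftrightarrow>
     convex_body n K \<and> isotropic_law n (uniform_measure (lebesgue_n n) K)"

definition isotropic_const :: "nat \<Rightarrow> (nat \<Rightarrow> real) set \<Rightarrow> real" where
  "isotropic_const n K = measure (lebesgue_n n) K powr (- 1 / real n)"

text \<open>Both suprema are over nonempty bounded sets for \<open>n \<ge> 1\<close>, since the moments of isotropic
  log-concave vectors are bounded in terms of the dimension.\<close>

definition tau_n :: "nat \<Rightarrow> real" where
  "tau_n n = sqrt (SUP \<mu>\<in>{\<mu>. log_concave_law n \<mu> \<and> isotropic_law n \<mu>}. SUP \<theta>\<in>sphere_n n.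
     \<Sum>i<n. \<Sum>j<n. (\<integral>x. x i * x j * inner_n n x \<theta> \<partial>\<mu>)\<^sup>2)"

end

theory Submission
  imports Defs
begin

text \<open>
  Write \<open>\<tau>\<close> for \<open>tau_n n\<close>, and let \<open>Q\<close> be the part of the isotropic body \<open>K\<close> in the ball of radius
  \<open>1000 sqrt n\<close>.  Tilt the uniform law on \<open>Q\<close> by the density \<open>exp (\<xi> \<bullet> x)\<close>, and let \<open>b(\<xi>)\<close> and \<open>A(\<xi>)\<close> be the
  barycentre and the covariance of the tilted law: they are the gradient and the Hessian of the
  logarithmic Laplace transform.  The derivative of \<open>ln (det A)\<close> along the ray through \<open>\<xi>\<close> is a third
  moment of the tilted law after an affine change that makes it isotropic.  That law is log-concave,
  so \<open>\<tau>\<close> bounds its third moments and the derivative is at most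
  \<open>sqrt n * \<tau> * sqrt (\<xi> \<bullet> A(t\<xi>) \<xi>)\<close> in absolute value.  Since \<open>\<xi> \<bullet> A(t\<xi>) \<xi>\<close> is the derivative of
  \<open>\<xi> \<bullet> b(t\<xi>)\<close>, the determinant of \<open>A(\<xi>)\<close> stays above \<open>c^n\<close> as long as the gain \<open>\<xi> \<bullet> (b(\<xi>) - b(0))\<close> is at
  most of order \<open>n / \<tau>^2\<close>.

  Now draw \<open>\<xi>\<close> from the centred Gaussian law of variance \<open>s^2\<close>.  Integration by parts gives
  \<open>E (\<xi> \<bullet> b(\<xi>)) = s^2 E (trace A(\<xi>))\<close>, and the trace is at most \<open>10^6 n\<close> because \<open>Q\<close> lies in a ball.  So
  for \<open>s = c / \<tau>\<close> the gain is small with probability at least one half.  Two conclusions follow.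

  \<^item> The map \<open>b\<close> is injective with Jacobian \<open>det A\<close> and takes its values in \<open>Q\<close>; hence
    \<open>|K| \<ge> (c s)^n\<close>, that is \<open>L_K \<le> C \<tau>\<close> (\<open>volume_lower_bound\<close>).

  \<^item> As \<open>\<xi> \<bullet> b(\<xi>)\<close> is at most the support function of \<open>K\<close>, the Gaussian mean of the support function is
    at least \<open>s^2 E (trace A(\<xi>)) \<ge> c n s^2\<close>, that is \<open>M*(K) \<ge> c sqrt n / \<tau>\<close> (\<open>width_lower_bound\<close>).

  The volume of \<open>K\<close> is at most \<open>36^n\<close>, because at least three quarters of the body lie within \<open>2 sqrt n\<close> of the
  origin.  With Markov's inequality for the gauge this yields \<open>M(K) \<ge> c / sqrt n\<close>, and with the lower
  bound on the volume it yields \<open>\<tau> \<ge> c\<close>.  The three claims follow, since \<open>ln n \<ge> 1/4\<close>.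

  Three supporting facts are needed.  The supremum that defines \<open>\<tau>\<close> must be finite, and cutting \<open>K\<close> down
  to \<open>Q\<close> must not destroy the covariance; both come from a dimension-free fourth moment bound for
  log-concave laws, a consequence of the Prekopa--Leindler inequality.  The Haar measure of the sphere
  must be identified with the normalisation of a rotation invariant law on the whole space, so that
  spherical means become Gaussian integrals.  Finally, the analysis takes place in \<open>real^'n\<close>, whose
  dimension is a type, while the dimension in the theorem is a number: a type is introduced whose
  cardinality is a dimension at which the bounds fail, if there is such a dimension.
\<close>

section \<open>The Prekopa--Leindler inequality for midpoints\<close>

text \<open>The set of midpoints of two measurable sets need not be measurable.  Approximation from inside by
  compact sets makes it possible to work with translates only.\<close>

lemma emeasure_eq_SUP_compact_real:
  fixes A :: "real set"
  assumes A: "A \<in> sets borel" "A \<noteq> {}"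
  shows "emeasure lborel A = (SUP K\<in>{K. K \<subseteq> A \<and> compact K \<and> K \<noteq> {}}. emeasure lborel K)"
proof (rule antisym)
  show "(SUP K\<in>{K. K \<subseteq> A \<and> compact K \<and> K \<noteq> {}}. emeasure lborel K) \<le> emeasure lborel A"
    by (intro SUP_least emeasure_mono) (auto simp: A)
  show "emeasure lborel A \<le> (SUP K\<in>{K. K \<subseteq> A \<and> compact K \<and> K \<noteq> {}}. emeasure lborel K)"
  proof (rule dense_le)
    fix c assume c: "c < emeasure lborel A"
    have "(SUP k::nat. emeasure lborel (A \<inter> {-real k..real k})) = emeasure lborel (\<Union>k::nat. A \<inter> {-real k..real k})"
      by (rule SUP_emeasure_incseq) (use A in \<open>auto simp: incseq_def\<close>)
    also have "(\<Union>k::nat. A \<inter> {-real k..real k}) = A"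
    proof -
      have "\<exists>k::nat. - real k \<le> x \<and> x \<le> real k" for x
        using real_arch_simple[of "\<bar>x\<bar>"] by (metis abs_le_iff minus_le_iff)
      then show ?thesis by auto
    qed
    finally obtain k :: nat where k: "c < emeasure lborel (A \<inter> {-real k..real k})"
      using c by (metis (no_types, lifting) less_SUP_iff)
    define M where "M = density lborel (indicator {-real k..real k})"
    have M: "emeasure M B = emeasure lborel (B \<inter> {-real k..real k})" if "B \<in> sets borel" for B
      using that by (simp add: M_def emeasure_density flip: indicator_inter_arith) (simp add: Int_commute)
    have "emeasure M A = (SUP K\<in>{K. K \<subseteq> A \<and> compact K}. emeasure M K)"
      using A by (intro inner_regular) (auto simp: M_def emeasure_density simp flip: indicator_inter_arith)
    with k A obtain K where K: "K \<subseteq> A" "compact K" "c < emeasure M K"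
      by (auto simp: M less_SUP_iff)
    have "c < emeasure lborel (K \<inter> {-real k..real k})"
      using K M[of K] by (simp add: compact_imp_closed borel_closed)
    moreover have "\<dots> \<le> emeasure lborel K"
      using K by (intro emeasure_mono) (auto simp: compact_imp_closed)
    ultimately have "c < emeasure lborel K" by simp
    moreover from this have "K \<noteq> {}" by auto
    ultimately show "c \<le> (SUP K\<in>{K. K \<subseteq> A \<and> compact K \<and> K \<noteq> {}}. emeasure lborel K)"
      using K by (intro SUP_upper2[of K]) auto
  qed
qed

lemma emeasure_half_real:
  fixes S :: "real set"
  assumes "compact S"
  shows "2 * emeasure lborel ((\<lambda>x. (x + c) / 2) ` S) = emeasure lborel S"
proof -
  have c: "compact ((\<lambda>x. (x + c) / 2) ` S)"
    by (intro compact_continuous_image assms continuous_intros) auto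
  have "emeasure lebesgue ((\<lambda>x. (1/2) *\<^sub>R x + c/2) ` S) = ennreal (\<bar>1/2\<bar> ^ DIM(real)) * emeasure lebesgue S"
    by (rule emeasure_lebesgue_affine)
  then have "emeasure lborel ((\<lambda>x. (x + c) / 2) ` S) = ennreal (1/2) * emeasure lborel S"
    using c assms by (simp add: add_divide_distrib compact_imp_closed)
  then have "2 * emeasure lborel ((\<lambda>x. (x + c) / 2) ` S) = (ennreal 2 * ennreal (1/2)) * emeasure lborel S"
    by (simp add: mult.assoc)
  also have "ennreal 2 * ennreal (1/2) = 1"
    by (subst ennreal_mult[symmetric]) auto
  finally show ?thesis by simp
qed

text \<open>The one-dimensional Brunn--Minkowski inequality: the midpoints of \<open>A\<close> with the least element of \<open>B\<close>
  and the midpoints of \<open>B\<close> with the greatest element of \<open>A\<close> overlap in a single point, and each family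
  is a copy of its set at half the scale.\<close>

lemma emeasure_midpoints_compact:
  fixes A B C :: "real set"
  assumes A: "compact A" "A \<noteq> {}" and B: "compact B" "B \<noteq> {}" and C: "C \<in> sets borel"
    and mid: "\<And>a b. a \<in> A \<Longrightarrow> b \<in> B \<Longrightarrow> (a + b) / 2 \<in> C"
  shows "emeasure lborel A + emeasure lborel B \<le> 2 * emeasure lborel C"
proof -
  obtain p where p: "p \<in> A" "\<And>a. a \<in> A \<Longrightarrow> a \<le> p" using compact_attains_sup[OF A] by auto
  obtain q where q: "q \<in> B" "\<And>b. b \<in> B \<Longrightarrow> q \<le> b" using compact_attains_inf[OF B] by auto
  let ?A = "(\<lambda>x. (x + q) / 2) ` A" and ?B = "(\<lambda>x. (x + p) / 2) ` B"
  have cA: "compact ?A" and cB: "compact ?B"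
    by (intro compact_continuous_image A B continuous_intros; auto)+
  then have bA: "?A \<in> sets borel" and bB: "?B \<in> sets borel"
    by (auto simp: compact_imp_closed)
  \<comment> \<open>\<open>a + q = b + p\<close> with \<open>a \<le> p\<close> and \<open>q \<le> b\<close> leaves only \<open>a = p\<close> and \<open>b = q\<close>.\<close>
  have sub: "?A \<inter> ?B \<subseteq> {(p + q) / 2}"
  proof clarify
    fix a b assume *: "a \<in> A" "b \<in> B" "(a + q) / 2 = (b + p) / 2"
    then have "a + q = b + p" by simp
    moreover have "a \<le> p" "q \<le> b" using p q * by auto
    ultimately have "b + p = p + q" by linarith
    then show "(a + q) / 2 = (p + q) / 2" using * by simp
  qed
  have "emeasure lborel (?A \<inter> ?B) \<le> emeasure lborel {(p + q) / 2}"
    using sub by (intro emeasure_mono) auto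
  then have 0: "emeasure lborel (?A \<inter> ?B) = 0" by simp
  have "emeasure lborel (?A \<union> ?B) = emeasure lborel ?A + emeasure lborel ?B"
    using 0 bA bB emeasure_Un_Int[of ?A lborel ?B] by simp
  moreover have "?A \<union> ?B \<subseteq> C"
    using mid[OF _ q(1)] mid[OF p(1)] by (auto simp: add.commute)
  then have "emeasure lborel (?A \<union> ?B) \<le> emeasure lborel C"
    using C by (intro emeasure_mono) auto
  ultimately have "2 * (emeasure lborel ?A + emeasure lborel ?B) \<le> 2 * emeasure lborel C"
    by (intro mult_left_mono) auto
  then show ?thesis
    unfolding distrib_left emeasure_half_real[OF A(1)] emeasure_half_real[OF B(1)] .
qed

lemma emeasure_midpoints:
  fixes A B C :: "real set"
  assumes A: "A \<in> sets borel" "A \<noteq> {}" and B: "B \<in> sets borel" "B \<noteq> {}" and C: "C \<in> sets borel"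
    and mid: "\<And>a b. a \<in> A \<Longrightarrow> b \<in> B \<Longrightarrow> (a + b) / 2 \<in> C"
  shows "emeasure lborel A + emeasure lborel B \<le> 2 * emeasure lborel C"
proof -
  have ne: "{K. K \<subseteq> S \<and> compact K \<and> K \<noteq> {}} \<noteq> {}" if "S \<noteq> {}" for S :: "real set"
    using that by (auto intro!: exI[of _ "{SOME x. x \<in> S}"] simp: some_in_eq)
  have "emeasure lborel A + emeasure lborel L \<le> 2 * emeasure lborel C"
    if L: "L \<subseteq> B" "compact L" "L \<noteq> {}" for L
  proof -
    have "emeasure lborel A + emeasure lborel L
        = (SUP K\<in>{K. K \<subseteq> A \<and> compact K \<and> K \<noteq> {}}. emeasure lborel K + emeasure lborel L)"
      by (subst emeasure_eq_SUP_compact_real[OF A], subst ennreal_SUP_add_left) (use ne[OF A(2)] in auto)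
    also have "\<dots> \<le> 2 * emeasure lborel C"
      by (intro SUP_least emeasure_midpoints_compact C) (use L mid in auto)
    finally show ?thesis .
  qed
  note * = this
  have "emeasure lborel A + emeasure lborel B
      = (SUP L\<in>{K. K \<subseteq> B \<and> compact K \<and> K \<noteq> {}}. emeasure lborel A + emeasure lborel L)"
    by (subst emeasure_eq_SUP_compact_real[OF B], subst ennreal_SUP_add_right) (use ne[OF B(2)] in auto)
  also have "\<dots> \<le> 2 * emeasure lborel C"
    by (intro SUP_least *) auto
  finally show ?thesis .
qed

lemma nn_integral_layer_cake:
  fixes f :: "real \<Rightarrow> ennreal"
  assumes [measurable]: "f \<in> borel_measurable borel"
  shows "(\<integral>\<^sup>+x. f x \<partial>lborel) = (\<integral>\<^sup>+t. emeasure lborel {x. 0 \<le> t \<and> ennreal t < f x} \<partial>lborel)"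
proof -
  have *: "(\<integral>\<^sup>+t. indicator {t. 0 \<le> t \<and> ennreal t < c} t \<partial>lborel) = c" for c :: ennreal
  proof (cases c)
    case (real r)
    then have "{t. 0 \<le> t \<and> ennreal t < c} = {0..<r}" by (auto simp: ennreal_less_iff)
    with real show ?thesis by simp
  next
    case top
    then have "{t. 0 \<le> t \<and> ennreal t < c} = {0..}" by (auto simp: ennreal_less_top)
    moreover have "emeasure lborel {0::real..} = \<top>"
    proof (rule antisym)
      show "emeasure lborel {0::real..} \<le> \<top>" by simp
      show "\<top> \<le> emeasure lborel {0::real..}"
      proof (rule ccontr)
        assume "\<not> \<top> \<le> emeasure lborel {0::real..}"
        then obtain r where r: "0 \<le> r" "emeasure lborel {0::real..} = ennreal r"
          by (cases "emeasure lborel {0::real..}") (auto simp: top_unique)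
        have "emeasure lborel {0..r+1} \<le> emeasure lborel {0::real..}"
          by (intro emeasure_mono) auto
        with r show False by (simp add: ennreal_le_iff)
      qed
    qed
    ultimately show ?thesis using top by simp
  qed
  have "(\<integral>\<^sup>+x. f x \<partial>lborel) = (\<integral>\<^sup>+x. (\<integral>\<^sup>+t. indicator {t. 0 \<le> t \<and> ennreal t < f x} t \<partial>lborel) \<partial>lborel)"
    by (simp only: *)
  also have "\<dots> = (\<integral>\<^sup>+t. (\<integral>\<^sup>+x. indicator {t. 0 \<le> t \<and> ennreal t < f x} t \<partial>lborel) \<partial>lborel)"
    by (rule lborel_pair.Fubini') measurable
  also have "\<dots> = (\<integral>\<^sup>+t. (\<integral>\<^sup>+x. indicator {x. 0 \<le> t \<and> ennreal t < f x} x \<partial>lborel) \<partial>lborel)"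
    by (intro nn_integral_cong) (auto simp: indicator_def)
  also have "\<dots> = (\<integral>\<^sup>+t. emeasure lborel {x. 0 \<le> t \<and> ennreal t < f x} \<partial>lborel)"
    by (intro nn_integral_cong nn_integral_indicator) measurable
  finally show ?thesis .
qed

lemma ennreal_arith_geo: "4 * (a * b) \<le> (a + b)\<^sup>2" for a b :: ennreal
proof (cases "a = \<top> \<or> b = \<top>")
  case True then show ?thesis by (auto simp: power2_eq_square ennreal_top_mult ennreal_mult_top)
next
  case False
  then obtain x y where xy: "0 \<le> x" "0 \<le> y" "a = ennreal x" "b = ennreal y"
    by (metis ennreal_cases infinity_ennreal_def)
  have "4 * (x * y) \<le> (x + y)\<^sup>2" using zero_le_power2[of "x - y"] by (simp add: power2_eq_square algebra_simps)
  then have "ennreal (4 * (x * y)) \<le> ennreal ((x + y)\<^sup>2)" by (rule ennreal_leI)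
  then show ?thesis using xy by (simp add: ennreal_mult ennreal_power flip: ennreal_plus)
qed

text \<open>When both suprema equal \<open>1\<close>, the superlevel sets of \<open>f\<close> and of \<open>g\<close> are nonempty at every level below
  \<open>1\<close> and empty above, so the inequality for midpoints of sets applies at every level that counts;
  integration over the levels gives a bound by the arithmetic mean.\<close>

lemma prekopa_leindler_normalised:
  fixes f g h :: "real \<Rightarrow> ennreal"
  assumes [measurable]: "f \<in> borel_measurable borel" "g \<in> borel_measurable borel" "h \<in> borel_measurable borel"
    and le: "\<And>x y. f x * g y \<le> (h ((x + y) / 2))\<^sup>2"
    and f: "(SUP x. f x) = 1" and g: "(SUP x. g x) = 1"
  shows "(\<integral>\<^sup>+x. f x \<partial>lborel) + (\<integral>\<^sup>+x. g x \<partial>lborel) \<le> 2 * (\<integral>\<^sup>+x. h x \<partial>lborel)"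
proof -
  have "emeasure lborel {x. 0 \<le> t \<and> ennreal t < f x} + emeasure lborel {x. 0 \<le> t \<and> ennreal t < g x}
      \<le> 2 * emeasure lborel {x. 0 \<le> t \<and> ennreal t < h x}" for t
  proof (cases "0 \<le> t \<and> t < 1")
    case True
    then have t: "ennreal t < 1" by (simp add: ennreal_less_one_iff)
    have "ennreal t < (SUP x. f x)" "ennreal t < (SUP x. g x)" using t f g by auto
    then have "\<exists>x. ennreal t < f x" "\<exists>x. ennreal t < g x"
      by (auto simp: less_SUP_iff)
    then have ne: "{x. 0 \<le> t \<and> ennreal t < f x} \<noteq> {}" "{x. 0 \<le> t \<and> ennreal t < g x} \<noteq> {}"
      using True by auto
    show ?thesis
    proof (rule emeasure_midpoints[OF _ ne(1) _ ne(2)])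
      fix a b assume "a \<in> {x. 0 \<le> t \<and> ennreal t < f x}" "b \<in> {x. 0 \<le> t \<and> ennreal t < g x}"
      then have ab: "ennreal t < f a" "ennreal t < g b" by auto
      have "ennreal t < h ((a + b) / 2)"
      proof (rule ccontr)
        assume "\<not> ennreal t < h ((a + b) / 2)"
        then have "(h ((a + b) / 2))\<^sup>2 \<le> (ennreal t)\<^sup>2" by (intro power_mono) auto
        then have 1: "f a * g b \<le> ennreal t * ennreal t" using le[of a b] by (simp add: power2_eq_square)
        have "ennreal t * g b \<le> f a * g b" using ab by (intro mult_right_mono) auto
        with 1 have 2: "ennreal t * g b \<le> ennreal t * ennreal t" by simp
        show False
        proof (cases "t = 0")
          case True
          then show False using 1 ab by (auto simp: mult_eq_0_iff)
        next
          case False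
          then show False using 2 ab \<open>0 \<le> t \<and> t < 1\<close> by (simp add: ennreal_mult_le_mult_iff)
        qed
      qed
      then show "(a + b) / 2 \<in> {x. 0 \<le> t \<and> ennreal t < h x}" using True by simp
    qed measurable
  next
    case False
    have "f x \<le> 1" "g x \<le> 1" for x using f g by (metis SUP_upper UNIV_I)+
    then have "{x. 0 \<le> t \<and> ennreal t < f x} = {}" "{x. 0 \<le> t \<and> ennreal t < g x} = {}"
      using False by (auto simp: not_less not_le intro: order_trans[of _ 1] simp flip: ennreal_1 intro!: ennreal_leI)
    then show ?thesis by (metis emeasure_empty add_0 zero_le)
  qed
  then have "(\<integral>\<^sup>+t. emeasure lborel {x. 0 \<le> t \<and> ennreal t < f x} + emeasure lborel {x. 0 \<le> t \<and> ennreal t < g x} \<partial>lborel)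
      \<le> (\<integral>\<^sup>+t. 2 * emeasure lborel {x. 0 \<le> t \<and> ennreal t < h x} \<partial>lborel)"
    by (intro nn_integral_mono)
  then show ?thesis
    by (simp add: nn_integral_layer_cake[of f] nn_integral_layer_cake[of g] nn_integral_layer_cake[of h]
        nn_integral_add nn_integral_cmult)
qed

text \<open>Dividing \<open>f\<close> and \<open>g\<close> by their suprema \<open>a\<close> and \<open>b\<close> forces the factor \<open>1 / sqrt (a * b)\<close> on \<open>h\<close>; the
  arithmetic-geometric mean inequality then turns the sum of the integrals into their product.\<close>

lemma prekopa_leindler_bounded:
  fixes f g h :: "real \<Rightarrow> ennreal"
  assumes [measurable]: "f \<in> borel_measurable borel" "g \<in> borel_measurable borel" "h \<in> borel_measurable borel"
    and le: "\<And>x y. f x * g y \<le> (h ((x + y) / 2))\<^sup>2"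
    and f: "\<And>x. f x \<le> ennreal N" and g: "\<And>x. g x \<le> ennreal N"
  shows "(\<integral>\<^sup>+x. f x \<partial>lborel) * (\<integral>\<^sup>+x. g x \<partial>lborel) \<le> (\<integral>\<^sup>+x. h x \<partial>lborel)\<^sup>2"
proof -
  define F G where "F = (SUP x. f x)" and "G = (SUP x. g x)"
  have FG: "F \<le> ennreal N" "G \<le> ennreal N" unfolding F_def G_def using f g by (auto intro!: SUP_least)
  consider "F = 0" | "G = 0" | "F \<noteq> 0" "G \<noteq> 0" by auto
  then show ?thesis
  proof cases
    case 1
    then have "f x = 0" for x unfolding F_def by (metis SUP_upper UNIV_I le_zero_eq)
    then show ?thesis by simp
  next
    case 2
    then have "g x = 0" for x unfolding G_def by (metis SUP_upper UNIV_I le_zero_eq)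
    then show ?thesis by simp
  next
    case 3
    obtain a where a: "F = ennreal a" "0 < a"
      using 3 FG by (cases F) (auto simp: top_unique less_le)
    obtain b where b: "G = ennreal b" "0 < b"
      using 3 FG by (cases G) (auto simp: top_unique less_le)
    define c where "c = sqrt (a * b)"
    have c: "0 < c" "c * c = a * b" using a b by (auto simp: c_def)
    define f1 g1 h1 where "f1 = (\<lambda>x. ennreal (1/a) * f x)" and "g1 = (\<lambda>x. ennreal (1/b) * g x)"
      and "h1 = (\<lambda>x. ennreal (1/c) * h x)"
    have [measurable]: "f1 \<in> borel_measurable borel" "g1 \<in> borel_measurable borel" "h1 \<in> borel_measurable borel"
      by (auto simp: f1_def g1_def h1_def)
    have "(\<integral>\<^sup>+x. f1 x \<partial>lborel) + (\<integral>\<^sup>+x. g1 x \<partial>lborel) \<le> 2 * (\<integral>\<^sup>+x. h1 x \<partial>lborel)"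
    proof (rule prekopa_leindler_normalised)
      fix x y
      have "f1 x * g1 y = ennreal (1/(a*b)) * (f x * g y)"
        using a b by (simp add: f1_def g1_def ac_simps flip: ennreal_mult)
      also have "\<dots> \<le> ennreal (1/(a*b)) * (h ((x + y) / 2))\<^sup>2" by (intro mult_left_mono le) auto
      also have "ennreal (1/(a*b)) = (ennreal (1/c))\<^sup>2"
        using c by (simp add: power2_eq_square flip: ennreal_mult)
      also have "\<dots> * (h ((x + y) / 2))\<^sup>2 = (h1 ((x + y) / 2))\<^sup>2" by (simp add: h1_def power_mult_distrib)
      finally show "f1 x * g1 y \<le> (h1 ((x + y) / 2))\<^sup>2" .
    next
      show "(SUP x. f1 x) = 1" using a unfolding f1_def
        by (subst SUP_mult_left_ennreal[symmetric]) (simp flip: F_def ennreal_mult)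
      show "(SUP x. g1 x) = 1" using b unfolding g1_def
        by (subst SUP_mult_left_ennreal[symmetric]) (simp flip: G_def ennreal_mult)
    qed measurable
    then have le2: "((\<integral>\<^sup>+x. f1 x \<partial>lborel) + (\<integral>\<^sup>+x. g1 x \<partial>lborel))\<^sup>2 \<le> 4 * (\<integral>\<^sup>+x. h1 x \<partial>lborel)\<^sup>2"
      by (drule_tac power_mono[where n=2]) (auto simp: power_mult_distrib)
    have eqs: "(\<integral>\<^sup>+x. f x \<partial>lborel) = ennreal a * (\<integral>\<^sup>+x. f1 x \<partial>lborel)"
      "(\<integral>\<^sup>+x. g x \<partial>lborel) = ennreal b * (\<integral>\<^sup>+x. g1 x \<partial>lborel)"
      "(\<integral>\<^sup>+x. h x \<partial>lborel) = ennreal c * (\<integral>\<^sup>+x. h1 x \<partial>lborel)"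
      using a b c by (simp_all add: f1_def g1_def h1_def nn_integral_cmult mult.assoc[symmetric] flip: ennreal_mult)
    have "4 * ((\<integral>\<^sup>+x. f1 x \<partial>lborel) * (\<integral>\<^sup>+x. g1 x \<partial>lborel)) \<le> 4 * (\<integral>\<^sup>+x. h1 x \<partial>lborel)\<^sup>2"
      using ennreal_arith_geo le2 by (rule order_trans)
    then have "(\<integral>\<^sup>+x. f1 x \<partial>lborel) * (\<integral>\<^sup>+x. g1 x \<partial>lborel) \<le> (\<integral>\<^sup>+x. h1 x \<partial>lborel)\<^sup>2"
      by (subst (asm) ennreal_mult_le_mult_iff) auto
    then have "ennreal (a * b) * ((\<integral>\<^sup>+x. f1 x \<partial>lborel) * (\<integral>\<^sup>+x. g1 x \<partial>lborel)) \<le> ennreal (c * c) * (\<integral>\<^sup>+x. h1 x \<partial>lborel)\<^sup>2"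
      unfolding c by (intro mult_left_mono) auto
    then show ?thesis
      unfolding eqs using a b c(1) by (simp add: ennreal_mult power_mult_distrib power2_eq_square ac_simps)
  qed
qed

theorem prekopa_leindler_real:
  fixes f g h :: "real \<Rightarrow> ennreal"
  assumes [measurable]: "f \<in> borel_measurable borel" "g \<in> borel_measurable borel" "h \<in> borel_measurable borel"
    and le: "\<And>x y. f x * g y \<le> (h ((x + y) / 2))\<^sup>2"
  shows "(\<integral>\<^sup>+x. f x \<partial>lborel) * (\<integral>\<^sup>+x. g x \<partial>lborel) \<le> (\<integral>\<^sup>+x. h x \<partial>lborel)\<^sup>2"
proof -
  define cut where "cut = (\<lambda>(k::nat) (u::real \<Rightarrow> ennreal) x. min (u x) (of_nat k))"
  have [measurable]: "cut k u \<in> borel_measurable borel" if "u \<in> borel_measurable borel" for k u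
    using that unfolding cut_def by measurable
  have inc: "incseq (\<lambda>k. cut k u)" for u
    by (auto simp: incseq_def le_fun_def cut_def intro: min.coboundedI2)
  have sup: "(SUP k. cut k u x) = u x" for u x
  proof -
    have "(SUP k. cut k u x) = min (u x) (SUP k. of_nat k)"
      unfolding cut_def using inf_SUP[of "u x" "of_nat :: nat \<Rightarrow> ennreal" UNIV] by (simp add: inf_min)
    then show ?thesis by (simp add: ennreal_SUP_of_nat_eq_top)
  qed
  have cutI: "(\<integral>\<^sup>+x. u x \<partial>lborel) = (SUP k. \<integral>\<^sup>+x. cut k u x \<partial>lborel)" if "u \<in> borel_measurable borel" for u
    using nn_integral_monotone_convergence_SUP[OF inc[of u], of lborel] that by (simp add: sup)
  have *: "(\<integral>\<^sup>+x. cut j f x \<partial>lborel) * (\<integral>\<^sup>+x. cut k g x \<partial>lborel) \<le> (\<integral>\<^sup>+x. h x \<partial>lborel)\<^sup>2" for j k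
  proof -
    have "(\<integral>\<^sup>+x. cut j f x \<partial>lborel) * (\<integral>\<^sup>+x. cut k g x \<partial>lborel) \<le> (\<integral>\<^sup>+x. cut (max j k) f x \<partial>lborel) * (\<integral>\<^sup>+x. cut (max j k) g x \<partial>lborel)"
      by (intro mult_mono nn_integral_mono) (auto simp: incseqD[OF inc, THEN le_funD])
    also have "\<dots> \<le> (\<integral>\<^sup>+x. h x \<partial>lborel)\<^sup>2"
    proof (rule prekopa_leindler_bounded[where N="real (max j k)"])
      fix x y
      have "cut (max j k) f x * cut (max j k) g y \<le> f x * g y" unfolding cut_def by (intro mult_mono) auto
      then show "cut (max j k) f x * cut (max j k) g y \<le> (h ((x + y) / 2))\<^sup>2" using le order_trans by blast
    qed (auto simp: cut_def ennreal_of_nat_eq_real_of_nat)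
    finally show ?thesis .
  qed
  have "(\<integral>\<^sup>+x. f x \<partial>lborel) * (\<integral>\<^sup>+x. cut k g x \<partial>lborel) \<le> (\<integral>\<^sup>+x. h x \<partial>lborel)\<^sup>2" for k
    by (subst cutI[of f]) (auto simp: SUP_mult_right_ennreal intro!: SUP_least *)
  then show ?thesis
    by (subst cutI[of g]) (auto simp: SUP_mult_left_ennreal intro!: SUP_least)
qed

text \<open>Induction on the set of coordinates: for fixed values of the other coordinates the one-dimensional
  inequality is the hypothesis of the induction for the functions with one coordinate integrated out.\<close>

theorem prekopa_leindler_PiM:
  fixes f g h :: "('i \<Rightarrow> real) \<Rightarrow> ennreal"
  assumes "finite I"
    and "f \<in> borel_measurable (\<Pi>\<^sub>M i\<in>I. lborel)" "g \<in> borel_measurable (\<Pi>\<^sub>M i\<in>I. lborel)"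
      "h \<in> borel_measurable (\<Pi>\<^sub>M i\<in>I. lborel)"
    and "\<And>x y. x \<in> extensional I \<Longrightarrow> y \<in> extensional I \<Longrightarrow> f x * g y \<le> (h (\<lambda>i\<in>I. (x i + y i) / 2))\<^sup>2"
  shows "(\<integral>\<^sup>+x. f x \<partial>(\<Pi>\<^sub>M i\<in>I. lborel)) * (\<integral>\<^sup>+x. g x \<partial>(\<Pi>\<^sub>M i\<in>I. lborel)) \<le> (\<integral>\<^sup>+x. h x \<partial>(\<Pi>\<^sub>M i\<in>I. lborel))\<^sup>2"
  using assms
proof (induction I arbitrary: f g h rule: finite_induct)
  case empty
  interpret product_sigma_finite "\<lambda>_::'i. lborel :: real measure" ..
  have "f (\<lambda>_. undefined) * g (\<lambda>_. undefined) \<le> (h (\<lambda>_. undefined))\<^sup>2"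
    using empty(4)[of "\<lambda>_. undefined" "\<lambda>_. undefined"] by (simp add: restrict_def)
  then show ?case by (simp add: nn_integral_empty)
next
  case (insert i I)
  interpret product_sigma_finite "\<lambda>_::'i. lborel :: real measure" ..
  have [simp]: "(\<integral>\<^sup>+x. u x \<partial>(\<Pi>\<^sub>M i\<in>insert i I. lborel)) = (\<integral>\<^sup>+x. (\<integral>\<^sup>+a. u (x(i := a)) \<partial>lborel) \<partial>(\<Pi>\<^sub>M i\<in>I. lborel))"
    if "u \<in> borel_measurable (\<Pi>\<^sub>M i\<in>insert i I. lborel)" for u :: "('i \<Rightarrow> real) \<Rightarrow> ennreal"
    using that insert by (intro product_nn_integral_insert) auto
  have m1: "(\<lambda>a. u (x(i := a))) \<in> borel_measurable borel"
    if "u \<in> borel_measurable (\<Pi>\<^sub>M i\<in>insert i I. lborel)" "x \<in> extensional I" for u :: "('i \<Rightarrow> real) \<Rightarrow> ennreal" and x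
    using measurable_comp[OF measurable_component_update[of x I "\<lambda>_. lborel" i] that(1)] that(2) insert
    by (simp add: comp_def space_PiM PiE_def)
  have m2: "(\<lambda>x. \<integral>\<^sup>+a. u (x(i := a)) \<partial>lborel) \<in> borel_measurable (\<Pi>\<^sub>M i\<in>I. lborel)"
    if [measurable]: "u \<in> borel_measurable (\<Pi>\<^sub>M i\<in>insert i I. lborel)" for u :: "('i \<Rightarrow> real) \<Rightarrow> ennreal"
  proof -
    have [measurable]: "(\<lambda>(x, a). x(i := a)) \<in> (\<Pi>\<^sub>M i\<in>I. lborel) \<Otimes>\<^sub>M lborel \<rightarrow>\<^sub>M (\<Pi>\<^sub>M i\<in>insert i I. (lborel::real measure))"
      by (rule measurable_add_dim)
    then have "(\<lambda>(x, a). u (x(i := a))) \<in> borel_measurable ((\<Pi>\<^sub>M i\<in>I. lborel) \<Otimes>\<^sub>M lborel)"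
      using measurable_compose[OF _ that, of "\<lambda>(x, a). x(i := a)"] by (simp add: case_prod_beta')
    then show ?thesis
      by (rule lborel.borel_measurable_nn_integral)
  qed
  have "(\<integral>\<^sup>+x. (\<integral>\<^sup>+a. f (x(i := a)) \<partial>lborel) \<partial>(\<Pi>\<^sub>M i\<in>I. lborel)) * (\<integral>\<^sup>+x. (\<integral>\<^sup>+a. g (x(i := a)) \<partial>lborel) \<partial>(\<Pi>\<^sub>M i\<in>I. lborel))
      \<le> (\<integral>\<^sup>+x. (\<integral>\<^sup>+a. h (x(i := a)) \<partial>lborel) \<partial>(\<Pi>\<^sub>M i\<in>I. lborel))\<^sup>2"
  proof (rule insert.IH)
    fix x y :: "'i \<Rightarrow> real" assume xy: "x \<in> extensional I" "y \<in> extensional I"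
    show "(\<integral>\<^sup>+a. f (x(i := a)) \<partial>lborel) * (\<integral>\<^sup>+a. g (y(i := a)) \<partial>lborel)
        \<le> (\<integral>\<^sup>+a. h ((\<lambda>i\<in>I. (x i + y i) / 2)(i := a)) \<partial>lborel)\<^sup>2"
    proof (rule prekopa_leindler_real)
      fix a b
      have "f (x(i := a)) * g (y(i := b)) \<le> (h (\<lambda>j\<in>insert i I. ((x(i := a)) j + (y(i := b)) j) / 2))\<^sup>2"
        using xy by (intro insert.prems) (auto simp: extensional_def)
      also have "(\<lambda>j\<in>insert i I. ((x(i := a)) j + (y(i := b)) j) / 2) = (\<lambda>i\<in>I. (x i + y i) / 2)(i := (a + b) / 2)"
        using insert(2) by (auto simp: fun_eq_iff restrict_def)
      finally show "f (x(i := a)) * g (y(i := b)) \<le> (h ((\<lambda>i\<in>I. (x i + y i) / 2)(i := (a + b) / 2)))\<^sup>2" .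
    qed (use xy insert.prems in \<open>auto intro!: m1\<close>)
  qed (intro m2 insert.prems)+
  then show ?case using insert.prems by simp
qed

section \<open>Moments of log-concave laws\<close>

lemma exp_neg_midpoint:
  assumes "u \<noteq> -\<infinity>" "v \<noteq> -\<infinity>" "w \<noteq> -\<infinity>" "w \<le> ereal (1 / 2) * u + ereal (1 / 2) * v"
  shows "exp_neg u * exp_neg v \<le> (exp_neg w)\<^sup>2"
proof (cases "u = \<infinity> \<or> v = \<infinity>")
  case True then show ?thesis by (auto simp: exp_neg_def)
next
  case False
  then obtain a b where ab: "u = ereal a" "v = ereal b" using assms by (cases u; cases v) auto
  moreover obtain c where c: "w = ereal c" using assms ab by (cases w) auto
  ultimately have "2 * c \<le> a + b" using assms(4) by simp
  then have "ennreal (exp (- a) * exp (- b)) \<le> ennreal ((exp (- c))\<^sup>2)"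
    by (intro ennreal_leI) (simp add: power2_eq_square flip: exp_add)
  then show ?thesis using ab c by (simp add: exp_neg_def ennreal_mult ennreal_power)
qed

lemma exp_neg_measurable [measurable]: "exp_neg \<in> borel_measurable borel"
  unfolding exp_neg_def by measurable

lemma space_n_iff: "x \<in> space_n n \<longleftrightarrow> (\<forall>i\<ge>n. x i = 0)"
  by (auto simp: topspace_Euclidean_space)

lemma inner_n_measurable [measurable]: "(\<lambda>x. inner_n n x y) \<in> borel_measurable borel"
  unfolding inner_n_def by (intro borel_measurable_sum borel_measurable_times measurable_product_coordinates) auto

lemma sets_lebesgue_n [simp, measurable_cong]: "sets (lebesgue_n n) = sets borel"
  by (simp add: lebesgue_n_def)

lemma log_concave_law_sets: "log_concave_law n \<mu> \<Longrightarrow> sets \<mu> = sets borel"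
  by (auto simp: log_concave_law_def)

text \<open>Midpoints between two parallel half-spaces lie in the half-space at the average level.  Applying
  Prekopa--Leindler to the density restricted to these half-spaces shows that the tail of every
  marginal is log-concave.\<close>

lemma log_concave_halfspace:
  assumes "log_concave_law n \<mu>"
  shows "emeasure \<mu> {x. a < inner_n n x \<theta>} * emeasure \<mu> {x. b < inner_n n x \<theta>}
    \<le> (emeasure \<mu> {x. (a + b) / 2 < inner_n n x \<theta>})\<^sup>2"
proof -
  obtain H where H [measurable]: "H \<in> borel_measurable borel"
    and H1: "\<And>x. x \<in> space_n n \<Longrightarrow> H x \<noteq> -\<infinity>"
    and H2: "\<And>x y t. x \<in> space_n n \<Longrightarrow> y \<in> space_n n \<Longrightarrow> t \<in> {0<..<1} \<Longrightarrow>
           H (\<lambda>i. (1 - t) * x i + t * y i) \<le> ereal (1 - t) * H x + ereal t * H y"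
    and \<mu>: "\<mu> = density (lebesgue_n n) (\<lambda>x. exp_neg (H x))"
    using assms by (auto simp: log_concave_law_def)
  define p where "p = (\<lambda>c x. exp_neg (H (extend_zero n x)) * indicator {x. c < inner_n n x \<theta>} (extend_zero n x))"
  note measurable_extend_zero [measurable]
  have p: "p c \<in> borel_measurable (\<Pi>\<^sub>M i\<in>{..<n}. lborel)" for c
    unfolding p_def by measurable
  have eq: "emeasure \<mu> {x. c < inner_n n x \<theta>} = (\<integral>\<^sup>+x. p c x \<partial>(\<Pi>\<^sub>M i\<in>{..<n}. lborel))" for c
    unfolding \<mu> by (simp add: emeasure_density lebesgue_n_def nn_integral_distr p_def)
  show ?thesis
    unfolding eq
  proof (rule prekopa_leindler_PiM[OF _ p p p])
    fix x y :: "nat \<Rightarrow> real"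
    let ?x = "extend_zero n x" and ?y = "extend_zero n y" and ?m = "\<lambda>i\<in>{..<n}. (x i + y i) / 2"
    have sp: "?x \<in> space_n n" "?y \<in> space_n n" "extend_zero n ?m \<in> space_n n"
      by (auto simp: space_n_iff extend_zero_def)
    have mid: "extend_zero n ?m = (\<lambda>i. (1 - 1/2) * ?x i + 1/2 * ?y i)"
      by (auto simp: extend_zero_def fun_eq_iff)
    have in2: "inner_n n (extend_zero n ?m) \<theta> = (inner_n n ?x \<theta> + inner_n n ?y \<theta>) / 2"
      by (simp add: mid inner_n_def sum_divide_distrib flip: sum.distrib) (simp add: algebra_simps add_divide_distrib)
    have "H (extend_zero n ?m) \<le> ereal (1 / 2) * H ?x + ereal (1 / 2) * H ?y"
      using H2[OF sp(1,2), of "1/2"] by (simp add: mid)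
    then have "exp_neg (H ?x) * exp_neg (H ?y) \<le> (exp_neg (H (extend_zero n ?m)))\<^sup>2"
      by (intro exp_neg_midpoint H1 sp) auto
    then show "p a x * p b y \<le> (p ((a + b) / 2) ?m)\<^sup>2"
      by (auto simp: p_def in2 indicator_def)
  qed simp
qed

text \<open>The fourth power of the outer radius of the \<open>k\<close>-th shell is absorbed by \<open>2 ^ k\<close>, which leaves the
  summable factor \<open>(2/3) ^ k\<close> against a tail of order \<open>3 ^ (-k)\<close>.\<close>

lemma shell_power_le: "(4 * real k + 2) ^ 4 \<le> 8000 * 2 ^ k"
proof (induction k)
  case (Suc k)
  show ?case
  proof (cases "k \<ge> 5")
    case True
    have "4 * real (Suc k) + 2 \<le> (13 / 11) * (4 * real k + 2)" using True by simp
    then have "(4 * real (Suc k) + 2) ^ 4 \<le> ((13 / 11) * (4 * real k + 2)) ^ 4" by (intro power_mono) auto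
    also have "\<dots> = (13/11)^4 * (4 * real k + 2) ^ 4" by (rule power_mult_distrib)
    also have "\<dots> \<le> 2 * (4 * real k + 2) ^ 4" by (intro mult_right_mono) (auto simp: power_divide)
    finally show ?thesis using Suc by simp
  next
    case False
    then have "k = 0 \<or> k = 1 \<or> k = 2 \<or> k = 3 \<or> k = 4" by auto
    then show ?thesis by (auto simp: power_divide)
  qed
qed simp

text \<open>By Chebyshev the tail beyond \<open>-2\<close> is at least \<open>3/4\<close> and the tail beyond \<open>2\<close> is at most \<open>1/4\<close>.
  Log-concavity makes the ratios of the tails at the points \<open>-2, 2, 6, 10, ...\<close> decrease, so all of
  them are at most \<open>1/3\<close>.\<close>

lemma (in prob_space) log_concave_tail:
  fixes Y :: "'a \<Rightarrow> real"
  assumes [measurable]: "random_variable borel Y"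
    and int: "integrable M (\<lambda>x. (Y x)\<^sup>2)" and var: "expectation (\<lambda>x. (Y x)\<^sup>2) = 1"
    and lc: "\<And>a b. prob {x\<in>space M. a < Y x} * prob {x\<in>space M. b < Y x} \<le> (prob {x\<in>space M. (a + b) / 2 < Y x})\<^sup>2"
  shows "prob {x\<in>space M. 4 * real k - 2 < Y x} \<le> (1/3) ^ k"
proof -
  define r where "r = (\<lambda>k::nat. prob {x\<in>space M. 4 * real k - 2 < Y x})"
  have r0: "0 \<le> r k" "r k \<le> 1" for k by (auto simp: r_def)
  have dec: "r (Suc k) \<le> r k" for k
    unfolding r_def by (intro finite_measure_mono) auto
  have cheb: "prob {x\<in>space M. 2 \<le> \<bar>Y x\<bar>} \<le> 1/4"
  proof -
    have "prob {x\<in>space M. 4 \<le> (Y x)\<^sup>2} \<le> expectation (\<lambda>x. (Y x)\<^sup>2) / 4"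
      by (intro integral_Markov_inequality_measure[where A="{}"] int) auto
    moreover have "{x\<in>space M. 4 \<le> (Y x)\<^sup>2} = {x\<in>space M. 2 \<le> \<bar>Y x\<bar>}"
      using abs_le_square_iff[of 2] by auto
    ultimately show ?thesis using var by simp
  qed
  have r1: "r 1 \<le> 1/4"
  proof -
    have "r 1 \<le> prob {x\<in>space M. 2 \<le> \<bar>Y x\<bar>}"
      unfolding r_def by (intro finite_measure_mono) auto
    with cheb show ?thesis by simp
  qed
  have "r 0 \<ge> 3/4"
  proof -
    have "1 - r 0 = prob (space M - {x\<in>space M. 4 * real 0 - 2 < Y x})"
      unfolding r_def by (subst prob_compl) auto
    also have "\<dots> \<le> prob {x\<in>space M. 2 \<le> \<bar>Y x\<bar>}"
      by (intro finite_measure_mono) auto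
    finally show ?thesis using cheb by simp
  qed
  have ratio: "r (Suc k) \<le> r k / 3" for k
  proof (induction k)
    case 0 then show ?case using r1 \<open>r 0 \<ge> 3/4\<close> by simp
  next
    case (Suc k)
    show ?case
    proof (cases "r k = 0")
      case True
      then show ?thesis using dec[of k] dec[of "Suc k"] r0[of "Suc k"] r0[of "Suc (Suc k)"] by simp
    next
      case False
      then have pos: "0 < r k" using r0[of k] by simp
      have "r k * r (Suc (Suc k)) \<le> (r (Suc k))\<^sup>2"
        using lc[of "4 * real k - 2" "4 * real (Suc (Suc k)) - 2"]
        by (simp add: r_def algebra_simps add_divide_distrib diff_divide_distrib)
      also have "\<dots> \<le> r k * (r (Suc k) / 3)"
        using mult_right_mono[OF Suc r0(1)[of "Suc k"]] by (simp add: power2_eq_square)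
      finally show ?thesis using pos by simp
    qed
  qed
  have "r k \<le> (1/3) ^ k"
  proof (induction k)
    case (Suc k) then show ?case using ratio[of k] by simp
  qed (use r0 in simp)
  then show ?thesis by (simp add: r_def)
qed

lemma less_abs_disj: "c < \<bar>y\<bar> \<longleftrightarrow> c < y \<or> c < - y" for c y :: real
  by linarith

text \<open>The reverse Hoelder inequality for log-concave laws, with a crude constant.  What matters is that
  the constant does not depend on the dimension of the space on which the marginal \<open>Y\<close> lives.\<close>

lemma (in prob_space) log_concave_fourth_moment:
  fixes Y :: "'a \<Rightarrow> real"
  assumes [measurable]: "random_variable borel Y"
    and int: "integrable M (\<lambda>x. (Y x)\<^sup>2)" and var: "expectation (\<lambda>x. (Y x)\<^sup>2) = 1"
    and lc: "\<And>a b. prob {x\<in>space M. a < Y x} * prob {x\<in>space M. b < Y x} \<le> (prob {x\<in>space M. (a + b) / 2 < Y x})\<^sup>2"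
    and lc': "\<And>a b. prob {x\<in>space M. a < - Y x} * prob {x\<in>space M. b < - Y x} \<le> (prob {x\<in>space M. (a + b) / 2 < - Y x})\<^sup>2"
  shows "integrable M (\<lambda>x. (Y x) ^ 4)" "expectation (\<lambda>x. (Y x) ^ 4) \<le> 40000"
proof -
  define S where "S = (\<lambda>k::nat. {x\<in>space M. 4 * real (Suc k) - 2 < \<bar>Y x\<bar>})"
  have [measurable]: "S k \<in> events" for k
    unfolding S_def by measurable
  have S: "prob (S k) \<le> 2 * (1/3) ^ Suc k" for k
  proof -
    define c where "c = 4 * real (Suc k) - 2"
    have "S k = {x\<in>space M. c < Y x} \<union> {x\<in>space M. c < - Y x}"
      unfolding S_def c_def[symmetric] less_abs_disj by blast
    also have "prob \<dots> \<le> prob {x\<in>space M. c < Y x} + prob {x\<in>space M. c < - Y x}"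
      by (intro measure_Un_le) measurable
    also have "prob {x\<in>space M. c < Y x} \<le> (1/3) ^ Suc k"
      unfolding c_def by (rule log_concave_tail[OF _ int var lc]) measurable
    also have "prob {x\<in>space M. c < - Y x} \<le> (1/3) ^ Suc k"
      unfolding c_def by (rule log_concave_tail[of "\<lambda>x. - Y x", OF _ _ _ lc']) (simp_all only: power2_minus int var, measurable)
    finally show ?thesis by linarith
  qed
  have pt: "ennreal ((Y x)^4) \<le> 16 + (\<Sum>k. ennreal ((4 * real (Suc k) + 2)^4) * indicator (S k) x)" if "x \<in> space M" for x
  proof (cases "\<bar>Y x\<bar> \<le> 2")
    case True
    then have "\<bar>Y x\<bar>^4 \<le> 2^4" by (intro power_mono) auto
    then have "ennreal ((Y x)^4) \<le> ennreal 16" by (intro ennreal_leI) simp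
    then have "ennreal ((Y x)^4) \<le> 16" by simp
    then show ?thesis by (rule add_increasing2[OF zero_le])
  next
    case False
    define k where "k = nat (\<lceil>(\<bar>Y x\<bar> - 2) / 4\<rceil>) - 1"
    have "0 < (\<bar>Y x\<bar> - 2) / 4" using False by simp
    then have c: "1 \<le> \<lceil>(\<bar>Y x\<bar> - 2) / 4\<rceil>" by linarith
    then have k: "real (Suc k) = real_of_int \<lceil>(\<bar>Y x\<bar> - 2) / 4\<rceil>"
      unfolding k_def by (simp add: of_nat_diff)
    have 1: "(\<bar>Y x\<bar> - 2) / 4 \<le> real (Suc k)" "real (Suc k) < (\<bar>Y x\<bar> - 2) / 4 + 1"
      unfolding k by linarith+
    then have x: "x \<in> S k" "\<bar>Y x\<bar> \<le> 4 * real (Suc k) + 2" using that by (auto simp: S_def)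
    then have "\<bar>Y x\<bar>^4 \<le> (4 * real (Suc k) + 2)^4" by (intro power_mono) auto
    then have "(Y x)^4 \<le> (4 * real (Suc k) + 2)^4" by (simp only: power_even_abs_numeral even_numeral)
    then have "ennreal ((Y x)^4) \<le> ennreal ((4 * real (Suc k) + 2)^4) * indicator (S k) x" using x(1)
      by (simp only: indicator_simps mult_1_right ennreal_leI)
    also have "\<dots> \<le> (\<Sum>k. ennreal ((4 * real (Suc k) + 2)^4) * indicator (S k) x)"
    proof -
      have "F k \<le> (\<Sum>k. F k)" for F :: "nat \<Rightarrow> ennreal"
        using sum_le_suminf[of F "{k}"] by simp
      then show ?thesis .
    qed
    finally show ?thesis by (rule add_increasing[OF zero_le])
  qed
  have "(\<integral>\<^sup>+x. ennreal ((Y x)^4) \<partial>M) \<le> (\<integral>\<^sup>+x. 16 + (\<Sum>k. ennreal ((4 * real (Suc k) + 2)^4) * indicator (S k) x) \<partial>M)"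
    by (intro nn_integral_mono pt)
  also have "\<dots> = 16 + (\<Sum>k. ennreal ((4 * real (Suc k) + 2)^4) * emeasure M (S k))"
    by (simp add: nn_integral_add nn_integral_suminf nn_integral_cmult emeasure_space_1)
  also have "\<dots> \<le> 16 + (\<Sum>k. ennreal (16000 * (2/3) ^ Suc k))"
  proof (intro add_left_mono suminf_le)
    fix k
    have "(4 * real (Suc k) + 2)^4 * prob (S k) \<le> (8000 * 2 ^ Suc k) * (2 * (1/3) ^ Suc k)"
      by (intro mult_mono shell_power_le S) auto
    also have "\<dots> = 16000 * (2/3) ^ Suc k" by (simp add: power_divide)
    finally show "ennreal ((4 * real (Suc k) + 2)^4) * emeasure M (S k) \<le> ennreal (16000 * (2/3) ^ Suc k)"
      unfolding emeasure_eq_measure by (subst ennreal_mult[symmetric]) (auto intro: ennreal_leI)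
  qed auto
  also have "(\<Sum>k. ennreal (16000 * (2/3) ^ Suc k)) = ennreal 32000"
  proof -
    have "(\<lambda>k. (2/3::real) ^ k) sums (1 / (1 - 2/3))" by (rule geometric_sums) simp
    then have "(\<lambda>k. (16000 * 2/3) * (2/3::real) ^ k) sums ((16000 * 2/3) * (1 / (1 - 2/3)))" by (rule sums_mult)
    then have s: "(\<lambda>k. 16000 * (2/3::real) ^ Suc k) sums 32000" by simp
    then show ?thesis by (subst suminf_ennreal2) (auto simp: sums_iff)
  qed
  also have "16 + ennreal 32000 \<le> ennreal 40000"
  proof -
    have "16 + ennreal 32000 = ennreal (16 + 32000)" by (subst ennreal_plus) auto
    also have "\<dots> \<le> ennreal 40000" by (intro ennreal_leI) simp
    finally show ?thesis .
  qed
  finally have fin: "(\<integral>\<^sup>+x. ennreal ((Y x)^4) \<partial>M) \<le> ennreal 40000" .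
  show i: "integrable M (\<lambda>x. (Y x) ^ 4)"
    by (rule integrableI_nonneg) (use fin in \<open>auto simp: le_less_trans[OF fin]\<close>)
  have "ennreal (expectation (\<lambda>x. (Y x) ^ 4)) = (\<integral>\<^sup>+x. ennreal ((Y x)^4) \<partial>M)"
    by (rule nn_integral_eq_integral[symmetric]) (use i in auto)
  with fin have "ennreal (expectation (\<lambda>x. (Y x) ^ 4)) \<le> ennreal 40000" by metis
  then show "expectation (\<lambda>x. (Y x) ^ 4) \<le> 40000" by (subst (asm) ennreal_le_iff) auto
qed

text \<open>The integral of a nonintegrable function is \<open>0\<close> by convention, so the value \<open>1\<close> of the diagonal
  covariances makes the coordinates square integrable.\<close>

lemma isotropic_coordinates:
  assumes "prob_space \<mu>" and sets: "sets \<mu> = sets borel" and iso: "isotropic_law n \<mu>"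
  shows "i < n \<Longrightarrow> j < n \<Longrightarrow> integrable \<mu> (\<lambda>x. x i * x j)"
    and "i < n \<Longrightarrow> integrable \<mu> (\<lambda>x. x i)"
    and "i < n \<Longrightarrow> (\<integral>x. x i \<partial>\<mu>) = 0"
    and "i < n \<Longrightarrow> j < n \<Longrightarrow> (\<integral>x. x i * x j \<partial>\<mu>) = (if i = j then 1 else 0)"
proof -
  interpret prob_space \<mu> by fact
  note sets [measurable_cong]
  have [measurable]: "(\<lambda>x. x i) \<in> borel_measurable \<mu>" for i
    by measurable
  show mean: "(\<integral>x. x i \<partial>\<mu>) = 0" if "i < n" for i
    using iso that by (simp add: isotropic_law_def mean_n_def)
  show cov: "(\<integral>x. x i * x j \<partial>\<mu>) = (if i = j then 1 else 0)" if "i < n" "j < n" for i j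
  proof -
    have "mean_n \<mu> i = 0" "mean_n \<mu> j = 0" "cov_n \<mu> i j = (if i = j then 1 else 0)"
      using iso that unfolding isotropic_law_def by blast+
    then show ?thesis unfolding cov_n_def by simp
  qed
  have sq: "integrable \<mu> (\<lambda>x. x i * x i)" if "i < n" for i
    using cov[OF that that] not_integrable_integral_eq[of \<mu> "\<lambda>x. x i * x i"] by auto
  have am: "\<bar>a * b\<bar> \<le> a * a + b * b" for a b :: real
  proof -
    have "2 * (\<bar>a\<bar> * \<bar>b\<bar>) \<le> a * a + b * b"
      using sum_squares_bound[of "\<bar>a\<bar>" "\<bar>b\<bar>"] by (simp add: power2_eq_square mult.assoc)
    moreover have "0 \<le> \<bar>a\<bar> * \<bar>b\<bar>" by simp
    ultimately show ?thesis unfolding abs_mult by linarith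
  qed
  show "integrable \<mu> (\<lambda>x. x i * x j)" if "i < n" "j < n" for i j
  proof (rule Bochner_Integration.integrable_bound)
    show "integrable \<mu> (\<lambda>x. x i * x i + x j * x j)"
      by (intro Bochner_Integration.integrable_add sq that)
    have "norm (x i * x j) \<le> norm (x i * x i + x j * x j)" for x :: "nat \<Rightarrow> real"
      unfolding real_norm_def using am[of "x i" "x j"] by linarith
    then show "AE x in \<mu>. norm (x i * x j) \<le> norm (x i * x i + x j * x j)" by (rule AE_I2)
  qed measurable
  show "integrable \<mu> (\<lambda>x. x i)" if "i < n" for i
  proof (rule Bochner_Integration.integrable_bound)
    show "integrable \<mu> (\<lambda>x. x i * x i + 1)"
      by (intro Bochner_Integration.integrable_add sq that integrable_const)
    have "norm (x i) \<le> norm (x i * x i + 1)" for x :: "nat \<Rightarrow> real"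
      unfolding real_norm_def using am[of "x i" 1] by simp
    then show "AE x in \<mu>. norm (x i) \<le> norm (x i * x i + 1)" by (rule AE_I2)
  qed measurable
qed

lemma isotropic_inner_square:
  assumes "prob_space \<mu>" and sets: "sets \<mu> = sets borel" and iso: "isotropic_law n \<mu>"
  shows "integrable \<mu> (\<lambda>x. (inner_n n x \<theta>)\<^sup>2)" "(\<integral>x. (inner_n n x \<theta>)\<^sup>2 \<partial>\<mu>) = inner_n n \<theta> \<theta>"
    "integrable \<mu> (\<lambda>x. inner_n n x \<theta>)" "(\<integral>x. inner_n n x \<theta> \<partial>\<mu>) = 0"
proof -
  note c = isotropic_coordinates[OF assms]
  have eq: "(inner_n n x \<theta>)\<^sup>2 = (\<Sum>i<n. \<Sum>j<n. (\<theta> i * \<theta> j) * (x i * x j))" for x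
    by (simp add: inner_n_def power2_eq_square sum_product ac_simps)
  show "integrable \<mu> (\<lambda>x. (inner_n n x \<theta>)\<^sup>2)"
    unfolding eq by (intro Bochner_Integration.integrable_sum integrable_mult_right c) auto
  have "(\<integral>x. (inner_n n x \<theta>)\<^sup>2 \<partial>\<mu>) = (\<Sum>i<n. \<Sum>j<n. (\<theta> i * \<theta> j) * (if i = j then 1 else 0))"
  proof -
    have "(\<integral>x. (\<Sum>j<n. (\<theta> i * \<theta> j) * (x i * x j)) \<partial>\<mu>) = (\<Sum>j<n. (\<theta> i * \<theta> j) * (if i = j then 1 else 0))"
      if "i < n" for i
      by (subst Bochner_Integration.integral_sum) (auto intro!: sum.cong integrable_mult_right c(1) simp: c(4) that)
    then show ?thesis unfolding eq
      by (subst Bochner_Integration.integral_sum) (auto intro!: sum.cong Bochner_Integration.integrable_sum integrable_mult_right c(1))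
  qed
  also have "\<dots> = inner_n n \<theta> \<theta>"
    by (simp add: inner_n_def if_distrib cong: if_cong)
  finally show "(\<integral>x. (inner_n n x \<theta>)\<^sup>2 \<partial>\<mu>) = inner_n n \<theta> \<theta>" .
  show "integrable \<mu> (\<lambda>x. inner_n n x \<theta>)"
    unfolding inner_n_def by (intro Bochner_Integration.integrable_sum integrable_mult_left c) auto
  show "(\<integral>x. inner_n n x \<theta> \<partial>\<mu>) = 0"
    unfolding inner_n_def by (subst Bochner_Integration.integral_sum, intro integrable_mult_left c; simp add: c)
qed

lemma isotropic_log_concave_fourth_moment:
  assumes lc: "log_concave_law n \<mu>" and iso: "isotropic_law n \<mu>" and \<theta>: "inner_n n \<theta> \<theta> = 1"
  shows "integrable \<mu> (\<lambda>x. (inner_n n x \<theta>) ^ 4)" "(\<integral>x. (inner_n n x \<theta>) ^ 4 \<partial>\<mu>) \<le> 40000"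
proof -
  have ps: "prob_space \<mu>" using lc by (simp add: log_concave_law_def)
  interpret prob_space \<mu> by fact
  have sets [measurable_cong]: "sets \<mu> = sets borel" using lc by (rule log_concave_law_sets)
  have [simp]: "space \<mu> = UNIV" using sets_eq_imp_space_eq[OF sets] by simp
  note sq = isotropic_inner_square[OF ps sets iso, of \<theta>]
  have half: "prob {x. a < inner_n n x \<theta>} * prob {x. b < inner_n n x \<theta>} \<le> (prob {x. (a + b) / 2 < inner_n n x \<theta>})\<^sup>2" for a b \<theta>
    using log_concave_halfspace[OF lc, of a \<theta> b]
    by (simp add: emeasure_eq_measure ennreal_power ennreal_le_iff flip: ennreal_mult)
  have neg: "- inner_n n x \<theta> = inner_n n x (\<lambda>i. - \<theta> i)" for x by (simp add: inner_n_def sum_negf)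
  show "integrable \<mu> (\<lambda>x. (inner_n n x \<theta>) ^ 4)" "(\<integral>x. (inner_n n x \<theta>) ^ 4 \<partial>\<mu>) \<le> 40000"
    using log_concave_fourth_moment[of "\<lambda>x. inner_n n x \<theta>", OF _ sq(1) sq(2)[unfolded \<theta>]]
      half[of _ \<theta>] half[of _ "\<lambda>i. - \<theta> i", folded neg] by auto
qed

lemma abs_triple_product_le: "\<bar>a * b * c\<bar> \<le> 3 + a^4 + b^4 + c^4" for a b c :: real
proof -
  have cube: "m ^ 3 \<le> 1 + m ^ 4" if "0 \<le> m" for m :: real
  proof (cases "m \<le> 1")
    case True then show ?thesis using power_le_one[of m 3] that by (simp add: add_increasing2)
  next
    case False then have "m ^ 3 \<le> m ^ 4" by (intro power_increasing) auto
    then show ?thesis by simp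
  qed
  define m where "m = max \<bar>a\<bar> (max \<bar>b\<bar> \<bar>c\<bar>)"
  have "\<bar>a * b * c\<bar> \<le> m * m * m" unfolding abs_mult m_def by (intro mult_mono) auto
  also have "\<dots> = m ^ 3" by (simp add: power3_eq_cube)
  also have "\<dots> \<le> 1 + m ^ 4" by (rule cube) (simp add: m_def)
  also have "m ^ 4 \<le> a^4 + b^4 + c^4"
  proof -
    have "m = \<bar>a\<bar> \<or> m = \<bar>b\<bar> \<or> m = \<bar>c\<bar>" by (auto simp: m_def max_def)
    then show ?thesis by (auto simp: power_even_abs add_increasing add_increasing2)
  qed
  finally show ?thesis by simp
qed

text \<open>A crude bound, whose only purpose is that the suprema in the definition of \<^const>\<open>tau_n\<close> run over
  bounded sets; otherwise they would say nothing about their members.\<close>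

lemma third_moments_bounded:
  assumes lc: "log_concave_law n \<mu>" and iso: "isotropic_law n \<mu>" and \<theta>: "\<theta> \<in> sphere_n n"
  shows "(\<Sum>i<n. \<Sum>j<n. (\<integral>x. x i * x j * inner_n n x \<theta> \<partial>\<mu>)\<^sup>2) \<le> real n * (real n * 120003\<^sup>2)"
proof -
  have ps: "prob_space \<mu>" using lc by (simp add: log_concave_law_def)
  interpret prob_space \<mu> by fact
  have sets [measurable_cong]: "sets \<mu> = sets borel" using lc by (rule log_concave_law_sets)
  have \<theta>1: "inner_n n \<theta> \<theta> = 1" using \<theta> by (simp add: sphere_n_def)
  define e where "e = (\<lambda>i k::nat. if k = i then 1 else 0 :: real)"
  have e: "inner_n n x (e i) = x i" "inner_n n (e i) (e i) = 1" if "i < n" for x i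
    using that by (auto simp: inner_n_def e_def if_distrib cong: if_cong)
  note m\<theta> = isotropic_log_concave_fourth_moment[OF lc iso \<theta>1]
  have mi: "integrable \<mu> (\<lambda>x. (x i) ^ 4)" "(\<integral>x. (x i) ^ 4 \<partial>\<mu>) \<le> 40000" if "i < n" for i
    using isotropic_log_concave_fourth_moment[OF lc iso e(2)[OF that]] e(1)[OF that] by simp_all
  have "(\<integral>x. x i * x j * inner_n n x \<theta> \<partial>\<mu>)\<^sup>2 \<le> 120003\<^sup>2" if ij: "i < n" "j < n" for i j
  proof -
    let ?g = "\<lambda>x. 3 + (x i)^4 + (x j)^4 + (inner_n n x \<theta>)^4"
    have g: "integrable \<mu> ?g" by (intro Bochner_Integration.integrable_add mi m\<theta> ij integrable_const)
    have [measurable]: "(\<lambda>x. x i) \<in> borel_measurable \<mu>" for i by measurable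
    have "integrable \<mu> (\<lambda>x. x i * x j * inner_n n x \<theta>)"
    proof (rule Bochner_Integration.integrable_bound[OF g])
      have "norm (x i * x j * inner_n n x \<theta>) \<le> norm (?g x)" for x :: "nat \<Rightarrow> real"
        unfolding real_norm_def using abs_triple_product_le[of "x i" "x j" "inner_n n x \<theta>"] by linarith
      then show "AE x in \<mu>. norm (x i * x j * inner_n n x \<theta>) \<le> norm (?g x)" by (rule AE_I2)
    qed measurable
    then have "(\<integral>x. \<bar>x i * x j * inner_n n x \<theta>\<bar> \<partial>\<mu>) \<le> (\<integral>x. ?g x \<partial>\<mu>)"
      by (intro integral_mono g integrable_abs abs_triple_product_le)
    then have "\<bar>\<integral>x. x i * x j * inner_n n x \<theta> \<partial>\<mu>\<bar> \<le> (\<integral>x. ?g x \<partial>\<mu>)"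
      using integral_abs_bound[of \<mu> "\<lambda>x. x i * x j * inner_n n x \<theta>"] by linarith
    also have "\<dots> = 3 + (\<integral>x. (x i)^4 \<partial>\<mu>) + (\<integral>x. (x j)^4 \<partial>\<mu>) + (\<integral>x. (inner_n n x \<theta>)^4 \<partial>\<mu>)"
      using mi[OF ij(1)] mi[OF ij(2)] m\<theta> by (simp add: prob_space)
    also have "\<dots> \<le> 120003" using mi(2)[OF ij(1)] mi(2)[OF ij(2)] m\<theta>(2) by simp
    finally have "\<bar>\<integral>x. x i * x j * inner_n n x \<theta> \<partial>\<mu>\<bar> \<le> \<bar>120003\<bar>" by simp
    then show ?thesis by (rule abs_le_square_iff[THEN iffD1])
  qed
  then have "(\<Sum>i<n. \<Sum>j<n. (\<integral>x. x i * x j * inner_n n x \<theta> \<partial>\<mu>)\<^sup>2) \<le> (\<Sum>i<n. \<Sum>j<n. 120003\<^sup>2)"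
    by (intro sum_mono) auto
  then show ?thesis by simp
qed

lemma third_moments_le_tau:
  assumes lc: "log_concave_law n \<mu>" and iso: "isotropic_law n \<mu>" and \<theta>: "\<theta> \<in> sphere_n n"
  shows "(\<Sum>i<n. \<Sum>j<n. (\<integral>x. x i * x j * inner_n n x \<theta> \<partial>\<mu>)\<^sup>2) \<le> (tau_n n)\<^sup>2" "0 \<le> tau_n n"
proof -
  define G where "G = (\<lambda>\<mu> \<theta>. \<Sum>i<n. \<Sum>j<n. (\<integral>x. x i * x j * inner_n n x \<theta> \<partial>\<mu>)\<^sup>2)"
  define P where "P = {\<mu>. log_concave_law n \<mu> \<and> isotropic_law n \<mu>}"
  have \<mu>: "\<mu> \<in> P" using lc iso by (simp add: P_def)
  have b: "G \<nu> \<eta> \<le> real n * (real n * 120003\<^sup>2)" if "\<nu> \<in> P" "\<eta> \<in> sphere_n n" for \<nu> \<eta>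
    using third_moments_bounded[of n \<nu> \<eta>] that by (simp add: G_def P_def)
  have 1: "G \<mu> \<theta> \<le> (SUP \<theta>\<in>sphere_n n. G \<mu> \<theta>)"
    using \<theta> b[OF \<mu>] by (intro cSUP_upper bdd_aboveI2) auto
  have 2: "(SUP \<theta>\<in>sphere_n n. G \<mu> \<theta>) \<le> (SUP \<mu>\<in>P. SUP \<theta>\<in>sphere_n n. G \<mu> \<theta>)"
  proof (rule cSUP_upper[OF \<mu>])
    show "bdd_above ((\<lambda>\<mu>. SUP \<theta>\<in>sphere_n n. G \<mu> \<theta>) ` P)"
      using b \<theta> by (intro bdd_aboveI2[of _ _ "real n * (real n * 120003\<^sup>2)"] cSUP_least) auto
  qed
  have 0: "0 \<le> G \<mu> \<theta>" unfolding G_def by (intro sum_nonneg) auto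
  have t: "tau_n n = sqrt (SUP \<mu>\<in>P. SUP \<theta>\<in>sphere_n n. G \<mu> \<theta>)"
    by (simp add: tau_n_def P_def G_def)
  show "0 \<le> tau_n n" using 0 1 2 unfolding t by simp
  show "(\<Sum>i<n. \<Sum>j<n. (\<integral>x. x i * x j * inner_n n x \<theta> \<partial>\<mu>)\<^sup>2) \<le> (tau_n n)\<^sup>2"
  proof -
    have "G \<mu> \<theta> \<le> (tau_n n)\<^sup>2" using 0 1 2 unfolding t by simp
    then show ?thesis unfolding G_def .
  qed
qed

section \<open>Uniqueness of the rotation invariant law on the sphere\<close>

text \<open>Rotations act transitively on the sphere, so an invariant law gives the same mass to all balls of
  one radius centred on the sphere.\<close>

lemma invariant_measure_ball:
  fixes M :: "(real^'n) measure"
  assumes sets [measurable_cong]: "sets M = sets borel"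
    and inv: "\<And>f. orthogonal_transformation f \<Longrightarrow> distr M borel f = M"
    and xy: "norm x = 1" "norm y = 1"
  shows "measure M (ball x \<delta>) = measure M (ball y \<delta>)"
proof -
  obtain f where f: "orthogonal_transformation f" "f x = y"
    using orthogonal_transformation_exists_1[OF xy] by blast
  have sp: "space M = UNIV" using sets_eq_imp_space_eq[OF sets] by simp
  have [measurable]: "f \<in> borel_measurable borel"
    using f(1) by (intro borel_measurable_continuous_onI linear_continuous_on)
      (simp add: orthogonal_transformation_linear linear_linear)
  have fm: "f \<in> M \<rightarrow>\<^sub>M borel" by measurable
  have "measure M (ball y \<delta>) = measure (distr M borel f) (ball y \<delta>)" using inv[OF f(1)] by simp
  also have "\<dots> = measure M (f -` ball y \<delta> \<inter> space M)" by (rule measure_distr[OF fm]) auto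
  also have "f -` ball y \<delta> \<inter> space M = ball x \<delta>"
  proof -
    have "dist (f a) (f b) = dist a b" for a b
      using f(1) unfolding orthogonal_transformation_isometry by blast
    then show ?thesis using f(2) by (auto simp: sp)
  qed
  finally show ?thesis by simp
qed

lemma invariant_measure_ball_pos:
  fixes M :: "(real^'n) measure"
  assumes "prob_space M" and sets [measurable_cong]: "sets M = sets borel"
    and sphere: "AE x in M. norm x = 1"
    and inv: "\<And>f. orthogonal_transformation f \<Longrightarrow> distr M borel f = M"
    and x: "norm x = 1" and \<delta>: "0 < \<delta>"
  shows "0 < measure M (ball x \<delta>)"
proof (rule ccontr)
  interpret prob_space M by fact
  assume "\<not> 0 < measure M (ball x \<delta>)"
  then have 0: "measure M (ball x \<delta>) = 0" using measure_nonneg[of M "ball x \<delta>"] by linarith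
  have null: "ball y \<delta> \<in> null_sets M" if "norm y = 1" for y
  proof -
    have "measure M (ball y \<delta>) = 0" using invariant_measure_ball[OF sets inv that x] 0 by simp
    then show ?thesis by (auto simp: null_sets_def emeasure_eq_measure sets)
  qed
  have "compact (sphere (0::real^'n) 1)" by simp
  then obtain D where D: "D \<subseteq> sphere 0 1" "finite D" "sphere (0::real^'n) 1 \<subseteq> (\<Union>y\<in>D. ball y \<delta>)"
    by (rule compactE_image[of _ "sphere 0 1" "\<lambda>y. ball y \<delta>"]) (use \<delta> in auto)
  have "(\<Union>y\<in>D. ball y \<delta>) \<in> null_sets M"
    using D null by (intro null_sets.finite_UN) auto
  then have "AE x in M. x \<notin> (\<Union>y\<in>D. ball y \<delta>)" by (rule AE_not_in)
  with sphere have "AE x in M. False"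
  proof eventually_elim
    case (elim x)
    then have "x \<in> sphere 0 1" by simp
    with D(3) elim(2) show False by blast
  qed
  then show False by simp
qed

text \<open>Integrate \<open>g x\<close> and \<open>g y\<close> over the pairs \<open>(x, y)\<close> at distance less than \<open>\<delta>\<close>, with \<open>x\<close> drawn from \<open>N\<close> and \<open>y\<close>
  from \<open>M\<close>.  Since all \<open>\<delta>\<close>-balls have equal mass, the two integrals are multiples of the mean of \<open>g\<close>
  under \<open>N\<close> and under \<open>M\<close>, and they differ by at most \<open>L * \<delta>\<close> times the mass of the pairs.  Constant
  functions show that the two multiples agree.\<close>

lemma invariant_measures_lipschitz:
  fixes M N :: "(real^'n) measure" and g :: "real^'n \<Rightarrow> real"
  assumes M: "prob_space M" "sets M = sets borel" "AE x in M. norm x = 1"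
      "\<And>f. orthogonal_transformation f \<Longrightarrow> distr M borel f = M"
    and N: "prob_space N" "sets N = sets borel" "AE x in N. norm x = 1"
      "\<And>f. orthogonal_transformation f \<Longrightarrow> distr N borel f = N"
    and g [measurable]: "g \<in> borel_measurable borel"
    and bound: "\<And>x. \<bar>g x\<bar> \<le> 1" and lip: "\<And>x y. \<bar>g x - g y\<bar> \<le> L * dist x y" and L: "0 \<le> L"
  shows "(\<integral>x. g x \<partial>M) = (\<integral>x. g x \<partial>N)"
proof -
  interpret M: prob_space M by fact
  interpret N: prob_space N by fact
  interpret NM: pair_prob_space N M ..
  note M(2) [measurable_cong] N(2) [measurable_cong]
  obtain e :: "real^'n" where e: "norm e = 1" by (metis norm_axis_1)
  have est: "\<bar>(\<integral>x. g x \<partial>N) - (\<integral>x. g x \<partial>M)\<bar> \<le> L * \<delta>" if \<delta>: "0 < \<delta>" for \<delta>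
  proof -
    define k :: "real^'n \<Rightarrow> real^'n \<Rightarrow> real" where "k = (\<lambda>x y. indicator (ball x \<delta>) y)"
    have ksym: "k x y = k y x" for x y by (simp add: k_def indicator_def dist_commute)
    have k01: "0 \<le> k x y" "k x y \<le> 1" for x y by (auto simp: k_def indicator_def)
    have km [measurable]: "(\<lambda>(x, y). k x y) \<in> borel_measurable (borel \<Otimes>\<^sub>M borel)"
      unfolding k_def indicator_def by (auto simp: ball_def case_prod_beta') 
    define a b where "a = measure M (ball e \<delta>)" and "b = measure N (ball e \<delta>)"
    have IM: "(\<integral>y. k x y \<partial>M) = a" if "norm x = 1" for x
      using invariant_measure_ball[OF M(2,4) that e] by (simp add: k_def a_def M(2))
    have IN: "(\<integral>x. k x y \<partial>N) = b" if "norm y = 1" for y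
    proof -
      have "(\<integral>x. k x y \<partial>N) = (\<integral>x. k y x \<partial>N)" by (intro Bochner_Integration.integral_cong ksym refl)
      then show ?thesis using invariant_measure_ball[OF N(2,4) that e] by (simp add: k_def b_def N(2))
    qed
    have int: "integrable (N \<Otimes>\<^sub>M M) (\<lambda>(x, y). u x y * k x y)"
      if "(\<lambda>(x, y). u x y) \<in> borel_measurable (borel \<Otimes>\<^sub>M borel)" "\<And>x y. \<bar>u x y\<bar> \<le> 2" for u :: "real^'n \<Rightarrow> real^'n \<Rightarrow> real"
    proof (rule NM.P.integrable_const_bound[where B=2])
      have "(\<lambda>z. (case z of (x, y) \<Rightarrow> u x y) * (case z of (x, y) \<Rightarrow> k x y)) \<in> borel_measurable (borel \<Otimes>\<^sub>M borel)"
        using that(1) km by (rule borel_measurable_times)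
      then show "(\<lambda>(x, y). u x y * k x y) \<in> borel_measurable (N \<Otimes>\<^sub>M M)"
        by (simp add: case_prod_beta' cong: measurable_cong_sets) 
      have "\<bar>u x y\<bar> * \<bar>k x y\<bar> \<le> 2 * 1" for x y
        using that(2)[of x y] k01[of x y] by (intro mult_mono) auto
      then show "AE z in N \<Otimes>\<^sub>M M. norm (case z of (x, y) \<Rightarrow> u x y * k x y) \<le> 2"
        by (intro AE_I2) (auto simp: abs_mult)
    qed
    have F1: "(\<integral>z. (case z of (x, y) \<Rightarrow> u x * k x y) \<partial>(N \<Otimes>\<^sub>M M)) = a * (\<integral>x. u x \<partial>N)"
      if [measurable]: "u \<in> borel_measurable borel" and "\<And>x. \<bar>u x\<bar> \<le> 1" for u :: "real^'n \<Rightarrow> real"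
    proof -
      have "\<bar>u x\<bar> \<le> 2" for x using that(2)[of x] by simp
      then have "(\<integral>z. (case z of (x, y) \<Rightarrow> u x * k x y) \<partial>(N \<Otimes>\<^sub>M M)) = (\<integral>x. (\<integral>y. u x * k x y \<partial>M) \<partial>N)"
        by (intro NM.integral_fst[symmetric] int) auto
      also have "\<dots> = (\<integral>x. a * u x \<partial>N)"
      proof (rule integral_cong_AE)
        have "(\<lambda>x. \<integral>y. k x y \<partial>M) \<in> borel_measurable N" by measurable
        then show "(\<lambda>x. \<integral>y. u x * k x y \<partial>M) \<in> borel_measurable N" by simp
      qed (use N(3) IM in auto)
      finally show ?thesis by simp
    qed
    have F2: "(\<integral>z. (case z of (x, y) \<Rightarrow> u y * k x y) \<partial>(N \<Otimes>\<^sub>M M)) = b * (\<integral>x. u x \<partial>M)"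
      if [measurable]: "u \<in> borel_measurable borel" and "\<And>x. \<bar>u x\<bar> \<le> 1" for u :: "real^'n \<Rightarrow> real"
    proof -
      have "\<bar>u x\<bar> \<le> 2" for x using that(2)[of x] by simp
      then have "(\<integral>z. (case z of (x, y) \<Rightarrow> u y * k x y) \<partial>(N \<Otimes>\<^sub>M M)) = (\<integral>y. (\<integral>x. u y * k x y \<partial>N) \<partial>M)"
        by (intro NM.integral_snd[symmetric] int) auto
      also have "\<dots> = (\<integral>y. b * u y \<partial>M)"
      proof (rule integral_cong_AE)
        have "(\<lambda>y. \<integral>x. k y x \<partial>N) \<in> borel_measurable M" by measurable
        then have "(\<lambda>y. u y * (\<integral>x. k y x \<partial>N)) \<in> borel_measurable M" by measurable
        then show "(\<lambda>y. \<integral>x. u y * k x y \<partial>N) \<in> borel_measurable M"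
          by (subst ksym) simp
      qed (use M(3) IN in auto)
      finally show ?thesis by simp
    qed
    have ab: "a = b"
      using F1[of "\<lambda>_. 1"] F2[of "\<lambda>_. 1"] by (simp add: M.prob_space N.prob_space)
    have apos: "0 < a" unfolding a_def by (rule invariant_measure_ball_pos[OF M e \<delta>])
    have g2: "\<bar>g x\<bar> \<le> 2" for x using bound[of x] by simp
    have gi: "integrable (N \<Otimes>\<^sub>M M) (\<lambda>(x, y). g x * k x y)" "integrable (N \<Otimes>\<^sub>M M) (\<lambda>(x, y). g y * k x y)"
      "integrable (N \<Otimes>\<^sub>M M) (\<lambda>(x, y). 1 * k x y)"
      by (rule int; use g2 in auto)+
    have "\<bar>a * (\<integral>x. g x \<partial>N) - b * (\<integral>x. g x \<partial>M)\<bar>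
        = \<bar>\<integral>z. (case z of (x, y) \<Rightarrow> g x * k x y) - (case z of (x, y) \<Rightarrow> g y * k x y) \<partial>(N \<Otimes>\<^sub>M M)\<bar>"
      by (simp only: F1[OF g bound, symmetric] F2[OF g bound, symmetric] Bochner_Integration.integral_diff[OF gi(1,2)])
    also have "\<dots> \<le> (\<integral>z. \<bar>(case z of (x, y) \<Rightarrow> g x * k x y) - (case z of (x, y) \<Rightarrow> g y * k x y)\<bar> \<partial>(N \<Otimes>\<^sub>M M))"
      by (rule integral_abs_bound)
    also have "\<dots> \<le> (\<integral>z. L * \<delta> * (case z of (x, y) \<Rightarrow> 1 * k x y) \<partial>(N \<Otimes>\<^sub>M M))"
    proof (rule integral_mono)
      fix z :: "(real^'n) \<times> (real^'n)"
      obtain x y where z: "z = (x, y)" by force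
      have "\<bar>g x * k x y - g y * k x y\<bar> \<le> L * \<delta> * k x y"
      proof (cases "dist x y < \<delta>")
        case True
        have "\<bar>g x - g y\<bar> \<le> L * \<delta>" using lip[of x y] mult_left_mono[OF less_imp_le[OF True] L] by linarith
        then show ?thesis using True by (simp add: k_def)
      qed (simp add: k_def)
      then show "\<bar>(case z of (x, y) \<Rightarrow> g x * k x y) - (case z of (x, y) \<Rightarrow> g y * k x y)\<bar> \<le> L * \<delta> * (case z of (x, y) \<Rightarrow> 1 * k x y)"
        by (simp add: z)
    qed (intro integrable_abs Bochner_Integration.integrable_diff integrable_mult_right gi)+
    also have "\<dots> = L * \<delta> * a" using F1[of "\<lambda>_. 1"] by (simp only: integral_mult_right_zero) (simp add: N.prob_space)
    finally have "a * \<bar>(\<integral>x. g x \<partial>N) - (\<integral>x. g x \<partial>M)\<bar> \<le> a * (L * \<delta>)"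
      using apos unfolding ab by (simp add: abs_mult mult.commute flip: right_diff_distrib)
    then show ?thesis using apos by simp
  qed
  have "\<bar>(\<integral>x. g x \<partial>N) - (\<integral>x. g x \<partial>M)\<bar> \<le> 0"
  proof (rule field_le_epsilon)
    fix \<epsilon> :: real assume \<epsilon>: "0 < \<epsilon>"
    have "L * (\<epsilon> / (L + 1)) \<le> \<epsilon>" using L \<epsilon> by (simp add: field_simps)
    then show "\<bar>(\<integral>x. g x \<partial>N) - (\<integral>x. g x \<partial>M)\<bar> \<le> 0 + \<epsilon>" using est[of "\<epsilon> / (L + 1)"] L \<epsilon> by simp
  qed
  then show ?thesis by simp
qed

text \<open>Lipschitz functions determine the measure of a closed set \<open>C\<close>, because the indicator of \<open>C\<close> is the
  limit of the functions \<open>max 0 (1 - k * infdist x C)\<close>.\<close>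

theorem invariant_sphere_measure_unique:
  fixes M N :: "(real^'n) measure"
  assumes M: "prob_space M" "sets M = sets borel" "AE x in M. norm x = 1"
      "\<And>f. orthogonal_transformation f \<Longrightarrow> distr M borel f = M"
    and N: "prob_space N" "sets N = sets borel" "AE x in N. norm x = 1"
      "\<And>f. orthogonal_transformation f \<Longrightarrow> distr N borel f = N"
  shows "M = N"
proof -
  interpret M: prob_space M by fact
  interpret N: prob_space N by fact
  note M(2) [measurable_cong] N(2) [measurable_cong]
  have closed_eq: "emeasure M C = emeasure N C" if C: "closed C" for C
  proof (cases "C = {}")
    case False
    define g where "g = (\<lambda>(k::nat) x. max 0 (1 - real k * infdist x C))"
    have [measurable]: "g k \<in> borel_measurable borel" for k
      unfolding g_def by (intro borel_measurable_continuous_onI continuous_intros)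
    have b: "\<bar>g k x\<bar> \<le> 1" for k x by (simp add: g_def infdist_nonneg)
    have lip: "\<bar>g k x - g k y\<bar> \<le> real k * dist x y" for k x y
    proof -
      have "\<bar>infdist x C - infdist y C\<bar> \<le> dist x y" by (rule infdist_triangle_abs)
      then have "real k * \<bar>infdist x C - infdist y C\<bar> \<le> real k * dist x y" by (intro mult_left_mono) auto
      moreover have "\<bar>g k x - g k y\<bar> \<le> \<bar>real k * infdist x C - real k * infdist y C\<bar>"
        unfolding g_def by linarith
      ultimately show ?thesis by (simp add: abs_mult flip: right_diff_distrib)
    qed
    have eq: "(\<integral>x. g k x \<partial>M) = (\<integral>x. g k x \<partial>N)" for k
      by (rule invariant_measures_lipschitz[OF M N _ b lip]) auto
    have conv: "(\<lambda>k. g k x) \<longlonglongrightarrow> indicator C x" for x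
    proof (cases "x \<in> C")
      case True
      then show ?thesis by (simp add: g_def)
    next
      case no: False
      then have pos: "0 < infdist x C"
        using C False in_closed_iff_infdist_zero[OF C False, of x] infdist_nonneg[of x C] by linarith
      then obtain K :: nat where K: "1 / infdist x C \<le> real K" using real_arch_simple by blast
      have "g k x = 0" if "k \<ge> K" for k
      proof -
        have "1 / infdist x C \<le> real k" using K that by linarith
        then show ?thesis using pos by (simp add: g_def field_simps)
      qed
      then have "eventually (\<lambda>k. g k x = 0) sequentially" by (auto simp: eventually_sequentially)
      then show ?thesis using no by (simp add: tendsto_eventually)
    qed
    have lim: "(\<lambda>k. \<integral>x. g k x \<partial>P) \<longlonglongrightarrow> measure P C" if P: "prob_space P" "sets P = sets borel" for P
    proof -
      interpret P: prob_space P by fact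
      note P(2) [measurable_cong]
      have "(\<lambda>k. \<integral>x. g k x \<partial>P) \<longlonglongrightarrow> (\<integral>x. indicator C x \<partial>P)"
        using b conv C by (intro integral_dominated_convergence[where w="\<lambda>_. 1"]) (auto intro!: borel_measurable_indicator borel_closed simp: P(2))
      then show ?thesis using C P(2) by simp
    qed
    have "measure M C = measure N C"
      using lim[OF M(1,2)] lim[OF N(1,2)] unfolding eq by (rule LIMSEQ_unique)
    then show ?thesis by (simp add: M.emeasure_eq_measure N.emeasure_eq_measure)
  qed simp
  show ?thesis
  proof (rule measure_eqI_generator_eq[where E="Collect closed" and \<Omega>=UNIV and A="\<lambda>_. UNIV"])
    show "Int_stable (Collect closed :: (real^'n) set set)" by (auto simp: Int_stable_def)
    show "sets M = sigma_sets UNIV (Collect closed)" "sets N = sigma_sets UNIV (Collect closed)"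
      using M(2) N(2) by (auto simp: borel_eq_closed)
  qed (use closed_eq M.emeasure_space_1 in auto)
qed

section \<open>The logarithm of the determinant\<close>

text \<open>A permutation other than the identity moves at least two indices.  Its product of entries therefore
  has two factors that vanish at the identity matrix, and differentiating one of them leaves the other.\<close>

lemma det_derivative_at_identity:
  fixes A :: "real \<Rightarrow> real^'n^'n"
  assumes der: "\<And>i j. ((\<lambda>t. A t $ i $ j) has_real_derivative A' $ i $ j) (at t)"
    and I: "A t = mat 1"
  shows "((\<lambda>t. det (A t)) has_real_derivative trace A') (at t)"
proof -
  let ?U = "UNIV :: 'n set"
  have prod: "((\<lambda>t. \<Prod>i\<in>?U. A t $ i $ p i) has_real_derivative (\<Sum>i\<in>?U. A' $ i $ p i * (\<Prod>j\<in>?U - {i}. A t $ j $ p j))) (at t)" for p :: "'n \<Rightarrow> 'n"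
  proof -
    have "((\<lambda>t. \<Prod>i\<in>?U. A t $ i $ p i) has_derivative (\<lambda>y. \<Sum>i\<in>?U. (A' $ i $ p i * y) * (\<Prod>j\<in>?U - {i}. A t $ j $ p j))) (at t)"
      using der by (intro has_derivative_prod) (auto simp: has_field_derivative_def mult_commute_abs)
    then show ?thesis unfolding has_field_derivative_def
      by (rule has_derivative_eq_rhs) (auto simp: sum_distrib_right fun_eq_iff intro!: sum.cong)
  qed
  have "((\<lambda>t. det (A t)) has_real_derivative
      (\<Sum>p\<in>{p. p permutes ?U}. of_int (sign p) * (\<Sum>i\<in>?U. A' $ i $ p i * (\<Prod>j\<in>?U - {i}. A t $ j $ p j)))) (at t)"
    unfolding det_def by (intro DERIV_sum DERIV_cmult prod)
  moreover have terms: "of_int (sign p) * (\<Sum>i\<in>?U. A' $ i $ p i * (\<Prod>j\<in>?U - {i}. A t $ j $ p j)) = (if p = id then trace A' else 0)"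
    if p: "p permutes ?U" for p
  proof (cases "p = id")
    case True
    then show ?thesis by (simp add: I mat_def trace_def)
  next
    case False
    then obtain j where j: "p j \<noteq> j" by (auto simp: fun_eq_iff)
    have inj: "inj p" using p by (rule permutes_inj)
    then have j2: "p (p j) \<noteq> p j" using j by (auto dest: injD)
    have 0: "(\<Prod>k\<in>?U - {i}. A t $ k $ p k) = 0" for i
    proof -
      have "\<exists>k\<in>?U - {i}. p k \<noteq> k" using j j2 by (cases "i = j") auto
      then obtain k where "k \<in> ?U - {i}" "p k \<noteq> k" by blast
      then have "A t $ k $ p k = 0" by (simp add: I mat_def)
      with \<open>k \<in> ?U - {i}\<close> show ?thesis by (intro prod_zero) auto
    qed
    show ?thesis using False by (simp only: 0 mult_zero_right sum.neutral_const if_False)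
  qed
  moreover have "(\<Sum>p\<in>{p. p permutes ?U}. if p = id then trace A' else 0) = trace A'"
    by (simp add: permutes_id finite_permutations)
  moreover have "(\<Sum>p\<in>{p. p permutes ?U}. of_int (sign p) * (\<Sum>i\<in>?U. A' $ i $ p i * (\<Prod>j\<in>?U - {i}. A t $ j $ p j)))
      = (\<Sum>p\<in>{p. p permutes ?U}. if p = id then trace A' else 0)"
    by (intro sum.cong refl terms) simp
  ultimately show ?thesis by metis
qed

lemma matrix_conjugation_component:
  fixes A B :: "real^'n^'n"
  shows "(B ** A ** transpose B) $ i $ j = row i B \<bullet> (A *v row j B)"
proof -
  have "(B ** A ** transpose B) $ i $ j = (\<Sum>k\<in>UNIV. (\<Sum>l\<in>UNIV. B$i$l * A$l$k) * B$j$k)"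
    by (simp add: matrix_matrix_mult_def transpose_def)
  also have "\<dots> = (\<Sum>k\<in>UNIV. \<Sum>l\<in>UNIV. B$i$l * (A$l$k * B$j$k))"
    by (simp add: sum_distrib_right mult.assoc)
  also have "\<dots> = (\<Sum>l\<in>UNIV. \<Sum>k\<in>UNIV. B$i$l * (A$l$k * B$j$k))" by (rule sum.swap)
  also have "\<dots> = row i B \<bullet> (A *v row j B)"
    by (simp add: inner_vec_def matrix_vector_mult_def row_def sum_distrib_left)
  finally show ?thesis .
qed

lemma det_conjugation: "det (B ** A ** transpose B) = (det B)\<^sup>2 * det A" for A B :: "real^'n^'n"
  by (simp add: det_mul det_transpose power2_eq_square)

text \<open>Jacobi's formula.  Conjugation by a matrix \<open>B\<close> that whitens \<open>A t\<close> reduces it to the identity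
  matrix; in this form the derivative does not mention the inverse of \<open>A t\<close>.\<close>

lemma ln_det_derivative:
  fixes A :: "real \<Rightarrow> real^'n^'n" and B :: "real^'n^'n"
  assumes der: "\<And>i j. ((\<lambda>t. A t $ i $ j) has_real_derivative A' $ i $ j) (at t)"
    and I: "B ** A t ** transpose B = mat 1"
  shows "0 < det (A t)" "((\<lambda>t. ln (det (A t))) has_real_derivative trace (B ** A' ** transpose B)) (at t)"
proof -
  have d1: "(det B)\<^sup>2 * det (A t) = 1" using det_conjugation[of B "A t"] I by (simp add: det_I)
  then have B0: "(det B)\<^sup>2 > 0" by (metis mult_zero_left zero_less_power2 zero_neq_one power_zero_numeral)
  show pos: "0 < det (A t)" using d1 B0 by (metis zero_less_mult_pos zero_less_one)
  have comp: "(B ** C ** transpose B) $ i $ j = (\<Sum>k\<in>UNIV. (\<Sum>l\<in>UNIV. B$i$l * C$l$k) * B$j$k)" for C i j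
    by (simp add: matrix_matrix_mult_def transpose_def)
  have "((\<lambda>t. det (B ** A t ** transpose B)) has_real_derivative trace (B ** A' ** transpose B)) (at t)"
    using I unfolding comp[abs_def] by (intro det_derivative_at_identity) (auto simp: comp intro!: DERIV_sum DERIV_cmult DERIV_cmult_right der)
  then have "((\<lambda>t. (1 / (det B)\<^sup>2) * ((det B)\<^sup>2 * det (A t))) has_real_derivative (1 / (det B)\<^sup>2) * trace (B ** A' ** transpose B)) (at t)"
    unfolding det_conjugation by (rule DERIV_cmult)
  moreover have "(\<lambda>t. (1 / (det B)\<^sup>2) * ((det B)\<^sup>2 * det (A t))) = (\<lambda>t. det (A t))" using B0 by auto
  moreover have "1 / (det B)\<^sup>2 = det (A t)" using d1 B0 by (simp add: field_simps)
  ultimately have "((\<lambda>t. det (A t)) has_real_derivative det (A t) * trace (B ** A' ** transpose B)) (at t)" by metis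
  from DERIV_chain2[OF DERIV_ln_divide[OF pos] this]
  show "((\<lambda>t. ln (det (A t))) has_real_derivative trace (B ** A' ** transpose B)) (at t)" using pos by simp
qed

text \<open>Gram--Schmidt for the scalar product given by \<open>A\<close>.\<close>

lemma orthonormal_family_exists:
  fixes A :: "real^'n^'n"
  assumes sym: "transpose A = A" and pos: "\<And>v. v \<noteq> 0 \<Longrightarrow> 0 < v \<bullet> (A *v v)"
  shows "\<exists>v::'n \<Rightarrow> real^'n. \<forall>i\<in>S. \<forall>j\<in>S. v i \<bullet> (A *v v j) = (if i = j then 1 else 0)"
proof -
  have comm: "x \<bullet> (A *v y) = y \<bullet> (A *v x)" for x y
    using sym by (metis dot_lmul_matrix inner_commute vector_transpose_matrix)
  have "finite S" by simp
  then show ?thesis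
  proof (induction S rule: finite_induct)
    case (insert k S)
    then obtain v where v: "\<And>i j. i \<in> S \<Longrightarrow> j \<in> S \<Longrightarrow> v i \<bullet> (A *v v j) = (if i = j then 1 else 0)" by blast
    have "dim (v ` S) \<le> card S"
      by (rule order_trans[OF dim_le_card']) (auto intro: card_image_le)
    also have "card S < CARD('n)" using insert(2) by (intro psubset_card_mono) auto
    finally have "dim (v ` S) < DIM(real^'n)" by simp
    then have "span (v ` S) \<noteq> UNIV" by (metis dim_UNIV dim_span less_irrefl)
    then obtain x where x: "x \<notin> span (v ` S)" by blast
    define y where "y = x - (\<Sum>i\<in>S. (v i \<bullet> (A *v x)) *\<^sub>R v i)"
    have "(\<Sum>i\<in>S. (v i \<bullet> (A *v x)) *\<^sub>R v i) \<in> span (v ` S)"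
      by (intro span_sum span_scale span_base) auto
    then have "y \<noteq> 0" using x by (auto simp: y_def)
    then have q: "0 < y \<bullet> (A *v y)" by (rule pos)
    have orth: "v i \<bullet> (A *v y) = 0" if "i \<in> S" for i
    proof -
      have "v i \<bullet> (A *v y) = v i \<bullet> (A *v x) - (\<Sum>j\<in>S. (v j \<bullet> (A *v x)) * (v i \<bullet> (A *v v j)))"
        by (simp add: y_def matrix_vector_mult_diff_distrib linear_sum[OF matrix_vector_mul_linear] inner_diff_right
            inner_sum_right matrix_vector_mult_scaleR)
      also have "(\<Sum>j\<in>S. (v j \<bullet> (A *v x)) * (v i \<bullet> (A *v v j))) = (\<Sum>j\<in>S. if i = j then v j \<bullet> (A *v x) else 0)"
        using v that by (intro sum.cong) auto
      also have "\<dots> = v i \<bullet> (A *v x)" using that insert(1) by simp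
      finally show ?thesis by simp
    qed
    define z where "z = (1 / sqrt (y \<bullet> (A *v y))) *\<^sub>R y"
    have zz: "z \<bullet> (A *v z) = 1" using q by (simp add: z_def matrix_vector_mult_scaleR flip: power2_eq_square)
    have vz: "v i \<bullet> (A *v z) = 0" if "i \<in> S" for i using orth[OF that] by (simp add: z_def matrix_vector_mult_scaleR)
    have zv: "z \<bullet> (A *v v i) = 0" if "i \<in> S" for i using vz[OF that] comm by simp
    have "k \<notin> S" by fact
    show ?case
    proof (intro exI[of _ "v(k := z)"] ballI)
      fix i j assume "i \<in> insert k S" "j \<in> insert k S"
      then show "(v(k := z)) i \<bullet> (A *v (v(k := z)) j) = (if i = j then 1 else 0)"
        using v vz zv zz \<open>k \<notin> S\<close> by (cases "i = k"; cases "j = k") auto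
    qed
  qed simp
qed

lemma whitening_exists:
  fixes A :: "real^'n^'n"
  assumes sym: "transpose A = A" and pos: "\<And>v. v \<noteq> 0 \<Longrightarrow> 0 < v \<bullet> (A *v v)"
  obtains B :: "real^'n^'n" where "B ** A ** transpose B = mat 1"
proof -
  obtain v :: "'n \<Rightarrow> real^'n" where v: "\<And>i j. v i \<bullet> (A *v v j) = (if i = j then 1 else 0)"
    using orthonormal_family_exists[OF sym pos, of UNIV] by auto
  have "row i (\<chi> i. v i) = v i" for i by (simp add: row_def vec_eq_iff)
  then have "(\<chi> i. v i) ** A ** transpose (\<chi> i. v i) = mat 1"
    by (subst vec_eq_iff, subst vec_eq_iff) (simp add: matrix_conjugation_component v mat_def)
  then show thesis by (rule that)
qed

lemma lborel_linear_image:
  fixes f :: "real^'n::{finite,wellorder} \<Rightarrow> real^'n::_"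
  assumes f: "linear f" and d: "det (matrix f) \<noteq> 0"
  shows "lborel = density (distr lborel borel f) (\<lambda>_. ennreal \<bar>det (matrix f)\<bar>)"
proof (rule lborel_eqI)
  have [measurable]: "f \<in> borel_measurable borel"
    using f by (intro borel_measurable_continuous_onI linear_continuous_on) (simp add: linear_linear)
  obtain g where g: "linear g" "\<And>x. g (f x) = x" "\<And>x. f (g x) = x"
    using f d det_nz_iff_inj[OF f] linear_injective_isomorphism[OF f] by metis
  fix l u :: "real^'n::_" assume le: "\<And>b. b \<in> Basis \<Longrightarrow> l \<bullet> b \<le> u \<bullet> b"
  have eq: "f -` box l u = g ` box l u" using g by (auto simp: image_iff) (metis g(2))
  have bd: "bounded (f -` box l u)"
    unfolding eq using g(1) by (intro bounded_linear_image) (auto simp: linear_linear)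
  have m: "f -` box l u \<in> sets borel" using measurable_sets[of f borel borel "box l u"] by simp
  have im: "f ` (f -` box l u) = box l u" using g(3) by (metis surj_image_vimage_eq surjI)
  have "measure lebesgue (box l u) = \<bar>det (matrix f)\<bar> * measure lebesgue (f -` box l u)"
    using measure_lebesgue_linear_transformation[OF bd _ f] m unfolding im by simp
  then have "measure lborel (box l u) = \<bar>det (matrix f)\<bar> * measure lborel (f -` box l u)"
    using m by (simp add: measure_completion)
  moreover have "emeasure lborel (f -` box l u) < \<infinity>"
    using bd by (rule emeasure_bounded_finite)
  ultimately have "ennreal (measure lborel (box l u)) = ennreal \<bar>det (matrix f)\<bar> * emeasure lborel (f -` box l u)"
    by (simp add: emeasure_eq_ennreal_measure less_top[symmetric] ennreal_mult)
  moreover have "emeasure (density (distr lborel borel f) (\<lambda>_. ennreal \<bar>det (matrix f)\<bar>)) (box l u)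
      = ennreal \<bar>det (matrix f)\<bar> * emeasure lborel (f -` box l u)"
    by (simp add: emeasure_density nn_integral_cmult emeasure_distr)
  ultimately show "emeasure (density (distr lborel borel f) (\<lambda>_. ennreal \<bar>det (matrix f)\<bar>)) (box l u) = (\<Prod>b\<in>Basis. (u - l) \<bullet> b)"
    using le by simp
qed simp

section \<open>Gaussian weights\<close>

text \<open>The density of the centred Gaussian law of variance \<open>s\<^sup>2\<close> without its normalising factor, so that the
  values are at most \<open>1\<close> and the total mass is \<open>(s * sqrt (2 * pi)) ^ CARD('n)\<close>.\<close>

definition gauss :: "real \<Rightarrow> real^'n \<Rightarrow> real" where
  "gauss s x = exp (- (norm x)\<^sup>2 / (2 * s\<^sup>2))"

lemma gauss_pos [simp]: "0 < gauss s x" by (simp add: gauss_def)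

lemma gauss_le_one [simp]: "gauss s x \<le> 1" by (simp add: gauss_def)

lemma gauss_continuous: "continuous_on S (gauss s)"
  unfolding gauss_def[abs_def] divide_inverse by (intro continuous_intros)

lemma gauss_measurable [measurable]: "gauss s \<in> borel_measurable borel"
  by (intro borel_measurable_continuous_onI gauss_continuous)

lemma nn_integral_gauss_real:
  assumes s: "0 < s"
  shows "(\<integral>\<^sup>+x. ennreal (exp (- x\<^sup>2 / (2 * s\<^sup>2))) \<partial>lborel) = ennreal (s * sqrt (2 * pi))"
proof -
  have c: "0 < s * sqrt (2 * pi)" using s by simp
  have eq: "exp (- x\<^sup>2 / (2 * s\<^sup>2)) = (s * sqrt (2 * pi)) * normal_density 0 s x" for x
    using s by (simp add: normal_density_def real_sqrt_mult)
  have "(\<integral>\<^sup>+x. ennreal (exp (- x\<^sup>2 / (2 * s\<^sup>2))) \<partial>lborel) = (\<integral>\<^sup>+x. ennreal (s * sqrt (2 * pi)) * ennreal (normal_density 0 s x) \<partial>lborel)"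
    unfolding eq using c by (simp add: ennreal_mult)
  also have "\<dots> = ennreal (s * sqrt (2 * pi)) * (\<integral>\<^sup>+x. ennreal (normal_density 0 s x) \<partial>lborel)"
    by (rule nn_integral_cmult) simp
  also have "(\<integral>\<^sup>+x. ennreal (normal_density 0 s x) \<partial>lborel) = 1"
  proof -
    interpret prob_space "density lborel (normal_density 0 s)" by (rule prob_space_normal_density[OF s])
    show ?thesis using emeasure_space_1 by (simp add: emeasure_density)
  qed
  finally show ?thesis by simp
qed

lemma gauss_nn_integral:
  assumes s: "0 < s"
  shows "(\<integral>\<^sup>+x. ennreal (gauss s (x::real^'n)) \<partial>lborel) = ennreal ((s * sqrt (2 * pi)) ^ CARD('n))"
proof -
  have "ennreal (gauss s x) = (\<Prod>b\<in>Basis. ennreal (exp (- (x \<bullet> b)\<^sup>2 / (2 * s\<^sup>2))))" for x :: "real^'n"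
  proof -
    have "(norm x)\<^sup>2 = (\<Sum>b\<in>Basis. (x \<bullet> b)\<^sup>2)"
      unfolding power2_norm_eq_inner by (subst euclidean_inner) (simp add: power2_eq_square)
    then have "gauss s x = (\<Prod>b\<in>Basis. exp (- (x \<bullet> b)\<^sup>2 / (2 * s\<^sup>2)))"
      by (simp add: gauss_def sum_divide_distrib sum_negf flip: exp_sum)
    then show ?thesis by (simp add: prod_ennreal)
  qed
  then have "(\<integral>\<^sup>+x. ennreal (gauss s (x::real^'n)) \<partial>lborel) = (\<Prod>b\<in>(Basis::(real^'n) set). (\<integral>\<^sup>+x. ennreal (exp (- x\<^sup>2 / (2 * s\<^sup>2))) \<partial>lborel))"
    by (simp only:) (rule nn_integral_lborel_prod, simp_all)
  also have "\<dots> = ennreal (s * sqrt (2 * pi)) ^ CARD('n)"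
    unfolding nn_integral_gauss_real[OF s] by simp
  also have "\<dots> = ennreal ((s * sqrt (2 * pi)) ^ CARD('n))"
    using s by (simp add: ennreal_power)
  finally show ?thesis .
qed

lemma gauss_integrable: assumes "0 < s" shows "integrable lborel (gauss s :: real^'n \<Rightarrow> real)"
  by (rule integrableI_nonneg) (auto simp: gauss_nn_integral[OF assms] less_imp_le)

lemma gauss_integral: assumes "0 < s" shows "(\<integral>x. gauss s (x::real^'n) \<partial>lborel) = (s * sqrt (2 * pi)) ^ CARD('n)"
  using nn_integral_eq_integral[OF gauss_integrable[OF assms, where 'n='n]] gauss_nn_integral[OF assms, where 'n='n] assms
  by (simp add: less_imp_le integral_nonneg_AE ennreal_inj)

text \<open>Quadratic growth is absorbed by doubling the variance of the weight.\<close>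

lemma gauss_weight_integrable:
  fixes f :: "real^'n \<Rightarrow> real"
  assumes s: "0 < s" and [measurable]: "f \<in> borel_measurable borel"
    and f: "\<And>x. \<bar>f x\<bar> \<le> c * (1 + norm x)\<^sup>2"
  shows "integrable lborel (\<lambda>x. f x * gauss s x)"
proof -
  have key: "(1 + r)\<^sup>2 * exp (- r\<^sup>2 / (2 * s\<^sup>2)) \<le> max 2 (8 * s\<^sup>2) * exp (- r\<^sup>2 / (2 * (sqrt 2 * s)\<^sup>2))" for r :: real
  proof -
    have "(1 + r)\<^sup>2 \<le> 2 * 1 + (8 * s\<^sup>2) * (r\<^sup>2 / (4 * s\<^sup>2))"
      using s zero_le_power2[of "1 - r"] by (simp add: power2_eq_square algebra_simps)
    also have "\<dots> \<le> max 2 (8 * s\<^sup>2) * 1 + max 2 (8 * s\<^sup>2) * (r\<^sup>2 / (4 * s\<^sup>2))"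
      by (intro add_mono mult_right_mono) auto
    also have "\<dots> = max 2 (8 * s\<^sup>2) * (1 + r\<^sup>2 / (4 * s\<^sup>2))" by (simp add: distrib_left)
    also have "\<dots> \<le> max 2 (8 * s\<^sup>2) * exp (r\<^sup>2 / (4 * s\<^sup>2))"
      by (intro mult_left_mono exp_ge_add_one_self) auto
    finally have "(1 + r)\<^sup>2 * exp (- r\<^sup>2 / (2 * s\<^sup>2)) \<le> max 2 (8 * s\<^sup>2) * exp (r\<^sup>2 / (4 * s\<^sup>2)) * exp (- r\<^sup>2 / (2 * s\<^sup>2))"
      by (rule mult_right_mono) simp
    also have "\<dots> = max 2 (8 * s\<^sup>2) * exp (- r\<^sup>2 / (2 * (sqrt 2 * s)\<^sup>2))"
      using s by (simp add: mult.assoc power_mult_distrib flip: exp_add)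
    finally show ?thesis .
  qed
  have *: "\<bar>f x\<bar> * gauss s x \<le> \<bar>c\<bar> * max 2 (8 * s\<^sup>2) * gauss (sqrt 2 * s) x" for x
  proof -
    have "\<bar>f x\<bar> * gauss s x \<le> c * (1 + norm x)\<^sup>2 * gauss s x" by (intro mult_right_mono f) (simp add: less_imp_le)
    also have "\<dots> \<le> \<bar>c\<bar> * ((1 + norm x)\<^sup>2 * gauss s x)" unfolding mult.assoc by (intro mult_right_mono) (auto simp: less_imp_le)
    also have "\<dots> \<le> \<bar>c\<bar> * (max 2 (8 * s\<^sup>2) * gauss (sqrt 2 * s) x)"
      unfolding gauss_def by (intro mult_left_mono key) simp
    finally show ?thesis by (simp add: mult.assoc)
  qed
  show "integrable lborel (\<lambda>x. f x * gauss s x)"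
  proof (rule Bochner_Integration.integrable_bound)
    show "integrable lborel (\<lambda>x::real^'n. \<bar>c\<bar> * max 2 (8 * s\<^sup>2) * gauss (sqrt 2 * s) x)"
      using s by (intro integrable_mult_right gauss_integrable) simp
    show "AE x in lborel. norm (f x * gauss s x) \<le> norm (\<bar>c\<bar> * max 2 (8 * s\<^sup>2) * gauss (sqrt 2 * s) x)"
      using * by (intro AE_I2) (simp add: abs_mult abs_of_pos[OF gauss_pos])
  qed measurable
qed

lemma gauss_line_derivative:
  assumes s: "0 < s"
  shows "((\<lambda>t. gauss s (x - t *\<^sub>R e)) has_real_derivative ((e \<bullet> (x - t *\<^sub>R e)) / s\<^sup>2 * gauss s (x - t *\<^sub>R e))) (at t)"
proof -
  have eq: "gauss s (x - t *\<^sub>R e) = exp (- (x \<bullet> x - 2 * t * (e \<bullet> x) + t\<^sup>2 * (e \<bullet> e)) / (2 * s\<^sup>2))" for t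
  proof -
    have "(norm (x - t *\<^sub>R e))\<^sup>2 = x \<bullet> x - 2 * t * (e \<bullet> x) + t\<^sup>2 * (e \<bullet> e)"
      unfolding power2_norm_eq_inner by (simp add: inner_diff_left inner_diff_right inner_commute[of x e] power2_eq_square algebra_simps)
    then show ?thesis by (simp add: gauss_def)
  qed
  show ?thesis
    unfolding eq using s
    by (auto intro!: derivative_eq_intros simp: inner_diff_right field_simps)
qed

text \<open>By translation invariance, the integral of \<open>F (x + h e)\<close> against \<open>gauss s x\<close> equals the integral of
  \<open>F x\<close> against \<open>gauss s (x - h e)\<close>.  Subtract the value at \<open>h = 0\<close>, divide by \<open>h\<close> and let \<open>h\<close> tend to
  \<open>0\<close>: the left side yields the derivative of \<open>F\<close>, the right side that of the weight.\<close>

theorem gauss_integration_by_parts: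
  fixes F F' :: "real^'n \<Rightarrow> real"
  assumes s: "0 < s" and F [measurable]: "F \<in> borel_measurable borel" and F' [measurable]: "F' \<in> borel_measurable borel"
    and der: "\<And>x. ((\<lambda>t. F (x + t *\<^sub>R e)) has_real_derivative F' x) (at 0)"
    and lip: "\<And>x t. \<bar>F (x + t *\<^sub>R e) - F x\<bar> \<le> L * \<bar>t\<bar>"
    and growth: "\<And>x. \<bar>F x\<bar> \<le> c * (1 + norm x)"
  shows "(\<integral>x. F x * (e \<bullet> x) * gauss s x \<partial>lborel) = s\<^sup>2 * (\<integral>x. F' x * gauss s x \<partial>lborel)"
proof -
  define h where "h = (\<lambda>k::nat. inverse (real (Suc k)))"
  have h: "h k > 0" "h k \<le> 1" for k by (auto simp: h_def divide_simps)
  have h0: "filterlim h (at 0) sequentially"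
    unfolding filterlim_at using h LIMSEQ_inverse_real_of_nat by (auto simp: h_def eventually_sequentially)
  have c0: "0 \<le> c" using order_trans[OF abs_ge_zero growth[of 0]] by simp
  have growth2: "\<bar>F x\<bar> \<le> c * (1 + norm x)\<^sup>2" for x
  proof -
    have "1 + norm x \<le> (1 + norm x)\<^sup>2" by (simp add: power2_eq_square algebra_simps)
    then show ?thesis using growth[of x] c0 by (meson mult_left_mono order_trans)
  qed
  define D where "D = (\<lambda>k x. (F (x + h k *\<^sub>R e) - F x) / h k)"
  have [measurable]: "D k \<in> borel_measurable borel" for k unfolding D_def by measurable
  have Db: "\<bar>D k x\<bar> \<le> L" for k x using lip[of x "h k"] h(1)[of k] by (simp add: D_def field_simps)
  have Dlim: "(\<lambda>k. D k x) \<longlonglongrightarrow> F' x" for x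
  proof -
    have "((\<lambda>t. (F (x + (0 + t) *\<^sub>R e) - F (x + 0 *\<^sub>R e)) / t) \<longlongrightarrow> F' x) (at 0)"
      using der[of x] unfolding DERIV_def by simp
    from filterlim_compose[OF this h0] show ?thesis by (simp add: D_def)
  qed
  define G where "G = (\<lambda>k x. (gauss s (x - h k *\<^sub>R e) - gauss s x) / h k)"
  have [measurable]: "G k \<in> borel_measurable borel" for k unfolding G_def by measurable
  have Glim: "(\<lambda>k. G k x) \<longlonglongrightarrow> (e \<bullet> x) / s\<^sup>2 * gauss s x" for x
  proof -
    have "((\<lambda>t. (gauss s (x - (0 + t) *\<^sub>R e) - gauss s (x - 0 *\<^sub>R e)) / t) \<longlongrightarrow> (e \<bullet> x) / s\<^sup>2 * gauss s x) (at 0)"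
      using gauss_line_derivative[OF s, of x e 0] unfolding DERIV_def by simp
    from filterlim_compose[OF this h0] show ?thesis by (simp add: G_def)
  qed
  \<comment> \<open>Difference quotients of the weight are dominated by a Gaussian of twice the variance, by the mean value theorem and \<open>|x|\<^sup>2 \<le> 2 |x - u e|\<^sup>2 + 2 |e|\<^sup>2\<close>.\<close>
  define C where "C = norm e * (1 + norm e) / s\<^sup>2 * exp ((norm e)\<^sup>2 / (2 * s\<^sup>2))"
  have C0: "0 \<le> C" by (simp add: C_def)
  have Gb: "\<bar>G k x\<bar> \<le> C * (1 + norm x) * gauss (sqrt 2 * s) x" for k x
  proof -
    obtain u where u: "0 < u" "u < h k"
      "gauss s (x - h k *\<^sub>R e) - gauss s (x - 0 *\<^sub>R e) = (h k - 0) * ((e \<bullet> (x - u *\<^sub>R e)) / s\<^sup>2 * gauss s (x - u *\<^sub>R e))"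
      using MVT2[OF h(1)[of k], of "\<lambda>t. gauss s (x - t *\<^sub>R e)", OF gauss_line_derivative[OF s]] by blast
    let ?y = "x - u *\<^sub>R e"
    have u1: "u \<le> 1" using u h(2)[of k] by linarith
    have ue: "norm (u *\<^sub>R e) \<le> norm e" using u u1 by (simp add: mult_left_le_one_le)
    have ny: "norm ?y \<le> norm x + norm e" using norm_triangle_ineq4[of x "u *\<^sub>R e"] ue by linarith
    have "(norm x)\<^sup>2 \<le> 2 * (norm ?y)\<^sup>2 + 2 * (norm e)\<^sup>2"
    proof -
      have "norm x \<le> norm ?y + norm e" using norm_triangle_ineq[of ?y "u *\<^sub>R e"] ue by simp
      then have "(norm x)\<^sup>2 \<le> (norm ?y + norm e)\<^sup>2" by (intro power_mono) auto
      also have "\<dots> \<le> 2 * (norm ?y)\<^sup>2 + 2 * (norm e)\<^sup>2"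
        using zero_le_power2[of "norm ?y - norm e"] by (simp add: power2_eq_square algebra_simps)
      finally show ?thesis .
    qed
    then have "- (norm ?y)\<^sup>2 / (2 * s\<^sup>2) \<le> (norm e)\<^sup>2 / (2 * s\<^sup>2) + (- (norm x)\<^sup>2 / (2 * (sqrt 2 * s)\<^sup>2))"
      using s by (simp add: power_mult_distrib field_simps)
    then have g: "gauss s ?y \<le> exp ((norm e)\<^sup>2 / (2 * s\<^sup>2)) * gauss (sqrt 2 * s) x"
      unfolding gauss_def by (simp flip: exp_add)
    have i: "\<bar>e \<bullet> ?y\<bar> \<le> norm e * (1 + norm e) * (1 + norm x)"
    proof -
      have "\<bar>e \<bullet> ?y\<bar> \<le> norm e * norm ?y" by (rule Cauchy_Schwarz_ineq2)
      also have "\<dots> \<le> norm e * ((1 + norm e) * (1 + norm x))"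
        using ny by (intro mult_left_mono) (auto simp: algebra_simps intro: order_trans)
      finally show ?thesis by (simp add: mult.assoc)
    qed
    have "G k x = (e \<bullet> ?y) / s\<^sup>2 * gauss s ?y" using u(3) h(1)[of k] by (simp add: G_def)
    then have "\<bar>G k x\<bar> = \<bar>e \<bullet> ?y\<bar> / s\<^sup>2 * gauss s ?y" by (simp add: abs_mult abs_of_pos[OF gauss_pos])
    also have "\<dots> \<le> (norm e * (1 + norm e) * (1 + norm x)) / s\<^sup>2 * (exp ((norm e)\<^sup>2 / (2 * s\<^sup>2)) * gauss (sqrt 2 * s) x)"
      by (intro mult_mono divide_right_mono i g) (auto simp: less_imp_le)
    finally show ?thesis by (simp add: C_def mult_ac)
  qed
  have s2: "0 < sqrt 2 * s" using s by simp
  have dom: "integrable lborel (\<lambda>x::real^'n. (c * C * (1 + norm x)\<^sup>2) * gauss (sqrt 2 * s) x)"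
    using c0 C0 by (intro gauss_weight_integrable[OF s2, where c="c * C"]) (auto simp: abs_mult)
  have FGb: "norm (F x * G k x) \<le> (c * C * (1 + norm x)\<^sup>2) * gauss (sqrt 2 * s) x" for k x
  proof -
    have "\<bar>F x\<bar> * \<bar>G k x\<bar> \<le> (c * (1 + norm x)) * (C * (1 + norm x) * gauss (sqrt 2 * s) x)"
      using c0 by (intro mult_mono growth Gb) auto
    then show ?thesis by (simp add: abs_mult power2_eq_square mult_ac)
  qed
  have Fi: "integrable lborel (\<lambda>x. F x * gauss s x)" by (rule gauss_weight_integrable[OF s F growth2])
  have e1: "(\<lambda>k. \<integral>x. D k x * gauss s x \<partial>lborel) \<longlonglongrightarrow> (\<integral>x. F' x * gauss s x \<partial>lborel)"
  proof (rule integral_dominated_convergence[where w="\<lambda>x. L * gauss s x"])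
    show "AE x in lborel. (\<lambda>k. D k x * gauss s x) \<longlonglongrightarrow> F' x * gauss s x"
      by (intro AE_I2 tendsto_mult Dlim tendsto_const)
    show "AE x in lborel. norm (D k x * gauss s x) \<le> L * gauss s x" for k
      by (intro AE_I2) (simp add: abs_mult abs_of_pos[OF gauss_pos] mult_right_mono Db)
  qed (use gauss_integrable[OF s] in auto)
  have e2: "(\<lambda>k. \<integral>x. F x * G k x \<partial>lborel) \<longlonglongrightarrow> (\<integral>x. F x * ((e \<bullet> x) / s\<^sup>2 * gauss s x) \<partial>lborel)"
  proof (rule integral_dominated_convergence[where w="\<lambda>x. (c * C * (1 + norm x)\<^sup>2) * gauss (sqrt 2 * s) x"])
    show "AE x in lborel. (\<lambda>k. F x * G k x) \<longlonglongrightarrow> F x * ((e \<bullet> x) / s\<^sup>2 * gauss s x)"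
      by (intro AE_I2 tendsto_mult Glim tendsto_const)
    show "AE x in lborel. norm (F x * G k x) \<le> (c * C * (1 + norm x)\<^sup>2) * gauss (sqrt 2 * s) x" for k
      by (intro AE_I2 FGb)
  qed (use dom in measurable)
  have "(\<integral>x. D k x * gauss s x \<partial>lborel) = (\<integral>x. F x * G k x \<partial>lborel)" for k
  proof -
    let ?e = "h k *\<^sub>R e"
    have sh: "(\<integral>x. f x \<partial>lborel) = (\<integral>x. f (?e + x) \<partial>lborel)" if [measurable]: "f \<in> borel_measurable borel" for f :: "real^'n \<Rightarrow> real"
      by (subst lborel_distr_plus[of ?e, symmetric]) (simp add: integral_distr)
    have shi: "integrable lborel f \<longleftrightarrow> integrable lborel (\<lambda>x. f (?e + x))" if [measurable]: "f \<in> borel_measurable borel" for f :: "real^'n \<Rightarrow> real"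
      by (subst lborel_distr_plus[of ?e, symmetric]) (simp add: integrable_distr_eq)
    have i2: "integrable lborel (\<lambda>x. F x * gauss s (x - ?e))"
    proof -
      have "integrable lborel (\<lambda>x. F x * G k x)"
        by (rule Bochner_Integration.integrable_bound[OF dom])
          (measurable, intro AE_I2 order_trans[OF FGb], simp)
      then have "integrable lborel (\<lambda>x. h k * (F x * G k x) + F x * gauss s x)"
        by (intro Bochner_Integration.integrable_add integrable_mult_right Fi)
      moreover have "(\<lambda>x. h k * (F x * G k x) + F x * gauss s x) = (\<lambda>x. F x * gauss s (x - ?e))"
      proof
        fix x
        have "h k * G k x = gauss s (x - ?e) - gauss s x" using h(1)[of k] by (simp add: G_def)
        then have "h k * (F x * G k x) = F x * (gauss s (x - ?e) - gauss s x)" by (simp add: mult.left_commute)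
        then show "h k * (F x * G k x) + F x * gauss s x = F x * gauss s (x - ?e)" by (simp add: algebra_simps)
      qed
      ultimately show ?thesis by simp
    qed
    have i1: "integrable lborel (\<lambda>x. F (x + ?e) * gauss s x)"
      using i2 by (subst (asm) shi) (simp_all add: add.commute)
    have "(\<integral>x. D k x * gauss s x \<partial>lborel) = (\<integral>x. (1 / h k) * (F (x + ?e) * gauss s x - F x * gauss s x) \<partial>lborel)"
      by (intro Bochner_Integration.integral_cong) (auto simp: D_def field_simps)
    also have "\<dots> = (1 / h k) * ((\<integral>x. F (x + ?e) * gauss s x \<partial>lborel) - (\<integral>x. F x * gauss s x \<partial>lborel))"
      using i1 Fi by simp
    also have "(\<integral>x. F (x + ?e) * gauss s x \<partial>lborel) = (\<integral>x. F x * gauss s (x - ?e) \<partial>lborel)"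
      by (subst (2) sh) (simp_all add: add.commute)
    also have "(1 / h k) * ((\<integral>x. F x * gauss s (x - ?e) \<partial>lborel) - (\<integral>x. F x * gauss s x \<partial>lborel))
       = (\<integral>x. (1 / h k) * (F x * gauss s (x - ?e) - F x * gauss s x) \<partial>lborel)"
      using i2 Fi by simp
    also have "\<dots> = (\<integral>x. F x * G k x \<partial>lborel)"
      by (intro Bochner_Integration.integral_cong) (auto simp: G_def field_simps)
    finally show ?thesis .
  qed
  with e1 e2 have "(\<integral>x. F' x * gauss s x \<partial>lborel) = (\<integral>x. F x * ((e \<bullet> x) / s\<^sup>2 * gauss s x) \<partial>lborel)"
    by (simp add: LIMSEQ_unique)
  also have "\<dots> = (\<integral>x. (1 / s\<^sup>2) * (F x * (e \<bullet> x) * gauss s x) \<partial>lborel)"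
    by (intro Bochner_Integration.integral_cong) (auto simp: field_simps)
  finally show ?thesis using s by (simp add: field_simps)
qed

lemma gauss_second_moment:
  fixes u v :: "real^'n"
  assumes s: "0 < s"
  shows "(\<integral>x. (u \<bullet> x) * (v \<bullet> x) * gauss s x \<partial>lborel) = s\<^sup>2 * (u \<bullet> v) * (s * sqrt (2 * pi)) ^ CARD('n)"
    and "integrable lborel (\<lambda>x. (u \<bullet> x) * (v \<bullet> x) * gauss s x)"
proof -
  have b: "\<bar>w \<bullet> x\<bar> \<le> norm w * (1 + norm x)" for w x :: "real^'n"
    using Cauchy_Schwarz_ineq2[of w x] mult_left_mono[of "norm x" "1 + norm x" "norm w"] by simp
  have "(\<integral>x. (u \<bullet> x) * (v \<bullet> x) * gauss s x \<partial>lborel) = s\<^sup>2 * (\<integral>x. (u \<bullet> v) * gauss s (x::real^'n) \<partial>lborel)"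
  proof (rule gauss_integration_by_parts[OF s, where L="\<bar>u \<bullet> v\<bar>" and c="norm u"])
    show "((\<lambda>t. u \<bullet> (x + t *\<^sub>R v)) has_real_derivative (u \<bullet> v)) (at 0)" for x
      by (auto intro!: derivative_eq_intros simp: inner_add_right)
    show "\<bar>u \<bullet> (x + t *\<^sub>R v) - u \<bullet> x\<bar> \<le> \<bar>u \<bullet> v\<bar> * \<bar>t\<bar>" for x t
      by (simp add: inner_add_right abs_mult mult.commute)
  qed (use b in auto)
  then show "(\<integral>x. (u \<bullet> x) * (v \<bullet> x) * gauss s x \<partial>lborel) = s\<^sup>2 * (u \<bullet> v) * (s * sqrt (2 * pi)) ^ CARD('n)"
    by (simp add: gauss_integral[OF s])
  show "integrable lborel (\<lambda>x. (u \<bullet> x) * (v \<bullet> x) * gauss s x)"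
  proof (rule gauss_weight_integrable[OF s, where c="norm u * norm v"])
    show "\<bar>(u \<bullet> x) * (v \<bullet> x)\<bar> \<le> norm u * norm v * (1 + norm x)\<^sup>2" for x
      using mult_mono[OF b[of u x] b[of v x]] by (simp add: abs_mult power2_eq_square mult_ac)
  qed measurable
qed

lemma gauss_first_moment:
  fixes v :: "real^'n"
  assumes s: "0 < s"
  shows "(\<integral>x. (v \<bullet> x) * gauss s x \<partial>lborel) = 0"
  using gauss_integration_by_parts[OF s, where F="\<lambda>_. 1" and F'="\<lambda>_. 0" and e=v and L=0 and c=1] by simp

lemma gauss_norm_moment:
  assumes s: "0 < s"
  shows "integrable lborel (\<lambda>x::real^'n. norm x * gauss s x)"
    and "(\<integral>(x::real^'n). norm x * gauss s x \<partial>lborel) \<le> s * sqrt (CARD('n)) * (s * sqrt (2 * pi)) ^ CARD('n)"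
proof -
  let ?n = "real CARD('n)" and ?W = "(s * sqrt (2 * pi)) ^ CARD('n)"
  show i: "integrable lborel (\<lambda>x::real^'n. norm x * gauss s x)"
    by (rule gauss_weight_integrable[OF s, where c=1]) (auto simp: power2_eq_square algebra_simps)
  have i2: "integrable lborel (\<lambda>x::real^'n. (norm x)\<^sup>2 * gauss s x)"
    by (rule gauss_weight_integrable[OF s, where c=1]) (auto simp: power_mono)
  have "(\<integral>(x::real^'n). (norm x)\<^sup>2 * gauss s x \<partial>lborel) = (\<integral>(x::real^'n). (\<Sum>b\<in>Basis. (b \<bullet> x) * (b \<bullet> x) * gauss s x) \<partial>lborel)"
    by (intro Bochner_Integration.integral_cong refl)
      (simp add: power2_norm_eq_inner euclidean_inner[of x x for x] inner_commute sum_distrib_right)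
  also have "\<dots> = (\<Sum>b\<in>(Basis::(real^'n) set). s\<^sup>2 * (b \<bullet> b) * ?W)"
    by (subst Bochner_Integration.integral_sum) (auto intro: gauss_second_moment[OF s] simp: gauss_second_moment[OF s])
  also have "\<dots> = ?n * s\<^sup>2 * ?W" by simp
  finally have m2: "(\<integral>(x::real^'n). (norm x)\<^sup>2 * gauss s x \<partial>lborel) = ?n * s\<^sup>2 * ?W" .
  define r where "r = s * sqrt ?n"
  have r: "0 < r" "r\<^sup>2 = ?n * s\<^sup>2" using s by (auto simp: r_def power_mult_distrib)
  have "(\<integral>(x::real^'n). norm x * gauss s x \<partial>lborel) \<le> (\<integral>(x::real^'n). (1 / (2 * r)) * ((norm x)\<^sup>2 * gauss s x) + (r / 2) * gauss s x \<partial>lborel)"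
  proof (rule integral_mono[OF i])
    show "integrable lborel (\<lambda>x::real^'n. (1 / (2 * r)) * ((norm x)\<^sup>2 * gauss s x) + (r / 2) * gauss s x)"
      by (intro Bochner_Integration.integrable_add integrable_mult_right i2 gauss_integrable s)
    fix x :: "real^'n"
    have "2 * r * norm x \<le> (norm x)\<^sup>2 + r\<^sup>2" using zero_le_power2[of "norm x - r"] by (simp add: power2_eq_square algebra_simps)
    then have "norm x \<le> (1 / (2 * r)) * (norm x)\<^sup>2 + r / 2" using r(1) by (simp add: field_simps power2_eq_square)
    then have "norm x * gauss s x \<le> ((1 / (2 * r)) * (norm x)\<^sup>2 + r / 2) * gauss s x" by (intro mult_right_mono) (simp_all add: less_imp_le)
    then show "norm x * gauss s x \<le> (1 / (2 * r)) * ((norm x)\<^sup>2 * gauss s x) + (r / 2) * gauss s x" by (simp add: distrib_right mult.assoc)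
  qed
  also have "\<dots> = (1 / (2 * r)) * (r\<^sup>2 * ?W) + (r / 2) * ?W"
    by (simp only: Bochner_Integration.integral_add integrable_mult_right i2 gauss_integrable[OF s]
        integral_mult_right_zero m2 gauss_integral[OF s] r(2))
  also have "\<dots> = r * ?W" using r(1) by (simp add: power2_eq_square)
  finally show "(\<integral>(x::real^'n). norm x * gauss s x \<partial>lborel) \<le> s * sqrt (CARD('n)) * ?W" by (simp add: r_def)
qed

lemma nn_integral_linear_substitution:
  fixes f :: "real^'n::{finite,wellorder} \<Rightarrow> real^'n::_"
  assumes f: "linear f" and d: "det (matrix f) \<noteq> 0" and [measurable]: "g \<in> borel_measurable borel"
  shows "(\<integral>\<^sup>+x. g x \<partial>lborel) = ennreal \<bar>det (matrix f)\<bar> * (\<integral>\<^sup>+y. g (f y) \<partial>lborel)"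
proof -
  have [measurable]: "f \<in> borel_measurable borel"
    using f by (intro borel_measurable_continuous_onI linear_continuous_on) (simp add: linear_linear)
  have "(\<integral>\<^sup>+x. g x \<partial>lborel) = (\<integral>\<^sup>+x. g x \<partial>(density (distr lborel borel f) (\<lambda>_. ennreal \<bar>det (matrix f)\<bar>)))"
    using lborel_linear_image[OF f d] by simp
  also have "\<dots> = ennreal \<bar>det (matrix f)\<bar> * (\<integral>\<^sup>+y. g (f y) \<partial>lborel)"
    by (simp add: nn_integral_density nn_integral_distr nn_integral_cmult)
  finally show ?thesis .
qed

text \<open>The classical formula for the Gaussian integral of a quadratic form, solved for the determinant: it
  converts bounds on the form, or on its trace, into bounds on the determinant without eigenvalues.\<close>

lemma gaussian_integral_quadratic_form:
  fixes A :: "real^'n::{finite,wellorder}^'n::_"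
  assumes sym: "transpose A = A" and pos: "\<And>v. v \<noteq> 0 \<Longrightarrow> 0 < v \<bullet> (A *v v)"
  shows "\<exists>J>0. (\<integral>\<^sup>+x. ennreal (exp (- (x \<bullet> (A *v x)) / 2)) \<partial>lborel) = ennreal J \<and> J\<^sup>2 * det A = ((2 * pi) ^ CARD('n))"
proof -
  obtain B :: "real^'n::_^'n::_" where B: "B ** A ** transpose B = mat 1"
    by (rule whitening_exists[OF sym pos])
  let ?f = "\<lambda>y. transpose B *v y"
  have d: "(det B)\<^sup>2 * det A = 1" using det_conjugation[of B A] B by (simp add: det_I)
  then have dB: "det B \<noteq> 0" by auto
  have q: "?f y \<bullet> (A *v ?f y) = (norm y)\<^sup>2" for y
  proof -
    have "?f y \<bullet> (A *v ?f y) = y \<bullet> ((B ** A ** transpose B) *v y)"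
    proof -
      have "y \<bullet> (B *v z) = (transpose B *v y) \<bullet> z" for z
        by (simp add: dot_lmul_matrix)
      then show ?thesis unfolding matrix_vector_mul_assoc[symmetric] by metis
    qed
    then show ?thesis unfolding B power2_norm_eq_inner by (simp only: matrix_vector_mul_lid)
  qed
  have mf: "matrix ?f = transpose B" by (rule matrix_of_matrix_vector_mul)
  have [measurable]: "(\<lambda>x. x \<bullet> (A *v x)) \<in> borel_measurable borel"
    by (intro borel_measurable_continuous_onI continuous_on_inner continuous_on_id matrix_vector_mult_linear_continuous_on)
  have "(\<integral>\<^sup>+x. ennreal (exp (- (x \<bullet> (A *v x)) / 2)) \<partial>lborel)
      = ennreal \<bar>det B\<bar> * (\<integral>\<^sup>+y. ennreal (gauss 1 (y::real^'n::_)) \<partial>lborel)"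
  proof -
    have "(\<integral>\<^sup>+x. ennreal (exp (- (x \<bullet> (A *v x)) / 2)) \<partial>lborel)
      = ennreal \<bar>det (matrix ?f)\<bar> * (\<integral>\<^sup>+y. ennreal (exp (- (?f y \<bullet> (A *v ?f y)) / 2)) \<partial>lborel)"
    proof (rule nn_integral_linear_substitution)
      show "linear ?f" by (rule matrix_vector_mul_linear)
      show "det (matrix ?f) \<noteq> 0" unfolding mf det_transpose by (rule dB)
    qed measurable
    also have "\<bar>det (matrix ?f)\<bar> = \<bar>det B\<bar>" unfolding mf det_transpose ..
    also have "(\<lambda>y. ennreal (exp (- (?f y \<bullet> (A *v ?f y)) / 2))) = (\<lambda>y. ennreal (gauss 1 y))"
      unfolding q gauss_def by (simp only: one_power2 mult_1_right)
    finally show ?thesis .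
  qed
  also have "\<dots> = ennreal (\<bar>det B\<bar> * sqrt (2 * pi) ^ CARD('n))"
    using gauss_nn_integral[of 1, where 'n='n] by (simp add: ennreal_mult)
  finally have J: "(\<integral>\<^sup>+x. ennreal (exp (- (x \<bullet> (A *v x)) / 2)) \<partial>lborel) = ennreal (\<bar>det B\<bar> * sqrt (2 * pi) ^ CARD('n))" .
  have "(\<bar>det B\<bar> * sqrt (2 * pi) ^ CARD('n))\<^sup>2 * det A = ((det B)\<^sup>2 * det A) * ((sqrt (2 * pi))\<^sup>2) ^ CARD('n)"
  proof -
    have "(\<bar>det B\<bar> * sqrt (2 * pi) ^ CARD('n))\<^sup>2 = (det B)\<^sup>2 * (sqrt (2 * pi) ^ CARD('n))\<^sup>2"
      by (simp only: power_mult_distrib power2_abs)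
    moreover have "(sqrt (2 * pi) ^ CARD('n))\<^sup>2 = ((sqrt (2 * pi))\<^sup>2) ^ CARD('n)"
      by (simp only: power_mult[symmetric] mult.commute)
    ultimately show ?thesis by (simp only: ac_simps)
  qed
  also have "\<dots> = (2 * pi) ^ CARD('n)" unfolding d by simp
  finally show ?thesis using J dB by (intro exI[of _ "\<bar>det B\<bar> * sqrt (2 * pi) ^ CARD('n)"]) simp
qed

lemma gauss_nn_integral_scaled:
  assumes \<delta>: "0 < \<delta>"
  shows "gauss (1 / sqrt \<delta>) x = exp (- \<delta> * (x \<bullet> x) / 2)"
    "(1 / sqrt \<delta> * sqrt (2 * pi)) ^ k > 0" "((1 / sqrt \<delta> * sqrt (2 * pi)) ^ k)\<^sup>2 * \<delta> ^ k = (2 * pi) ^ k"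
proof -
  show "gauss (1 / sqrt \<delta>) x = exp (- \<delta> * (x \<bullet> x) / 2)"
    using \<delta> by (simp add: gauss_def power2_norm_eq_inner power_divide field_simps)
  show "(1 / sqrt \<delta> * sqrt (2 * pi)) ^ k > 0" using \<delta> by simp
  have "((1 / sqrt \<delta> * sqrt (2 * pi)) ^ k)\<^sup>2 * \<delta> ^ k = ((1 / sqrt \<delta> * sqrt (2 * pi))\<^sup>2 * \<delta>) ^ k"
    by (simp only: power_mult_distrib power_mult[symmetric] mult.commute[of k 2])
  also have "(1 / sqrt \<delta> * sqrt (2 * pi))\<^sup>2 * \<delta> = 2 * pi" using \<delta> by (simp add: power_mult_distrib power_divide)
  finally show "((1 / sqrt \<delta> * sqrt (2 * pi)) ^ k)\<^sup>2 * \<delta> ^ k = (2 * pi) ^ k" .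
qed

lemma det_ge_of_quadratic_form_ge:
  fixes A :: "real^'n::{finite,wellorder}^'n::_"
  assumes sym: "transpose A = A" and \<delta>: "0 < \<delta>" and ge: "\<And>v. \<delta> * (v \<bullet> v) \<le> v \<bullet> (A *v v)"
  shows "\<delta> ^ CARD('n) \<le> det A"
proof -
  have pos: "0 < v \<bullet> (A *v v)" if "v \<noteq> 0" for v
    using ge[of v] \<delta> that by (meson inner_gt_zero_iff less_le_trans mult_pos_pos)
  obtain J where J: "0 < J" "(\<integral>\<^sup>+x. ennreal (exp (- (x \<bullet> (A *v x)) / 2)) \<partial>lborel) = ennreal J" "J\<^sup>2 * det A = ((2 * pi) ^ CARD('n))"
    using gaussian_integral_quadratic_form[OF sym pos] by metis
  let ?V = "(1 / sqrt \<delta> * sqrt (2 * pi)) ^ CARD('n)"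
  note V = gauss_nn_integral_scaled[OF \<delta>]
  have "ennreal J \<le> (\<integral>\<^sup>+x. ennreal (gauss (1 / sqrt \<delta>) (x::real^'n::_)) \<partial>lborel)"
    unfolding J(2)[symmetric] V(1) using ge by (intro nn_integral_mono ennreal_leI) simp
  also have "\<dots> = ennreal ?V" using \<delta> by (intro gauss_nn_integral) simp
  finally have "J \<le> ?V" using V(2)[of "CARD('n)"] by (simp add: ennreal_le_iff)
  then have "J\<^sup>2 * \<delta> ^ CARD('n) \<le> ?V\<^sup>2 * \<delta> ^ CARD('n)"
    using J(1) \<delta> by (intro mult_right_mono power_mono) auto
  also have "\<dots> = J\<^sup>2 * det A" unfolding V(3) J(3) ..
  finally show ?thesis using J(1) by simp
qed

text \<open>The arithmetic-geometric mean inequality for the eigenvalues of \<open>A\<close>.  The Gaussian integral of the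
  form is bounded from below by \<open>exp u \<ge> 1 + u\<close> applied to \<open>u = (\<delta> |x|\<^sup>2 - x \<bullet> A x) / 2\<close>, whose mean
  under the Gaussian law of variance \<open>1 / \<delta>\<close> is nonnegative when the trace is at most \<open>n \<delta>\<close>.\<close>

lemma det_le_of_trace_le:
  fixes A :: "real^'n::{finite,wellorder}^'n::_"
  assumes sym: "transpose A = A" and pos: "\<And>v. v \<noteq> 0 \<Longrightarrow> 0 < v \<bullet> (A *v v)"
    and \<delta>: "0 < \<delta>" and tr: "trace A \<le> real CARD('n) * \<delta>"
  shows "det A \<le> \<delta> ^ CARD('n)"
proof -
  obtain J where J: "0 < J" "(\<integral>\<^sup>+x. ennreal (exp (- (x \<bullet> (A *v x)) / 2)) \<partial>lborel) = ennreal J" "J\<^sup>2 * det A = ((2 * pi) ^ CARD('n))"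
    using gaussian_integral_quadratic_form[OF sym pos] by metis
  let ?s = "1 / sqrt \<delta>" and ?V = "(1 / sqrt \<delta> * sqrt (2 * pi)) ^ CARD('n)"
  have s: "0 < ?s" using \<delta> by simp
  note V = gauss_nn_integral_scaled[OF \<delta>]
  have [measurable]: "(\<lambda>x. x \<bullet> (A *v x)) \<in> borel_measurable borel"
    by (intro borel_measurable_continuous_onI continuous_on_inner continuous_on_id matrix_vector_mult_linear_continuous_on)
  have iJ: "integrable lborel (\<lambda>x. exp (- (x \<bullet> (A *v x)) / 2))"
  proof (rule integrableI_nonneg)
    show "(\<integral>\<^sup>+x. ennreal (exp (- (x \<bullet> (A *v x)) / 2)) \<partial>lborel) < \<infinity>" unfolding J(2) by simp
  qed auto
  have J': "(\<integral>x. exp (- (x \<bullet> (A *v x)) / 2) \<partial>lborel) = J"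
    using J(1,2) by (simp add: integral_eq_nn_integral)
  have e1: "x \<bullet> x = (\<Sum>i\<in>UNIV. (axis i 1 \<bullet> x) * (axis i 1 \<bullet> x))" for x :: "real^'n::_"
    by (simp only: inner_axis') (simp add: inner_vec_def)
  have e2: "x \<bullet> (A *v x) = (\<Sum>i\<in>UNIV. (axis i 1 \<bullet> x) * (row i A \<bullet> x))" for x
    by (simp add: inner_vec_def[of x] inner_axis' matrix_vector_mul_component row_def)
  note m = gauss_second_moment[OF s]
  have i1: "integrable lborel (\<lambda>x::real^'n::_. (x \<bullet> x) * gauss ?s x)"
    unfolding e1 sum_distrib_right by (intro Bochner_Integration.integrable_sum m)
  have i2: "integrable lborel (\<lambda>x::real^'n::_. (x \<bullet> (A *v x)) * gauss ?s x)"
    unfolding e2 sum_distrib_right by (intro Bochner_Integration.integrable_sum m)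
  have m1: "(\<integral>(x::real^'n::_). (x \<bullet> x) * gauss ?s x \<partial>lborel) = real CARD('n) / \<delta> * ?V"
    unfolding e1 sum_distrib_right using \<delta> by (subst Bochner_Integration.integral_sum) (auto intro: m simp: m inner_axis_axis power_divide)
  have m2: "(\<integral>(x::real^'n::_). (x \<bullet> (A *v x)) * gauss ?s x \<partial>lborel) = trace A / \<delta> * ?V"
  proof -
    have "axis i 1 \<bullet> row i A = A $ i $ i" for i by (simp add: inner_axis' row_def)
    then have "(\<integral>(x::real^'n::_). (x \<bullet> (A *v x)) * gauss ?s x \<partial>lborel) = (\<Sum>i\<in>UNIV. ?s\<^sup>2 * A$i$i * ?V)"
      unfolding e2 sum_distrib_right by (subst Bochner_Integration.integral_sum) (auto intro: m simp: m)
    then show ?thesis using \<delta> by (simp add: trace_def power_divide sum_divide_distrib sum_distrib_right)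
  qed
  have ig: "integrable lborel (\<lambda>x::real^'n::_. gauss ?s x)" by (rule gauss_integrable[OF s])
  have "(\<integral>(x::real^'n::_). gauss ?s x + (\<delta> / 2) * ((x \<bullet> x) * gauss ?s x) - (1 / 2) * ((x \<bullet> (A *v x)) * gauss ?s x) \<partial>lborel) \<le> J"
    unfolding J'[symmetric]
  proof (rule integral_mono[OF _ iJ])
    show "integrable lborel (\<lambda>x::real^'n::_. gauss ?s x + (\<delta> / 2) * ((x \<bullet> x) * gauss ?s x) - (1 / 2) * ((x \<bullet> (A *v x)) * gauss ?s x))"
      by (intro Bochner_Integration.integrable_diff Bochner_Integration.integrable_add integrable_mult_right i1 i2 ig)
    fix x :: "real^'n::_"
    have "1 + (\<delta> / 2 * (x \<bullet> x) - (x \<bullet> (A *v x)) / 2) \<le> exp (\<delta> / 2 * (x \<bullet> x) - (x \<bullet> (A *v x)) / 2)"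
      by (rule exp_ge_add_one_self)
    then have "(1 + (\<delta> / 2 * (x \<bullet> x) - (x \<bullet> (A *v x)) / 2)) * gauss ?s x \<le> exp (\<delta> / 2 * (x \<bullet> x) - (x \<bullet> (A *v x)) / 2) * gauss ?s x"
      by (intro mult_right_mono) (simp_all add: less_imp_le)
    also have "\<dots> = exp (- (x \<bullet> (A *v x)) / 2)" unfolding V(1) by (simp flip: exp_add)
    finally show "gauss ?s x + (\<delta> / 2) * ((x \<bullet> x) * gauss ?s x) - (1 / 2) * ((x \<bullet> (A *v x)) * gauss ?s x) \<le> exp (- (x \<bullet> (A *v x)) / 2)"
      by (simp add: algebra_simps)
  qed
  moreover have "(\<integral>(x::real^'n::_). gauss ?s x + (\<delta> / 2) * ((x \<bullet> x) * gauss ?s x) - (1 / 2) * ((x \<bullet> (A *v x)) * gauss ?s x) \<partial>lborel)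
     = ?V + (\<delta> / 2) * (real CARD('n) / \<delta> * ?V) - (1 / 2) * (trace A / \<delta> * ?V)"
    by (simp only: Bochner_Integration.integral_diff Bochner_Integration.integral_add integral_mult_right_zero
        Bochner_Integration.integrable_diff Bochner_Integration.integrable_add integrable_mult_right i1 i2 ig m1 m2 gauss_integral[OF s])
  moreover have "?V + (\<delta> / 2) * (real CARD('n) / \<delta> * ?V) - (1 / 2) * (trace A / \<delta> * ?V) \<ge> ?V"
  proof -
    have "trace A / \<delta> \<le> real CARD('n)" using tr \<delta> by (simp add: field_simps)
    then have "trace A / \<delta> * ?V \<le> real CARD('n) * ?V" using V(2)[of "CARD('n)"] by (intro mult_right_mono) auto
    then show ?thesis using \<delta> by simp
  qed
  ultimately have "?V \<le> J" by linarith
  then have "?V\<^sup>2 * \<delta> ^ CARD('n) \<le> J\<^sup>2 * \<delta> ^ CARD('n)"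
    using V(2)[of "CARD('n)"] \<delta> by (intro mult_right_mono power_mono) auto
  then have "J\<^sup>2 * det A \<le> J\<^sup>2 * \<delta> ^ CARD('n)" unfolding V(3) J(3) .
  then show ?thesis using J(1) by simp
qed

section \<open>Exponential tilts of a compactly supported measure\<close>

lemma exp_minus_linear_bound: "\<bar>exp u - 1 - u\<bar> \<le> u\<^sup>2 * exp \<bar>u\<bar>" for u :: real
proof -
  obtain t where t: "\<bar>t\<bar> \<le> \<bar>u\<bar>" "exp u = (\<Sum>m<2. u ^ m / fact m) + exp t / fact 2 * u ^ 2"
    using Maclaurin_exp_le[of u 2] by blast
  then have "exp u - 1 - u = exp t / 2 * u\<^sup>2" by (simp add: numeral_2_eq_2)
  then have "\<bar>exp u - 1 - u\<bar> = exp t / 2 * u\<^sup>2" by (simp only:) simp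
  also have "\<dots> \<le> exp \<bar>u\<bar> * u\<^sup>2"
  proof (rule mult_right_mono)
    have "exp t \<le> exp \<bar>u\<bar>" using t(1) by simp
    moreover have "exp t / 2 \<le> exp t" by simp
    ultimately show "exp t / 2 \<le> exp \<bar>u\<bar>" by linarith
  qed simp
  finally show ?thesis by (simp add: mult.commute)
qed

text \<open>The condition \<open>nondegenerate\<close> says that the measure is not carried by a hyperplane; it makes all
  covariances positive definite.\<close>

locale compact_measure = finite_measure M for M :: "(real^'n) measure" +
  fixes \<rho> :: real
  assumes sets_M [measurable_cong]: "sets M = sets borel"
    and bounded: "AE x in M. norm x \<le> \<rho>"
    and nondegenerate: "\<And>v c. v \<noteq> 0 \<Longrightarrow> \<not> (AE x in M. v \<bullet> x = c)"
begin

lemma space_M [simp]: "space M = UNIV"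
  using sets_eq_imp_space_eq[OF sets_M] by simp

lemma rho_nonneg: "0 \<le> \<rho>"
proof (rule ccontr)
  assume "\<not> ?thesis"
  then have "\<not> norm x \<le> \<rho>" for x :: "real^'n" using norm_ge_zero[of x] by linarith
  then have "AE x in M. False" using bounded by simp
  then have "AE x in M. axis undefined 1 \<bullet> x = 0" by eventually_elim simp
  then show False using nondegenerate[of "axis undefined 1" 0] by simp
qed

text \<open>Observables that are essentially bounded, so that all their exponential tilts are integrable.\<close>

definition adm :: "(real^'n \<Rightarrow> real) \<Rightarrow> bool" where
  "adm \<phi> \<longleftrightarrow> \<phi> \<in> borel_measurable borel \<and> (\<exists>C. AE x in M. \<bar>\<phi> x\<bar> \<le> C)"

lemma adm_measurable: "adm \<phi> \<Longrightarrow> \<phi> \<in> borel_measurable borel"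
  by (simp add: adm_def)

lemma adm_bound:
  assumes "adm \<phi>" obtains C where "0 \<le> C" "AE x in M. \<bar>\<phi> x\<bar> \<le> C"
proof -
  obtain C where C: "AE x in M. \<bar>\<phi> x\<bar> \<le> C" using assms by (auto simp: adm_def)
  show thesis
    by (rule that[of "max 0 C"]) (use C in \<open>auto elim: eventually_mono\<close>)
qed

lemma adm_const [simp, intro]: "adm (\<lambda>_. c)"
  unfolding adm_def by (auto intro!: exI[of _ "\<bar>c\<bar>"])

lemma adm_inner [simp, intro]: "adm (\<lambda>x. v \<bullet> x)"
proof -
  have "AE x in M. \<bar>v \<bullet> x\<bar> \<le> norm v * \<rho>"
    using bounded by eventually_elim (meson Cauchy_Schwarz_ineq2 mult_left_mono norm_ge_zero order_trans)
  then show ?thesis unfolding adm_def by (auto intro!: exI[of _ "norm v * \<rho>"])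
qed

lemma adm_component [simp, intro]: "adm (\<lambda>x. x $ i)"
  using adm_inner[of "axis i 1"] by (simp add: inner_axis')

lemma adm_add [simp, intro]:
  assumes "adm \<phi>" "adm \<psi>" shows "adm (\<lambda>x. \<phi> x + \<psi> x)"
proof -
  obtain C D where "AE x in M. \<bar>\<phi> x\<bar> \<le> C" "AE x in M. \<bar>\<psi> x\<bar> \<le> D" using assms by (auto simp: adm_def)
  then have "AE x in M. \<bar>\<phi> x + \<psi> x\<bar> \<le> C + D" by eventually_elim linarith
  then show ?thesis using assms by (auto simp: adm_def)
qed

lemma adm_mult [simp, intro]:
  assumes "adm \<phi>" "adm \<psi>" shows "adm (\<lambda>x. \<phi> x * \<psi> x)"
proof -
  obtain C where C: "0 \<le> C" "AE x in M. \<bar>\<phi> x\<bar> \<le> C" by (rule adm_bound[OF assms(1)])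
  obtain D where D: "0 \<le> D" "AE x in M. \<bar>\<psi> x\<bar> \<le> D" by (rule adm_bound[OF assms(2)])
  have "AE x in M. \<bar>\<phi> x * \<psi> x\<bar> \<le> C * D"
    using C(2) D(2) by eventually_elim (simp add: abs_mult mult_mono C(1))
  then show ?thesis using assms by (auto simp: adm_def)
qed

lemma adm_diff [simp, intro]: "adm \<phi> \<Longrightarrow> adm \<psi> \<Longrightarrow> adm (\<lambda>x. \<phi> x - \<psi> x)"
  using adm_add[of \<phi> "\<lambda>x. (-1) * \<psi> x"] adm_mult[OF adm_const, of \<psi> "-1"] by simp

lemma adm_sum [simp, intro]: "(\<And>i. i \<in> I \<Longrightarrow> adm (f i)) \<Longrightarrow> adm (\<lambda>x. \<Sum>i\<in>I. f i x)"
  by (induction I rule: infinite_finite_induct) auto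

lemma adm_power [simp, intro]: "adm \<phi> \<Longrightarrow> adm (\<lambda>x. (\<phi> x) ^ k)"
  by (induction k) auto

lemma AE_exp_le: "AE x in M. exp (\<xi> \<bullet> x) \<le> exp (norm \<xi> * \<rho>)"
  using bounded
proof eventually_elim
  case (elim x)
  have "\<xi> \<bullet> x \<le> norm \<xi> * norm x" by (rule norm_cauchy_schwarz)
  also have "\<dots> \<le> norm \<xi> * \<rho>" using elim by (intro mult_left_mono) auto
  finally show ?case by simp
qed

lemma integrable_mom: assumes "adm \<phi>" shows "integrable M (\<lambda>x. \<phi> x * exp (\<xi> \<bullet> x))"
proof -
  obtain C where C: "0 \<le> C" "AE x in M. \<bar>\<phi> x\<bar> \<le> C" by (rule adm_bound[OF assms])
  note adm_measurable[OF assms, measurable]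
  show ?thesis
  proof (rule integrable_const_bound)
    show "AE x in M. norm (\<phi> x * exp (\<xi> \<bullet> x)) \<le> C * exp (norm \<xi> * \<rho>)"
      using C(2) AE_exp_le[of \<xi>] by eventually_elim (simp add: abs_mult mult_mono C(1))
  qed measurable
qed

text \<open>For the constant function \<open>1\<close> this is the Laplace transform of \<open>M\<close>, and \<open>mean\<close> below is the
  expectation under the law with density proportional to \<open>exp (\<xi> \<bullet> x)\<close>.\<close>

definition mom :: "(real^'n \<Rightarrow> real) \<Rightarrow> real^'n \<Rightarrow> real" where
  "mom \<phi> \<xi> = (\<integral>x. \<phi> x * exp (\<xi> \<bullet> x) \<partial>M)"

lemma mom_add: "adm \<phi> \<Longrightarrow> adm \<psi> \<Longrightarrow> mom (\<lambda>x. \<phi> x + \<psi> x) \<xi> = mom \<phi> \<xi> + mom \<psi> \<xi>"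
  by (simp add: mom_def distrib_right integrable_mom)

lemma mom_cmult: "mom (\<lambda>x. c * \<phi> x) \<xi> = c * mom \<phi> \<xi>"
  by (simp add: mom_def mult.assoc)

lemma mom_pos: "0 < mom (\<lambda>_. 1) \<xi>"
proof -
  have "0 \<le> mom (\<lambda>_. 1) \<xi>" unfolding mom_def by (intro integral_nonneg_AE) auto
  moreover have "mom (\<lambda>_. 1) \<xi> \<noteq> 0"
  proof
    assume "mom (\<lambda>_. 1) \<xi> = 0"
    then have "AE x in M. 1 * exp (\<xi> \<bullet> x) = 0"
      using integral_nonneg_eq_0_iff_AE[OF integrable_mom[OF adm_const, of 1 \<xi>]] by (simp add: mom_def)
    then have "AE x in M. False" by simp
    then have "AE x in M. axis undefined 1 \<bullet> x = 0" by eventually_elim simp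
    then show False using nondegenerate[of "axis undefined 1" 0] by simp
  qed
  ultimately show ?thesis by simp
qed

text \<open>On the support the second-order remainder of the exponential is at most a constant times the square
  of the increment, so the derivative may be taken under the integral.\<close>

lemma mom_has_derivative:
  assumes \<phi>: "adm \<phi>"
  shows "(mom \<phi> has_derivative (\<lambda>\<eta>. mom (\<lambda>x. \<phi> x * (\<eta> \<bullet> x)) \<xi>)) (at \<xi>)"
  unfolding has_derivative_at_alt
proof (intro conjI allI impI)
  let ?D = "\<lambda>\<eta>. mom (\<lambda>x. \<phi> x * (\<eta> \<bullet> x)) \<xi>"
  have "linear ?D"
  proof (rule linearI)
    fix u v c
    show "?D (u + v) = ?D u + ?D v"
      using \<phi> by (simp add: inner_add_left distrib_left mom_add)
    show "?D (c *\<^sub>R u) = c *\<^sub>R ?D u"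
      using mom_cmult[of c "\<lambda>x. \<phi> x * (u \<bullet> x)"] by (simp add: mult.left_commute)
  qed
  then show "bounded_linear ?D" by (simp add: linear_conv_bounded_linear)
  fix e :: real assume e: "0 < e"
  obtain C where C: "0 \<le> C" "AE x in M. \<bar>\<phi> x\<bar> \<le> C" by (rule adm_bound[OF \<phi>])
  define K where "K = C * exp (norm \<xi> * \<rho>) * (\<rho>\<^sup>2 * exp \<rho>) * measure M UNIV"
  have K0: "0 \<le> K" using C(1) by (simp add: K_def)
  have est: "\<bar>mom \<phi> y - mom \<phi> \<xi> - ?D (y - \<xi>)\<bar> \<le> K * (norm (y - \<xi>))\<^sup>2" if y: "norm (y - \<xi>) \<le> 1" for y
  proof -
    let ?h = "y - \<xi>"
    let ?g = "\<lambda>x. \<phi> x * exp (y \<bullet> x) - \<phi> x * exp (\<xi> \<bullet> x) - \<phi> x * (?h \<bullet> x) * exp (\<xi> \<bullet> x)"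
    have i: "integrable M (\<lambda>x. \<phi> x * exp (y \<bullet> x))" "integrable M (\<lambda>x. \<phi> x * exp (\<xi> \<bullet> x))"
      "integrable M (\<lambda>x. \<phi> x * (?h \<bullet> x) * exp (\<xi> \<bullet> x))"
      using \<phi> by (auto intro: integrable_mom)
    have ig: "integrable M ?g" by (intro Bochner_Integration.integrable_diff i)
    have eq: "mom \<phi> y - mom \<phi> \<xi> - ?D ?h = (\<integral>x. ?g x \<partial>M)"
      unfolding mom_def by (simp only: Bochner_Integration.integral_diff Bochner_Integration.integrable_diff i)
    have "AE x in M. \<bar>?g x\<bar> \<le> C * exp (norm \<xi> * \<rho>) * (\<rho>\<^sup>2 * exp \<rho>) * (norm ?h)\<^sup>2"
      using C(2) AE_exp_le[of \<xi>] bounded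
    proof eventually_elim
      case (elim x)
      let ?u = "?h \<bullet> x"
      have u: "\<bar>?u\<bar> \<le> norm ?h * \<rho>"
        using elim(3) by (meson Cauchy_Schwarz_ineq2 mult_left_mono norm_ge_zero order_trans)
      have "norm ?h * \<rho> \<le> 1 * \<rho>" using y rho_nonneg by (intro mult_right_mono) auto
      then have u1: "\<bar>?u\<bar> \<le> \<rho>" using u by simp
      have "?g x = \<phi> x * exp (\<xi> \<bullet> x) * (exp ?u - 1 - ?u)"
        by (simp add: algebra_simps inner_diff_left exp_diff)
      then have "\<bar>?g x\<bar> = \<bar>\<phi> x\<bar> * exp (\<xi> \<bullet> x) * \<bar>exp ?u - 1 - ?u\<bar>" by (simp add: abs_mult)
      also have "\<dots> \<le> C * exp (norm \<xi> * \<rho>) * (\<rho>\<^sup>2 * exp \<rho> * (norm ?h)\<^sup>2)"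
      proof (intro mult_mono)
        have "\<bar>exp ?u - 1 - ?u\<bar> \<le> ?u\<^sup>2 * exp \<bar>?u\<bar>" by (rule exp_minus_linear_bound)
        also have "\<dots> \<le> (norm ?h * \<rho>)\<^sup>2 * exp \<rho>"
          using u u1 by (intro mult_mono) (auto simp: abs_le_square_iff[symmetric] rho_nonneg)
        finally show "\<bar>exp ?u - 1 - ?u\<bar> \<le> \<rho>\<^sup>2 * exp \<rho> * (norm ?h)\<^sup>2"
          by (simp add: power_mult_distrib mult_ac)
      qed (use elim C(1) in auto)
      finally show ?case by (simp add: mult.assoc)
    qed
    then have "(\<integral>x. \<bar>?g x\<bar> \<partial>M) \<le> (\<integral>x. C * exp (norm \<xi> * \<rho>) * (\<rho>\<^sup>2 * exp \<rho>) * (norm ?h)\<^sup>2 \<partial>M)"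
      using ig by (intro integral_mono_AE) auto
    also have "\<dots> = K * (norm ?h)\<^sup>2" by (simp add: K_def)
    finally show ?thesis unfolding eq using integral_abs_bound[of M ?g] by linarith
  qed
  show "\<exists>d>0. \<forall>y. norm (y - \<xi>) < d \<longrightarrow> norm (mom \<phi> y - mom \<phi> \<xi> - ?D (y - \<xi>)) \<le> e * norm (y - \<xi>)"
  proof (intro exI[of _ "min 1 (e / (K + 1))"] conjI allI impI)
    show "0 < min 1 (e / (K + 1))" using e K0 by simp
    fix y assume y: "norm (y - \<xi>) < min 1 (e / (K + 1))"
    have "K * norm (y - \<xi>) \<le> (K + 1) * norm (y - \<xi>)" by (simp add: mult_right_mono)
    also have "\<dots> \<le> e" using y K0 by (simp add: field_simps)
    finally have "K * norm (y - \<xi>) * norm (y - \<xi>) \<le> e * norm (y - \<xi>)" by (intro mult_right_mono) auto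
    then show "norm (mom \<phi> y - mom \<phi> \<xi> - ?D (y - \<xi>)) \<le> e * norm (y - \<xi>)"
      using est[of y] y by (simp add: power2_eq_square mult.assoc)
  qed
qed

definition mean :: "(real^'n \<Rightarrow> real) \<Rightarrow> real^'n \<Rightarrow> real" where
  "mean \<phi> \<xi> = mom \<phi> \<xi> / mom (\<lambda>_. 1) \<xi>"

lemma mean_const [simp]: "mean (\<lambda>_. c) \<xi> = c"
  using mom_cmult[of c "\<lambda>_. 1" \<xi>] mom_pos[of \<xi>] by (simp add: mean_def)

lemma mean_add: "adm \<phi> \<Longrightarrow> adm \<psi> \<Longrightarrow> mean (\<lambda>x. \<phi> x + \<psi> x) \<xi> = mean \<phi> \<xi> + mean \<psi> \<xi>"
  by (simp add: mean_def mom_add add_divide_distrib)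

lemma mean_cmult: "mean (\<lambda>x. c * \<phi> x) \<xi> = c * mean \<phi> \<xi>"
  by (simp add: mean_def mom_cmult)

lemma mean_multc: "mean (\<lambda>x. \<phi> x * c) \<xi> = mean \<phi> \<xi> * c"
  using mean_cmult[of c \<phi> \<xi>] by (simp add: mult.commute)

lemma mean_diff: "adm \<phi> \<Longrightarrow> adm \<psi> \<Longrightarrow> mean (\<lambda>x. \<phi> x - \<psi> x) \<xi> = mean \<phi> \<xi> - mean \<psi> \<xi>"
  using mean_add[of \<phi> "\<lambda>x. (-1) * \<psi> x" \<xi>] mean_cmult[of "-1" \<psi> \<xi>] adm_mult[OF adm_const, of \<psi> "-1"] by simp

lemma mean_sum: "(\<And>i. i \<in> I \<Longrightarrow> adm (f i)) \<Longrightarrow> mean (\<lambda>x. \<Sum>i\<in>I. f i x) \<xi> = (\<Sum>i\<in>I. mean (f i) \<xi>)"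
  by (induction I rule: infinite_finite_induct) (auto simp: mean_add)

lemma mean_mono:
  assumes "adm \<phi>" "adm \<psi>" "AE x in M. \<phi> x \<le> \<psi> x"
  shows "mean \<phi> \<xi> \<le> mean \<psi> \<xi>"
proof -
  have "mom \<phi> \<xi> \<le> mom \<psi> \<xi>" unfolding mom_def
    by (intro integral_mono_AE integrable_mom assms) (use assms(3) in \<open>auto elim: eventually_mono\<close>)
  then show ?thesis unfolding mean_def using mom_pos[of \<xi>] by (simp add: divide_right_mono)
qed

lemma mean_has_derivative:
  assumes \<phi>: "adm \<phi>"
  shows "(mean \<phi> has_derivative (\<lambda>\<eta>. mean (\<lambda>x. \<phi> x * (\<eta> \<bullet> x)) \<xi> - mean \<phi> \<xi> * mean (\<lambda>x. \<eta> \<bullet> x) \<xi>)) (at \<xi>)"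
proof -
  have Z: "mom (\<lambda>_. 1) \<xi> \<noteq> 0" using mom_pos[of \<xi>] by simp
  have "((\<lambda>\<xi>. mom \<phi> \<xi> / mom (\<lambda>_. 1) \<xi>) has_derivative
     (\<lambda>\<eta>. (mom (\<lambda>x. \<phi> x * (\<eta> \<bullet> x)) \<xi> * mom (\<lambda>_. 1) \<xi> - mom \<phi> \<xi> * mom (\<lambda>x. 1 * (\<eta> \<bullet> x)) \<xi>) / (mom (\<lambda>_. 1) \<xi> * mom (\<lambda>_. 1) \<xi>))) (at \<xi>)"
    by (intro has_derivative_divide' mom_has_derivative \<phi> adm_const Z)
  then show ?thesis
    unfolding mean_def[abs_def]
    by (rule has_derivative_eq_rhs) (use Z in \<open>auto simp: fun_eq_iff divide_simps\<close>)
qed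

lemma mean_line_derivative:
  assumes \<phi>: "adm \<phi>"
  shows "((\<lambda>t. mean \<phi> (\<eta> + t *\<^sub>R v)) has_real_derivative
    (mean (\<lambda>x. \<phi> x * (v \<bullet> x)) (\<eta> + t *\<^sub>R v) - mean \<phi> (\<eta> + t *\<^sub>R v) * mean (\<lambda>x. v \<bullet> x) (\<eta> + t *\<^sub>R v))) (at t)"
proof -
  have "((\<lambda>t. \<eta> + t *\<^sub>R v) has_derivative (\<lambda>s. s *\<^sub>R v)) (at t)"
    by (auto intro!: derivative_eq_intros)
  from has_derivative_compose[OF this mean_has_derivative[OF \<phi>]]
  show ?thesis unfolding has_field_derivative_def
    by (rule has_derivative_eq_rhs)
      (auto simp: fun_eq_iff mean_cmult mult.left_commute[of "\<phi> _"] right_diff_distrib mult.commute[of _ "mean \<phi> _"] ac_simps)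
qed

lemma mean_continuous: "adm \<phi> \<Longrightarrow> continuous_on UNIV (mean \<phi>)"
  by (intro differentiable_imp_continuous_on)
    (auto simp: differentiable_on_def differentiable_def intro: mean_has_derivative)

text \<open>\<open>bary\<close>, \<open>cov\<close> and \<open>third\<close> are the first three derivatives of the logarithmic Laplace transform, the
  last one contracted with a vector.\<close>

definition bary :: "real^'n \<Rightarrow> real^'n" where
  "bary \<xi> = (\<chi> i. mean (\<lambda>x. x $ i) \<xi>)"

lemma bary_nth: "bary \<xi> $ i = mean (\<lambda>x. x $ i) \<xi>"
  by (simp add: bary_def)

definition cov :: "real^'n \<Rightarrow> real^'n^'n" where
  "cov \<xi> = (\<chi> i j. mean (\<lambda>x. x $ i * x $ j) \<xi> - bary \<xi> $ i * bary \<xi> $ j)"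

definition third :: "real^'n \<Rightarrow> real^'n \<Rightarrow> real^'n^'n" where
  "third \<xi> \<eta> = (\<chi> i j. mean (\<lambda>x. (x $ i - bary \<xi> $ i) * (x $ j - bary \<xi> $ j) * (\<eta> \<bullet> (x - bary \<xi>))) \<xi>)"

lemma inner_bary: "v \<bullet> bary \<xi> = mean (\<lambda>x. v \<bullet> x) \<xi>"
  by (simp add: inner_vec_def bary_def mean_sum mean_cmult)

lemma adm_inner_diff [simp, intro]: "adm (\<lambda>x. v \<bullet> (x - c))"
  by (simp add: inner_diff_right)

lemma mean_centered: "mean (\<lambda>x. v \<bullet> (x - bary \<xi>)) \<xi> = 0"
  by (simp add: inner_diff_right mean_diff inner_bary)

lemma cov_bilinear: "u \<bullet> (cov \<xi> *v v) = mean (\<lambda>x. (u \<bullet> (x - bary \<xi>)) * (v \<bullet> (x - bary \<xi>))) \<xi>"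
proof -
  have "u \<bullet> (cov \<xi> *v v) = (\<Sum>i\<in>UNIV. \<Sum>j\<in>UNIV. u$i * (mean (\<lambda>x. x $ i * x $ j) \<xi> - bary \<xi> $ i * bary \<xi> $ j) * v$j)"
    by (simp add: inner_vec_def matrix_vector_mult_def cov_def sum_distrib_left mult.assoc)
  also have "\<dots> = (\<Sum>i\<in>UNIV. \<Sum>j\<in>UNIV. mean (\<lambda>x. (u$i * x$i) * (v$j * x$j)) \<xi>) - (\<Sum>i\<in>UNIV. \<Sum>j\<in>UNIV. (u$i * bary \<xi>$i) * (v$j * bary \<xi>$j))"
  proof -
    have "mean (\<lambda>x. (u$i * x$i) * (v$j * x$j)) \<xi> = u$i * v$j * mean (\<lambda>x. x$i * x$j) \<xi>" for i j
      using mean_cmult[of "u$i * v$j" "\<lambda>x. x$i * x$j"] by (simp add: ac_simps)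
    then show ?thesis by (simp add: sum_subtractf[symmetric] algebra_simps)
  qed
  also have "(\<Sum>i\<in>UNIV. \<Sum>j\<in>UNIV. mean (\<lambda>x. (u$i * x$i) * (v$j * x$j)) \<xi>) = mean (\<lambda>x. (u \<bullet> x) * (v \<bullet> x)) \<xi>"
    by (simp add: inner_vec_def sum_product mean_sum)
  also have "(\<Sum>i\<in>UNIV. \<Sum>j\<in>UNIV. (u$i * bary \<xi>$i) * (v$j * bary \<xi>$j)) = (u \<bullet> bary \<xi>) * (v \<bullet> bary \<xi>)"
    by (simp add: inner_vec_def sum_product)
  also have "mean (\<lambda>x. (u \<bullet> x) * (v \<bullet> x)) \<xi> - (u \<bullet> bary \<xi>) * (v \<bullet> bary \<xi>)
      = mean (\<lambda>x. (u \<bullet> (x - bary \<xi>)) * (v \<bullet> (x - bary \<xi>))) \<xi>"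
    by (simp add: inner_diff_right left_diff_distrib right_diff_distrib mean_diff mean_add mean_cmult mean_multc inner_bary[symmetric])
  finally show ?thesis .
qed

lemma cov_sym: "transpose (cov \<xi>) = cov \<xi>"
  by (simp add: transpose_def cov_def vec_eq_iff mult.commute)

lemma cov_pos: assumes "v \<noteq> 0" shows "0 < v \<bullet> (cov \<xi> *v v)"
proof -
  let ?f = "\<lambda>x. (v \<bullet> (x - bary \<xi>)) * (v \<bullet> (x - bary \<xi>))"
  have nn: "AE x in M. 0 \<le> ?f x * exp (\<xi> \<bullet> x)" by auto
  have a: "adm ?f" by auto
  have "mom ?f \<xi> \<noteq> 0"
  proof
    assume "mom ?f \<xi> = 0"
    then have "AE x in M. ?f x * exp (\<xi> \<bullet> x) = 0"
      using integral_nonneg_eq_0_iff_AE[OF integrable_mom[OF a] nn] by (simp add: mom_def)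
    then have "AE x in M. v \<bullet> x = v \<bullet> bary \<xi>" by eventually_elim (simp add: inner_diff_right)
    with nondegenerate[OF assms] show False by blast
  qed
  moreover have "0 \<le> mom ?f \<xi>" unfolding mom_def by (intro integral_nonneg_AE nn)
  ultimately show ?thesis unfolding cov_bilinear mean_def using mom_pos[of \<xi>] by simp
qed

lemma bary_has_derivative: "(bary has_derivative (\<lambda>\<eta>. cov \<xi> *v \<eta>)) (at \<xi>)"
  unfolding has_derivative_componentwise_within[of bary]
proof
  fix b :: "real^'n" assume "b \<in> Basis"
  have "((\<lambda>\<xi>. mean (\<lambda>x. b \<bullet> x) \<xi>) has_derivative (\<lambda>\<eta>. mean (\<lambda>x. (b \<bullet> x) * (\<eta> \<bullet> x)) \<xi> - mean (\<lambda>x. b \<bullet> x) \<xi> * mean (\<lambda>x. \<eta> \<bullet> x) \<xi>)) (at \<xi>)"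
    by (rule mean_has_derivative) auto
  moreover have "mean (\<lambda>x. (b \<bullet> x) * (\<eta> \<bullet> x)) \<xi> - mean (\<lambda>x. b \<bullet> x) \<xi> * mean (\<lambda>x. \<eta> \<bullet> x) \<xi> = b \<bullet> (cov \<xi> *v \<eta>)" for \<eta>
    unfolding cov_bilinear
    by (simp add: inner_diff_right left_diff_distrib right_diff_distrib mean_diff mean_add mean_cmult mean_multc inner_bary)
  ultimately show "((\<lambda>x. bary x \<bullet> b) has_derivative (\<lambda>x. (cov \<xi> *v x) \<bullet> b)) (at \<xi>)"
    by (simp add: inner_commute[of _ b] inner_bary)
qed

lemma bary_line_derivative:
  "((\<lambda>t. w \<bullet> bary (\<eta> + t *\<^sub>R v)) has_real_derivative (w \<bullet> (cov (\<eta> + t *\<^sub>R v) *v v))) (at t)"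
proof -
  have "((\<lambda>t. \<eta> + t *\<^sub>R v) has_derivative (\<lambda>s. s *\<^sub>R v)) (at t)"
    by (auto intro!: derivative_eq_intros)
  from has_derivative_compose[OF this bary_has_derivative]
  have "((\<lambda>t. w \<bullet> bary (\<eta> + t *\<^sub>R v)) has_derivative (\<lambda>s. w \<bullet> (cov (\<eta> + t *\<^sub>R v) *v (s *\<^sub>R v)))) (at t)"
    by (rule has_derivative_inner_right)
  then show ?thesis unfolding has_field_derivative_def
    by (rule has_derivative_eq_rhs) (auto simp: matrix_vector_mult_scaleR)
qed

lemma cov_line_derivative:
  "((\<lambda>t. cov (\<eta> + t *\<^sub>R v) $ i $ j) has_real_derivative third (\<eta> + t *\<^sub>R v) v $ i $ j) (at t)"
proof -
  let ?\<xi> = "\<eta> + t *\<^sub>R v"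
  let ?E = "\<lambda>\<phi>. mean \<phi> ?\<xi>"
  have "((\<lambda>t. mean (\<lambda>x. x $ i * x $ j) (\<eta> + t *\<^sub>R v) - mean (\<lambda>x. x $ i) (\<eta> + t *\<^sub>R v) * mean (\<lambda>x. x $ j) (\<eta> + t *\<^sub>R v))
     has_real_derivative
      (?E (\<lambda>x. x$i * x$j * (v \<bullet> x)) - ?E (\<lambda>x. x$i * x$j) * ?E (\<lambda>x. v \<bullet> x))
      - ((?E (\<lambda>x. x$i * (v \<bullet> x)) - ?E (\<lambda>x. x$i) * ?E (\<lambda>x. v \<bullet> x)) * ?E (\<lambda>x. x$j)
         + (?E (\<lambda>x. x$j * (v \<bullet> x)) - ?E (\<lambda>x. x$j) * ?E (\<lambda>x. v \<bullet> x)) * ?E (\<lambda>x. x$i))) (at t)"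
    by (intro DERIV_diff DERIV_mult mean_line_derivative) auto
  moreover have "third ?\<xi> v $ i $ j = (?E (\<lambda>x. x$i * x$j * (v \<bullet> x)) - ?E (\<lambda>x. x$i * x$j) * ?E (\<lambda>x. v \<bullet> x))
      - ((?E (\<lambda>x. x$i * (v \<bullet> x)) - ?E (\<lambda>x. x$i) * ?E (\<lambda>x. v \<bullet> x)) * ?E (\<lambda>x. x$j)
         + (?E (\<lambda>x. x$j * (v \<bullet> x)) - ?E (\<lambda>x. x$j) * ?E (\<lambda>x. v \<bullet> x)) * ?E (\<lambda>x. x$i))"
  proof -
    define p q r where "p = ?E (\<lambda>x. x$i)" and "q = ?E (\<lambda>x. x$j)" and "r = ?E (\<lambda>x. v \<bullet> x)"
    have "(\<lambda>x. (x $ i - p) * (x $ j - q) * (v \<bullet> x - r))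
      = (\<lambda>x. (x$i * x$j * (v \<bullet> x) - x$i * x$j * r) - (x$i * (v \<bullet> x) * q - x$i * (q * r)) - (x$j * (v \<bullet> x) * p - x$j * (p * r)) + ((v \<bullet> x) * (p * q) - p * q * r))"
      by (auto simp: fun_eq_iff algebra_simps)
    then have "?E (\<lambda>x. (x $ i - p) * (x $ j - q) * (v \<bullet> x - r))
      = (?E (\<lambda>x. x$i * x$j * (v \<bullet> x)) - ?E (\<lambda>x. x$i * x$j) * r) - (?E (\<lambda>x. x$i * (v \<bullet> x)) * q - p * (q * r)) - (?E (\<lambda>x. x$j * (v \<bullet> x)) * p - q * (p * r)) + (r * (p * q) - p * q * r)"
      by (simp add: mean_diff mean_add mean_multc flip: p_def q_def r_def)
    moreover have "third ?\<xi> v $ i $ j = ?E (\<lambda>x. (x $ i - p) * (x $ j - q) * (v \<bullet> x - r))"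
      by (simp add: third_def inner_diff_right inner_bary bary_nth p_def q_def r_def)
    moreover have "?E (\<lambda>x. x$i) = p" "?E (\<lambda>x. x$j) = q" "?E (\<lambda>x. v \<bullet> x) = r"
      by (simp_all add: p_def q_def r_def)
    ultimately show ?thesis by (simp only:) (simp add: algebra_simps)
  qed
  ultimately show ?thesis by (simp add: cov_def bary_def)
qed

lemma third_conjugate:
  fixes B :: "real^'n^'n"
  shows "trace (B ** third \<xi> \<eta> ** transpose B)
    = (\<Sum>i\<in>UNIV. mean (\<lambda>x. ((B *v (x - bary \<xi>)) $ i)\<^sup>2 * (\<eta> \<bullet> (x - bary \<xi>))) \<xi>)"
proof -
  let ?z = "\<lambda>x. x - bary \<xi>"
  have "(B ** third \<xi> \<eta> ** transpose B) $ i $ i = mean (\<lambda>x. ((B *v ?z x) $ i)\<^sup>2 * (\<eta> \<bullet> ?z x)) \<xi>" for i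
  proof -
    have "(B ** third \<xi> \<eta> ** transpose B) $ i $ i = (\<Sum>k\<in>UNIV. \<Sum>l\<in>UNIV. (B$i$l * B$i$k) * third \<xi> \<eta> $ l $ k)"
      by (simp add: matrix_matrix_mult_def transpose_def sum_distrib_left sum_distrib_right ac_simps)
    also have "\<dots> = (\<Sum>k\<in>UNIV. \<Sum>l\<in>UNIV. mean (\<lambda>x. (B$i$l * B$i$k) * ((x$l - bary \<xi>$l) * (x$k - bary \<xi>$k) * (\<eta> \<bullet> ?z x))) \<xi>)"
      by (simp add: third_def mean_cmult)
    also have "\<dots> = mean (\<lambda>x. \<Sum>k\<in>UNIV. \<Sum>l\<in>UNIV. (B$i$l * B$i$k) * ((x$l - bary \<xi>$l) * (x$k - bary \<xi>$k) * (\<eta> \<bullet> ?z x))) \<xi>"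
      by (subst mean_sum; (subst mean_sum)?; auto)
    also have "(\<lambda>x. \<Sum>k\<in>UNIV. \<Sum>l\<in>UNIV. (B$i$l * B$i$k) * ((x$l - bary \<xi>$l) * (x$k - bary \<xi>$k) * (\<eta> \<bullet> ?z x)))
       = (\<lambda>x. ((B *v ?z x) $ i)\<^sup>2 * (\<eta> \<bullet> ?z x))"
      by (simp add: fun_eq_iff matrix_vector_mult_def power2_eq_square sum_product sum_distrib_left sum_distrib_right ac_simps)
    finally show ?thesis .
  qed
  then show ?thesis by (simp add: trace_def)
qed

lemma trace_cov_le: "trace (cov \<xi>) \<le> \<rho>\<^sup>2"
proof -
  have "trace (cov \<xi>) = (\<Sum>i\<in>UNIV. mean (\<lambda>x. x$i * x$i) \<xi> - bary \<xi>$i * bary \<xi>$i)" by (simp add: trace_def cov_def)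
  also have "\<dots> \<le> (\<Sum>i\<in>UNIV. mean (\<lambda>x. x$i * x$i) \<xi>)" by (intro sum_mono) simp
  also have "\<dots> = mean (\<lambda>x. \<Sum>i\<in>UNIV. x$i * x$i) \<xi>" by (simp add: mean_sum)
  also have "\<dots> \<le> mean (\<lambda>_. \<rho>\<^sup>2) \<xi>"
  proof (rule mean_mono)
    show "AE x in M. (\<Sum>i\<in>UNIV. x$i * x$i) \<le> \<rho>\<^sup>2" using bounded
    proof eventually_elim
      case (elim x)
      have "(\<Sum>i\<in>UNIV. x$i * x$i) = (norm x)\<^sup>2" by (simp add: power2_norm_eq_inner inner_vec_def)
      also have "\<dots> \<le> \<rho>\<^sup>2" using elim by (intro power_mono) auto
      finally show ?case .
    qed
  qed auto
  finally show ?thesis by simp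
qed

lemma bary_norm_le: "norm (bary \<xi>) \<le> \<rho>"
proof -
  let ?b = "bary \<xi>"
  have "?b \<bullet> ?b = mean (\<lambda>x. ?b \<bullet> x) \<xi>" by (rule inner_bary)
  also have "\<dots> \<le> mean (\<lambda>_. norm ?b * \<rho>) \<xi>"
  proof (rule mean_mono)
    show "AE x in M. ?b \<bullet> x \<le> norm ?b * \<rho>" using bounded
      by eventually_elim (meson norm_cauchy_schwarz mult_left_mono norm_ge_zero order_trans)
  qed auto
  finally have "norm ?b * norm ?b \<le> norm ?b * \<rho>" by (simp add: power2_norm_eq_inner[symmetric] power2_eq_square)
  then show ?thesis using rho_nonneg by (cases "norm ?b = 0") auto
qed

text \<open>A hyperplane that separates the barycentre strictly from \<open>Q\<close> would contradict monotonicity of the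
  mean.\<close>

lemma bary_in_convex:
  assumes "closed Q" "convex Q" "AE x in M. x \<in> Q"
  shows "bary \<xi> \<in> Q"
proof (rule ccontr)
  assume "bary \<xi> \<notin> Q"
  then obtain a c where ac: "a \<bullet> bary \<xi> < c" "\<And>x. x \<in> Q \<Longrightarrow> c < a \<bullet> x"
    using separating_hyperplane_closed_point[OF assms(2,1)] by metis
  have "mean (\<lambda>_. c) \<xi> \<le> mean (\<lambda>x. a \<bullet> x) \<xi>"
    using assms(3) ac(2) by (intro mean_mono) (auto elim!: eventually_mono intro: less_imp_le)
  then show False using ac(1) by (simp add: inner_bary)
qed

text \<open>The barycentre is the gradient of a strictly convex function.\<close>

lemma bary_monotone: assumes "\<xi> \<noteq> \<eta>" shows "(\<xi> - \<eta>) \<bullet> bary \<eta> < (\<xi> - \<eta>) \<bullet> bary \<xi>"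
proof -
  have "(\<xi> - \<eta>) \<bullet> bary (\<eta> + 0 *\<^sub>R (\<xi> - \<eta>)) < (\<xi> - \<eta>) \<bullet> bary (\<eta> + 1 *\<^sub>R (\<xi> - \<eta>))"
    by (rule DERIV_pos_imp_increasing) (use assms in \<open>auto intro!: bary_line_derivative cov_pos exI\<close>)
  then show ?thesis by simp
qed

lemma inj_bary: "inj_on bary S"
  by (rule inj_onI) (metis bary_monotone less_irrefl)

lemma bary_continuous: "continuous_on UNIV bary"
  using bary_has_derivative by (intro differentiable_imp_continuous_on) (auto simp: differentiable_on_def differentiable_def)

lemma cov_continuous: "continuous_on UNIV (\<lambda>\<xi>. cov \<xi> $ i $ j)"
  unfolding cov_def bary_def by (auto intro!: continuous_intros mean_continuous)

end

section \<open>Stability of the covariance under tilting\<close>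

text \<open>The assumption \<open>third_bound\<close> is what \<^const>\<open>tau_n\<close> provides: it bounds the third moments of every tilt
  after an affine change \<open>B\<close> that makes the tilt isotropic.\<close>

locale tilted_body = compact_measure M \<rho> for M :: "(real^'n::{finite,wellorder}) measure" and \<rho> +
  fixes \<tau> :: real
  assumes tau_nonneg: "0 \<le> \<tau>"
    and third_bound: "\<And>\<xi> (B :: real^'n::_^'n::_) \<theta>. B ** cov \<xi> ** transpose B = mat 1 \<Longrightarrow> norm \<theta> = 1 \<Longrightarrow>
      (\<Sum>i\<in>UNIV. \<Sum>j\<in>UNIV. (mean (\<lambda>x. (B *v (x - bary \<xi>)) $ i * (B *v (x - bary \<xi>)) $ j
         * (\<theta> \<bullet> (B *v (x - bary \<xi>)))) \<xi>)\<^sup>2) \<le> \<tau>\<^sup>2"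
begin

text \<open>In whitened coordinates \<open>Y\<close> the vector \<open>\<eta>\<close> becomes \<open>\<zeta>\<close>, whose squared length is the quadratic form of the
  covariance at \<open>\<eta>\<close>.  The trace is \<open>|\<zeta>|\<close> times the sum of \<open>n\<close> diagonal third moments, which
  Cauchy--Schwarz bounds by \<open>sqrt n\<close> times the Euclidean norm of the full matrix of third moments.\<close>

lemma trace_third_bound:
  fixes B :: "real^'n::_^'n::_"
  assumes B: "B ** cov \<xi> ** transpose B = mat 1"
  shows "\<bar>trace (B ** third \<xi> \<eta> ** transpose B)\<bar> \<le> sqrt (real CARD('n)) * \<tau> * sqrt (\<eta> \<bullet> (cov \<xi> *v \<eta>))"
proof -
  define \<zeta> where "\<zeta> = B *v (cov \<xi> *v \<eta>)"
  have "transpose B ** (B ** cov \<xi>) = mat 1" using B by (simp add: matrix_left_right_inverse)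
  then have t: "transpose B *v \<zeta> = \<eta>" unfolding \<zeta>_def matrix_vector_mul_assoc by simp
  have tr: "(transpose B *v u) \<bullet> z = u \<bullet> (B *v z)" for u z
    by (simp add: dot_lmul_matrix)
  have \<eta>: "\<eta> \<bullet> z = \<zeta> \<bullet> (B *v z)" for z using tr[of \<zeta> z] unfolding t .
  have nz: "(norm \<zeta>)\<^sup>2 = \<eta> \<bullet> (cov \<xi> *v \<eta>)" unfolding \<eta> power2_norm_eq_inner by (simp add: \<zeta>_def)
  define Y where "Y = (\<lambda>x. B *v (x - bary \<xi>))"
  have tr3: "trace (B ** third \<xi> \<eta> ** transpose B) = (\<Sum>i\<in>UNIV. mean (\<lambda>x. (Y x $ i)\<^sup>2 * (\<zeta> \<bullet> Y x)) \<xi>)"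
    unfolding third_conjugate \<eta> Y_def ..
  show ?thesis
  proof (cases "\<zeta> = 0")
    case True
    then show ?thesis unfolding tr3 using nz by simp
  next
    case False
    define \<theta> where "\<theta> = \<zeta> /\<^sub>R norm \<zeta>"
    have \<theta>: "norm \<theta> = 1" "\<zeta> = norm \<zeta> *\<^sub>R \<theta>" using False by (auto simp: \<theta>_def)
    define a where "a = (\<lambda>i. mean (\<lambda>x. Y x $ i * Y x $ i * (\<theta> \<bullet> Y x)) \<xi>)"
    have "mean (\<lambda>x. (Y x $ i)\<^sup>2 * (\<zeta> \<bullet> Y x)) \<xi> = norm \<zeta> * a i" for i
    proof -
      have "(\<lambda>x. (Y x $ i)\<^sup>2 * (\<zeta> \<bullet> Y x)) = (\<lambda>x. norm \<zeta> * (Y x $ i * Y x $ i * (\<theta> \<bullet> Y x)))"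
        by (subst \<theta>(2)) (simp add: fun_eq_iff power2_eq_square)
      then show ?thesis unfolding a_def by (simp only: mean_cmult)
    qed
    then have eq: "trace (B ** third \<xi> \<eta> ** transpose B) = norm \<zeta> * sum a UNIV"
      unfolding tr3 by (simp add: sum_distrib_left)
    have "(\<Sum>i\<in>UNIV. (a i)\<^sup>2) \<le> (\<Sum>i\<in>UNIV. \<Sum>j\<in>UNIV. (mean (\<lambda>x. Y x $ i * Y x $ j * (\<theta> \<bullet> Y x)) \<xi>)\<^sup>2)"
      unfolding a_def by (intro sum_mono member_le_sum) auto
    also have "\<dots> \<le> \<tau>\<^sup>2" unfolding Y_def by (rule third_bound[OF B \<theta>(1)])
    finally have a2: "(\<Sum>i\<in>UNIV. (a i)\<^sup>2) \<le> \<tau>\<^sup>2" .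
    have "\<bar>sum a UNIV\<bar>\<^sup>2 \<le> (\<Sum>i\<in>UNIV. (a i)\<^sup>2) * real CARD('n)"
      using sum_squared_le_sum_of_squares[of a UNIV] by simp
    also have "\<dots> \<le> \<tau>\<^sup>2 * real CARD('n)" using a2 by (intro mult_right_mono) auto
    also have "\<dots> = (sqrt (real CARD('n)) * \<tau>)\<^sup>2" by (simp add: power_mult_distrib)
    finally have "\<bar>sum a UNIV\<bar> \<le> sqrt (real CARD('n)) * \<tau>"
      by (rule power2_le_imp_le) (simp add: tau_nonneg)
    then have "norm \<zeta> * \<bar>sum a UNIV\<bar> \<le> norm \<zeta> * (sqrt (real CARD('n)) * \<tau>)" by (intro mult_left_mono) auto
    moreover have "norm \<zeta> = sqrt (\<eta> \<bullet> (cov \<xi> *v \<eta>))" using nz by (metis norm_ge_zero real_sqrt_unique)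
    moreover have "\<bar>norm \<zeta> * sum a UNIV\<bar> = norm \<zeta> * \<bar>sum a UNIV\<bar>" by (simp add: abs_mult)
    ultimately show ?thesis unfolding eq by (simp only: mult.commute)
  qed
qed

lemma cov_whitening: obtains B :: "real^'n::_^'n::_" where "B ** cov \<xi> ** transpose B = mat 1"
  using cov_sym cov_pos by (rule whitening_exists)

lemma det_cov_pos: "0 < det (cov \<xi>)"
proof -
  obtain B :: "real^'n::_^'n::_" where B: "B ** cov \<xi> ** transpose B = mat 1" by (rule cov_whitening)
  show ?thesis
    by (rule ln_det_derivative(1)[of "\<lambda>_. cov \<xi>" 0 0 B]) (use B in auto)
qed

text \<open>The integral of \<open>\<xi> \<bullet> A(t\<xi>) \<xi>\<close> over \<open>t\<close> in the unit interval; it bounds the square of the length of the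
  segment from \<open>0\<close> to \<open>\<xi>\<close> in the Riemannian metric given by the covariances.\<close>

definition gain :: "real^'n::_ \<Rightarrow> real" where "gain \<xi> = \<xi> \<bullet> bary \<xi> - \<xi> \<bullet> bary 0"

text \<open>The logarithm of the determinant decreases at most at the rate \<open>sqrt n * \<tau> * sqrt v\<close>, where \<open>v\<close> is the
  rate of growth of the gain.  Estimating \<open>sqrt v\<close> by \<open>(v / \<kappa> + \<kappa>) / 2\<close> replaces an integral of square
  roots by the monotonicity of one function, and the best \<open>\<kappa>\<close> is the square root of the gain.\<close>

lemma log_det_cov_bound:
  assumes \<kappa>: "0 < \<kappa>"
  shows "ln (det (cov 0)) - sqrt (real CARD('n)) * \<tau> / 2 * (gain \<xi> / \<kappa> + \<kappa>) \<le> ln (det (cov \<xi>))"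
proof -
  let ?c = "sqrt (real CARD('n)) * \<tau>"
  define f where "f = (\<lambda>t. ln (det (cov (0 + t *\<^sub>R \<xi>))) + ?c / 2 * ((\<xi> \<bullet> bary (0 + t *\<^sub>R \<xi>)) / \<kappa> + \<kappa> * t))"
  have "f 0 \<le> f 1"
  proof (rule DERIV_nonneg_imp_nondecreasing[of 0 1 f])
    fix t :: real
    let ?\<xi> = "0 + t *\<^sub>R \<xi>"
    obtain B :: "real^'n::_^'n::_" where B: "B ** cov ?\<xi> ** transpose B = mat 1" by (rule cov_whitening)
    define v where "v = \<xi> \<bullet> (cov ?\<xi> *v \<xi>)"
    have v: "0 \<le> v" unfolding v_def using cov_pos[of \<xi> ?\<xi>] by (cases "\<xi> = 0") (auto intro: less_imp_le)
    let ?T = "trace (B ** third ?\<xi> \<xi> ** transpose B)"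
    have "(f has_real_derivative (?T + ?c / 2 * (v / \<kappa> + \<kappa> * 1))) (at t)"
      unfolding f_def v_def
      by (intro DERIV_add DERIV_cmult DERIV_cdivide DERIV_ident ln_det_derivative(2) cov_line_derivative B bary_line_derivative)
    moreover have "0 \<le> ?T + ?c / 2 * (v / \<kappa> + \<kappa> * 1)"
    proof -
      have "2 * (sqrt v) \<le> v / \<kappa> + \<kappa>"
      proof -
        have "0 \<le> (sqrt v - \<kappa>)\<^sup>2" by simp
        also have "(sqrt v - \<kappa>)\<^sup>2 = v + \<kappa>\<^sup>2 - 2 * \<kappa> * sqrt v" using v by (simp add: power2_diff)
        finally show ?thesis using \<kappa> by (simp add: field_simps power2_eq_square)
      qed
      then have "?c / 2 * (2 * sqrt v) \<le> ?c / 2 * (v / \<kappa> + \<kappa>)"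
        using tau_nonneg by (intro mult_left_mono) auto
      then have "?c * sqrt v \<le> ?c / 2 * (v / \<kappa> + \<kappa> * 1)" by simp
      moreover have "\<bar>?T\<bar> \<le> ?c * sqrt v" using trace_third_bound[OF B, of \<xi>] by (simp add: v_def)
      ultimately show ?thesis by linarith
    qed
    ultimately show "\<exists>y. (f has_real_derivative y) (at t) \<and> 0 \<le> y" by blast
  qed simp
  then show ?thesis by (simp add: f_def gain_def algebra_simps diff_divide_distrib add_divide_distrib)
qed

lemma rho_pos: "0 < \<rho>"
proof (rule ccontr)
  assume "\<not> 0 < \<rho>"
  then have "\<rho> = 0" using rho_nonneg by simp
  then have "AE x in M. axis undefined 1 \<bullet> x = 0" using bounded by (auto elim!: eventually_mono)
  then show False using nondegenerate[of "axis undefined 1" 0] by simp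
qed

lemma cov_diag: "0 \<le> cov \<xi> $ i $ i" "cov \<xi> $ i $ i \<le> \<rho>\<^sup>2"
proof -
  have d: "cov \<xi> $ j $ j = axis j 1 \<bullet> (cov \<xi> *v axis j 1)" for j
    by (simp add: inner_axis' matrix_vector_mul_component inner_axis)
  have nn: "0 \<le> cov \<xi> $ j $ j" for j
    unfolding d by (rule less_imp_le[OF cov_pos]) simp
  then show "0 \<le> cov \<xi> $ i $ i" .
  have "cov \<xi> $ i $ i \<le> trace (cov \<xi>)" unfolding trace_def by (intro member_le_sum) (auto simp: nn)
  then show "cov \<xi> $ i $ i \<le> \<rho>\<^sup>2" using trace_cov_le[of \<xi>] by simp
qed

lemma cov_entry_measurable [measurable]: "(\<lambda>\<xi>. cov \<xi> $ i $ j) \<in> borel_measurable borel"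
  by (intro borel_measurable_continuous_onI cov_continuous)

lemma bary_entry_measurable [measurable]: "(\<lambda>\<xi>. bary \<xi> $ i) \<in> borel_measurable borel"
  by (intro borel_measurable_continuous_onI continuous_intros bary_continuous)

lemma gain_continuous: "continuous_on UNIV gain"
  unfolding gain_def by (intro continuous_intros bary_continuous)

lemma gain_measurable [measurable]: "gain \<in> borel_measurable borel"
  by (intro borel_measurable_continuous_onI gain_continuous)

lemma gain_nonneg: "0 \<le> gain \<xi>"
  using bary_monotone[of \<xi> 0] by (cases "\<xi> = 0") (auto simp: gain_def)

lemma trace_cov_measurable [measurable]: "(\<lambda>\<xi>. trace (cov \<xi>)) \<in> borel_measurable borel"
  unfolding trace_def by measurable

lemma trace_cov_gauss_integrable: "0 < s \<Longrightarrow> integrable lborel (\<lambda>\<xi>. trace (cov \<xi>) * gauss s \<xi>)"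
proof (rule Bochner_Integration.integrable_bound)
  assume s: "0 < s"
  show "integrable lborel (\<lambda>\<xi>::real^'n::_. \<rho>\<^sup>2 * gauss s \<xi>)" using s by (intro integrable_mult_right gauss_integrable)
  have "0 \<le> trace (cov \<xi>)" for \<xi> unfolding trace_def by (intro sum_nonneg cov_diag)
  then show "AE \<xi> in lborel. norm (trace (cov \<xi>) * gauss s \<xi>) \<le> norm (\<rho>\<^sup>2 * gauss s \<xi>)"
    by (intro AE_I2) (simp add: abs_mult abs_of_pos[OF gauss_pos] mult_right_mono trace_cov_le less_imp_le)
qed measurable

text \<open>Integration by parts in each coordinate: the derivative of the \<open>i\<close>-th coordinate of the barycentre in
  the \<open>i\<close>-th direction is the \<open>i\<close>-th diagonal entry of the covariance.\<close>

lemma bary_gauss: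
  assumes s: "0 < s"
  shows "integrable lborel (\<lambda>\<xi>. (\<xi> \<bullet> bary \<xi>) * gauss s \<xi>)"
    and "(\<integral>\<xi>. (\<xi> \<bullet> bary \<xi>) * gauss s \<xi> \<partial>lborel) = s\<^sup>2 * (\<integral>\<xi>. trace (cov \<xi>) * gauss s \<xi> \<partial>lborel)"
proof -
  have bb: "\<bar>bary \<xi> $ i\<bar> \<le> \<rho>" for \<xi> i using component_le_norm_cart[of "bary \<xi>" i] bary_norm_le[of \<xi>] by linarith
  have parts: "(\<integral>\<xi>. bary \<xi> $ i * (axis i 1 \<bullet> \<xi>) * gauss s \<xi> \<partial>lborel) = s\<^sup>2 * (\<integral>\<xi>. cov \<xi> $ i $ i * gauss s \<xi> \<partial>lborel)" for i
  proof (rule gauss_integration_by_parts[OF s, where L="\<rho>\<^sup>2" and c=\<rho>])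
    have der: "((\<lambda>t. bary (x + t *\<^sub>R axis i 1) $ i) has_real_derivative cov (x + t *\<^sub>R axis i 1) $ i $ i) (at t)" for x t
      using bary_line_derivative[of "axis i 1" x "axis i 1" t]
      by (simp add: inner_axis' matrix_vector_mul_component inner_axis)
    show "((\<lambda>t. bary (x + t *\<^sub>R axis i 1) $ i) has_real_derivative cov x $ i $ i) (at 0)" for x
      using der[of x 0] by simp
    show "\<bar>bary (x + t *\<^sub>R axis i 1) $ i - bary x $ i\<bar> \<le> \<rho>\<^sup>2 * \<bar>t\<bar>" for x t
    proof -
      have "norm (bary (x + t *\<^sub>R axis i 1) $ i - bary (x + 0 *\<^sub>R axis i 1) $ i) \<le> \<rho>\<^sup>2 * norm (t - 0)"
        by (rule field_differentiable_bound[of UNIV "\<lambda>t. bary (x + t *\<^sub>R axis i 1) $ i"])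
          (use der cov_diag in auto)
      then show ?thesis by simp
    qed
    show "\<bar>bary x $ i\<bar> \<le> \<rho> * (1 + norm x)" for x
    proof -
      have "\<rho> * 1 \<le> \<rho> * (1 + norm x)" by (intro mult_left_mono) (auto simp: rho_nonneg)
      then show ?thesis using bb[of x i] by simp
    qed
  qed measurable
  have int: "integrable lborel (\<lambda>\<xi>. bary \<xi> $ i * (axis i 1 \<bullet> \<xi>) * gauss s \<xi>)" for i
  proof (rule gauss_weight_integrable[OF s, where c=\<rho>])
    fix x :: "real^'n::_"
    have "\<bar>bary x $ i * (axis i 1 \<bullet> x)\<bar> \<le> \<rho> * norm x"
      unfolding abs_mult inner_axis' by (intro mult_mono bb) (auto simp: component_le_norm_cart rho_nonneg)
    also have "\<dots> \<le> \<rho> * (1 + norm x)\<^sup>2"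
      by (intro mult_left_mono) (auto simp: rho_nonneg power2_eq_square algebra_simps)
    finally show "\<bar>bary x $ i * (axis i 1 \<bullet> x)\<bar> \<le> \<rho> * (1 + norm x)\<^sup>2" .
  qed measurable
  have intc: "integrable lborel (\<lambda>\<xi>. cov \<xi> $ i $ i * gauss s \<xi>)" for i
  proof (rule Bochner_Integration.integrable_bound)
    show "integrable lborel (\<lambda>\<xi>::real^'n::_. \<rho>\<^sup>2 * gauss s \<xi>)" using s by (intro integrable_mult_right gauss_integrable)
    show "AE \<xi> in lborel. norm (cov \<xi> $ i $ i * gauss s \<xi>) \<le> norm (\<rho>\<^sup>2 * gauss s \<xi>)"
      using cov_diag by (intro AE_I2) (simp add: abs_mult abs_of_pos[OF gauss_pos] mult_right_mono less_imp_le)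
  qed measurable
  have eq: "(\<xi> \<bullet> bary \<xi>) * gauss s \<xi> = (\<Sum>i\<in>UNIV. bary \<xi> $ i * (axis i 1 \<bullet> \<xi>) * gauss s \<xi>)" for \<xi>
  proof -
    have "\<xi> \<bullet> bary \<xi> = (\<Sum>i\<in>UNIV. bary \<xi> $ i * (axis i 1 \<bullet> \<xi>))"
      unfolding inner_axis' by (simp add: inner_vec_def mult.commute)
    then show ?thesis by (simp add: sum_distrib_right)
  qed
  show "integrable lborel (\<lambda>\<xi>. (\<xi> \<bullet> bary \<xi>) * gauss s \<xi>)"
    unfolding eq by (intro Bochner_Integration.integrable_sum int)
  have "(\<integral>\<xi>. (\<xi> \<bullet> bary \<xi>) * gauss s \<xi> \<partial>lborel) = (\<Sum>i\<in>UNIV. s\<^sup>2 * (\<integral>\<xi>. cov \<xi> $ i $ i * gauss s \<xi> \<partial>lborel))"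
    unfolding eq by (subst Bochner_Integration.integral_sum) (auto simp: parts intro: int)
  also have "\<dots> = s\<^sup>2 * (\<integral>\<xi>. (\<Sum>i\<in>UNIV. cov \<xi> $ i $ i * gauss s \<xi>) \<partial>lborel)"
    by (subst Bochner_Integration.integral_sum) (auto simp: sum_distrib_left intro: intc)
  finally show "(\<integral>\<xi>. (\<xi> \<bullet> bary \<xi>) * gauss s \<xi> \<partial>lborel) = s\<^sup>2 * (\<integral>\<xi>. trace (cov \<xi>) * gauss s \<xi> \<partial>lborel)"
    by (simp add: trace_def sum_distrib_right)
qed

lemma gain_gauss:
  assumes s: "0 < s"
  shows "integrable lborel (\<lambda>\<xi>. gain \<xi> * gauss s \<xi>)"
    and "(\<integral>\<xi>. gain \<xi> * gauss s \<xi> \<partial>lborel) \<le> s\<^sup>2 * \<rho>\<^sup>2 * (s * sqrt (2 * pi)) ^ CARD('n)"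
proof -
  have i0: "integrable lborel (\<lambda>\<xi>. (bary 0 \<bullet> \<xi>) * gauss s \<xi>)"
  proof (rule gauss_weight_integrable[OF s, where c="norm (bary 0)"])
    fix x :: "real^'n::_"
    have "\<bar>bary 0 \<bullet> x\<bar> \<le> norm (bary 0) * norm x" by (rule Cauchy_Schwarz_ineq2)
    also have "\<dots> \<le> norm (bary 0) * (1 + norm x)\<^sup>2"
      by (intro mult_left_mono) (auto simp: power2_eq_square algebra_simps)
    finally show "\<bar>bary 0 \<bullet> x\<bar> \<le> norm (bary 0) * (1 + norm x)\<^sup>2" .
  qed measurable
  have eq: "gain \<xi> * gauss s \<xi> = (\<xi> \<bullet> bary \<xi>) * gauss s \<xi> - (bary 0 \<bullet> \<xi>) * gauss s \<xi>" for \<xi>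
    by (simp add: gain_def left_diff_distrib inner_commute)
  show "integrable lborel (\<lambda>\<xi>. gain \<xi> * gauss s \<xi>)"
    unfolding eq by (intro Bochner_Integration.integrable_diff bary_gauss s i0)
  have "(\<integral>\<xi>. gain \<xi> * gauss s \<xi> \<partial>lborel) = s\<^sup>2 * (\<integral>\<xi>. trace (cov \<xi>) * gauss s \<xi> \<partial>lborel)"
    unfolding eq using bary_gauss[OF s] i0 gauss_first_moment[OF s, of "bary 0"] by simp
  also have "(\<integral>\<xi>. trace (cov \<xi>) * gauss s \<xi> \<partial>lborel) \<le> (\<integral>(\<xi>::real^'n::_). \<rho>\<^sup>2 * gauss s \<xi> \<partial>lborel)"
    by (intro integral_mono trace_cov_gauss_integrable s integrable_mult_right gauss_integrable mult_right_mono trace_cov_le)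
      (simp add: less_imp_le)
  finally show "(\<integral>\<xi>. gain \<xi> * gauss s \<xi> \<partial>lborel) \<le> s\<^sup>2 * \<rho>\<^sup>2 * (s * sqrt (2 * pi)) ^ CARD('n)"
    by (simp add: gauss_integral[OF s] mult_left_mono mult.assoc)
qed

text \<open>The threshold is twice the bound on the Gaussian mean of the gain, so that Markov's inequality leaves
  at least half of the Gaussian mass.\<close>

definition typical :: "real \<Rightarrow> (real^'n::_) set" where "typical s = {\<xi>. gain \<xi> \<le> 2 * s\<^sup>2 * \<rho>\<^sup>2}"

lemma typical_closed: "closed (typical s)"
  unfolding typical_def by (intro closed_Collect_le gain_continuous continuous_on_const)

lemma typical_measurable [measurable]: "typical s \<in> sets borel"
  by (intro borel_closed typical_closed)

lemma typical_gauss_integrable: "0 < s \<Longrightarrow> integrable lborel (\<lambda>\<xi>. indicator (typical s) \<xi> * gauss s \<xi>)"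
  by (rule Bochner_Integration.integrable_bound[OF gauss_integrable[of s]]) (auto simp: indicator_def)

lemma typical_mass:
  assumes s: "0 < s"
  shows "(s * sqrt (2 * pi)) ^ CARD('n) / 2 \<le> (\<integral>\<xi>. indicator (typical s) \<xi> * gauss s \<xi> \<partial>lborel)"
proof -
  let ?W = "(s * sqrt (2 * pi)) ^ CARD('n)"
  define c where "c = 2 * s\<^sup>2 * \<rho>\<^sup>2"
  have c: "0 < c" using s rho_pos by (simp add: c_def)
  have "(\<integral>(\<xi>::real^'n::_). gauss s \<xi> \<partial>lborel) \<le> (\<integral>\<xi>. indicator (typical s) \<xi> * gauss s \<xi> + (1 / c) * (gain \<xi> * gauss s \<xi>) \<partial>lborel)"
  proof (rule integral_mono)
    fix \<xi> :: "real^'n::_"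
    show "gauss s \<xi> \<le> indicator (typical s) \<xi> * gauss s \<xi> + (1 / c) * (gain \<xi> * gauss s \<xi>)"
    proof (cases "\<xi> \<in> typical s")
      case True
      then show ?thesis using c gain_nonneg[of \<xi>] by (simp add: less_imp_le)
    next
      case False
      then have "c \<le> gain \<xi>" by (simp add: typical_def c_def)
      then have "1 \<le> (1 / c) * gain \<xi>" using c by (simp add: field_simps)
      then have "1 * gauss s \<xi> \<le> ((1 / c) * gain \<xi>) * gauss s \<xi>" by (intro mult_right_mono) (auto simp: less_imp_le)
      then show ?thesis using False by (simp add: mult.assoc)
    qed
  qed (intro gauss_integrable s Bochner_Integration.integrable_add typical_gauss_integrable integrable_mult_right gain_gauss)+
  also have "\<dots> = (\<integral>\<xi>. indicator (typical s) \<xi> * gauss s \<xi> \<partial>lborel) + (1 / c) * (\<integral>\<xi>. gain \<xi> * gauss s \<xi> \<partial>lborel)"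
    by (simp only: Bochner_Integration.integral_add typical_gauss_integrable[OF s] integrable_mult_right gain_gauss(1)[OF s] integral_mult_right_zero)
  also have "(1 / c) * (\<integral>\<xi>. gain \<xi> * gauss s \<xi> \<partial>lborel) \<le> (1 / c) * (s\<^sup>2 * \<rho>\<^sup>2 * ?W)"
    using c by (intro mult_left_mono gain_gauss s) auto
  also have "(1 / c) * (s\<^sup>2 * \<rho>\<^sup>2 * ?W) = ?W / 2" using s rho_pos by (simp add: c_def)
  finally show ?thesis by (simp add: gauss_integral[OF s])
qed

text \<open>The choice \<open>\<kappa> = s * \<rho>\<close> balances the threshold \<open>2 * s\<^sup>2 * \<rho>\<^sup>2\<close> of the gain, and the smallness of \<open>s\<close> makes
  the total loss in the logarithm of the determinant at most \<open>n\<close>.\<close>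

lemma typical_det:
  assumes s: "0 < s" and small: "3 * s * \<rho> * \<tau> * sqrt (real CARD('n)) \<le> 2 * real CARD('n)"
    and \<delta>: "0 < \<delta>" "\<And>v. \<delta> * (v \<bullet> v) \<le> v \<bullet> (cov 0 *v v)" and \<xi>: "\<xi> \<in> typical s"
  shows "(\<delta> / exp 1) ^ CARD('n) \<le> det (cov \<xi>)"
proof -
  let ?n = "real CARD('n)"
  have \<kappa>: "0 < s * \<rho>" using s rho_pos by simp
  have "gain \<xi> \<le> 2 * (s * \<rho>) * (s * \<rho>)" using \<xi> by (simp add: typical_def power2_eq_square mult_ac)
  then have "gain \<xi> / (s * \<rho>) \<le> 2 * (s * \<rho>)" using \<kappa> by (simp only: pos_divide_le_eq)
  then have "gain \<xi> / (s * \<rho>) + s * \<rho> \<le> 3 * (s * \<rho>)" by linarith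
  then have "sqrt ?n * \<tau> / 2 * (gain \<xi> / (s * \<rho>) + s * \<rho>) \<le> sqrt ?n * \<tau> / 2 * (3 * (s * \<rho>))"
    by (rule mult_left_mono) (simp add: tau_nonneg)
  also have "\<dots> = (3 * s * \<rho> * \<tau> * sqrt ?n) / 2" by simp
  also have "\<dots> \<le> ?n" using small by simp
  finally have "ln (det (cov 0)) - ?n \<le> ln (det (cov \<xi>))" using log_det_cov_bound[OF \<kappa>, of \<xi>] by linarith
  moreover have "?n * ln \<delta> \<le> ln (det (cov 0))"
  proof -
    have "\<delta> ^ CARD('n) \<le> det (cov 0)" by (rule det_ge_of_quadratic_form_ge[OF cov_sym \<delta>])
    then have "ln (\<delta> ^ CARD('n)) \<le> ln (det (cov 0))" using \<delta>(1) by (intro ln_mono) auto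
    then show ?thesis using \<delta>(1) by (simp add: ln_realpow)
  qed
  ultimately have "?n * ln (\<delta> / exp 1) \<le> ln (det (cov \<xi>))" using \<delta>(1) by (simp add: ln_div right_diff_distrib)
  then have "ln ((\<delta> / exp 1) ^ CARD('n)) \<le> ln (det (cov \<xi>))" using \<delta>(1) by (simp add: ln_realpow)
  then show ?thesis using \<delta>(1) det_cov_pos[of \<xi>] by (subst (asm) ln_le_cancel_iff) auto
qed

text \<open>By parts, the integral is \<open>s\<^sup>2\<close> times the integral of the trace of the covariance, and on typical
  points a determinant of at least \<open>(\<delta> / e) ^ n\<close> forces a trace of at least \<open>n * \<delta> / e\<close>.\<close>

theorem width_lower_bound:
  assumes s: "0 < s" and small: "3 * s * \<rho> * \<tau> * sqrt (real CARD('n)) \<le> 2 * real CARD('n)"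
    and \<delta>: "0 < \<delta>" "\<And>v. \<delta> * (v \<bullet> v) \<le> v \<bullet> (cov 0 *v v)"
  shows "s\<^sup>2 * (real CARD('n) * \<delta> / exp 1) * ((s * sqrt (2 * pi)) ^ CARD('n) / 2)
    \<le> (\<integral>\<xi>. (\<xi> \<bullet> bary \<xi>) * gauss s \<xi> \<partial>lborel)"
proof -
  let ?n = "real CARD('n)"
  have tr: "?n * \<delta> / exp 1 \<le> trace (cov \<xi>)" if \<xi>: "\<xi> \<in> typical s" for \<xi>
  proof (rule ccontr)
    assume "\<not> ?thesis"
    then have lt: "trace (cov \<xi>) / ?n < \<delta> / exp 1" by (simp add: field_simps)
    have nn: "0 \<le> trace (cov \<xi>)" unfolding trace_def by (intro sum_nonneg cov_diag)
    \<comment> \<open>A value strictly in between keeps the comparison parameter positive even if the trace were zero.\<close>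
    obtain \<delta>' where \<delta>': "trace (cov \<xi>) / ?n < \<delta>'" "\<delta>' < \<delta> / exp 1" using dense[OF lt] by blast
    have "0 \<le> trace (cov \<xi>) / ?n" using nn by simp
    then have p: "0 < \<delta>'" using \<delta>'(1) by linarith
    have "det (cov \<xi>) \<le> \<delta>' ^ CARD('n)"
      by (rule det_le_of_trace_le[OF cov_sym cov_pos p]) (use \<delta>'(1) in \<open>auto simp: field_simps\<close>)
    also have "\<dots> < (\<delta> / exp 1) ^ CARD('n)" using \<delta>'(2) p by (intro power_strict_mono) auto
    also have "\<dots> \<le> det (cov \<xi>)" by (rule typical_det[OF s small \<delta> \<xi>])
    finally show False by simp
  qed
  have "(?n * \<delta> / exp 1) * ((s * sqrt (2 * pi)) ^ CARD('n) / 2) \<le> (?n * \<delta> / exp 1) * (\<integral>\<xi>. indicator (typical s) \<xi> * gauss s \<xi> \<partial>lborel)"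
    using \<delta>(1) by (intro mult_left_mono typical_mass s) auto
  also have "\<dots> = (\<integral>\<xi>. (?n * \<delta> / exp 1) * (indicator (typical s) \<xi> * gauss s \<xi>) \<partial>lborel)" by simp
  also have "\<dots> \<le> (\<integral>\<xi>. trace (cov \<xi>) * gauss s \<xi> \<partial>lborel)"
  proof (rule integral_mono)
    fix \<xi> :: "real^'n::_"
    have nn: "0 \<le> trace (cov \<xi>)" unfolding trace_def by (intro sum_nonneg cov_diag)
    show "(?n * \<delta> / exp 1) * (indicator (typical s) \<xi> * gauss s \<xi>) \<le> trace (cov \<xi>) * gauss s \<xi>"
    proof (cases "\<xi> \<in> typical s")
      case True
      then show ?thesis using mult_right_mono[OF tr[OF True], of "gauss s \<xi>"] by (simp add: less_imp_le)
    qed (simp add: nn less_imp_le)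
  qed (intro integrable_mult_right typical_gauss_integrable trace_cov_gauss_integrable s)+
  finally have "s\<^sup>2 * ((?n * \<delta> / exp 1) * ((s * sqrt (2 * pi)) ^ CARD('n) / 2)) \<le> s\<^sup>2 * (\<integral>\<xi>. trace (cov \<xi>) * gauss s \<xi> \<partial>lborel)"
    by (intro mult_left_mono) auto
  then show ?thesis unfolding bary_gauss(2)[OF s] by (simp add: mult.assoc)
qed

text \<open>The barycentre map sends the typical points injectively into \<open>Q\<close>, with Jacobian determinant
  \<open>det (cov \<xi>)\<close>, so the volume of \<open>Q\<close> is at least the integral of that determinant.\<close>

theorem volume_lower_bound:
  assumes s: "0 < s" and small: "3 * s * \<rho> * \<tau> * sqrt (real CARD('n)) \<le> 2 * real CARD('n)"
    and \<delta>: "0 < \<delta>" "\<And>v. \<delta> * (v \<bullet> v) \<le> v \<bullet> (cov 0 *v v)"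
    and Q: "compact Q" "convex Q" "AE x in M. x \<in> Q"
  shows "(\<delta> / exp 1) ^ CARD('n) * ((s * sqrt (2 * pi)) ^ CARD('n) / 2) \<le> measure lebesgue Q"
proof -
  let ?c = "(\<delta> / exp 1) ^ CARD('n)" and ?S = "typical s"
  have img: "bary ` ?S \<subseteq> Q" using bary_in_convex[OF compact_imp_closed[OF Q(1)] Q(2,3)] by blast
  have Sm: "?S \<in> sets lebesgue" using typical_measurable[of s] by simp
  have der: "(bary has_derivative (\<lambda>\<eta>. cov \<xi> *v \<eta>)) (at \<xi> within ?S)" for \<xi>
    by (rule has_derivative_at_withinI[OF bary_has_derivative])
  have "bary differentiable_on ?S" using der by (auto simp: differentiable_on_def differentiable_def)
  then have "bary ` ?S \<in> sets lebesgue" by (intro differentiable_image_in_sets_lebesgue Sm) auto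
  moreover have "bounded (bary ` ?S)" using img Q(1) by (meson bounded_subset compact_imp_bounded)
  ultimately have lm: "bary ` ?S \<in> lmeasurable" by (simp add: bounded_set_imp_lmeasurable)
  have I1: "((\<lambda>\<xi>. \<bar>det (matrix (\<lambda>\<eta>. cov \<xi> *v \<eta>))\<bar>) has_integral measure lebesgue (bary ` ?S)) ?S"
    using has_measure_differentiable_image[OF Sm der inj_bary] lm by blast
  have "((\<lambda>\<xi>. ?c * (indicator ?S \<xi> * gauss s \<xi>)) has_integral (\<integral>\<xi>. ?c * (indicator ?S \<xi> * gauss s \<xi>) \<partial>lborel)) UNIV"
    by (intro has_integral_integral_lborel integrable_mult_right typical_gauss_integrable s)
  moreover have "(\<lambda>\<xi>. ?c * (indicator ?S \<xi> * gauss s \<xi>)) = (\<lambda>\<xi>. if \<xi> \<in> ?S then ?c * gauss s \<xi> else 0)" by auto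
  ultimately have "((\<lambda>\<xi>. if \<xi> \<in> ?S then ?c * gauss s \<xi> else 0) has_integral (?c * (\<integral>\<xi>. indicator ?S \<xi> * gauss s \<xi> \<partial>lborel))) UNIV"
    by (simp only: integral_mult_right_zero[symmetric])
  then have I2: "((\<lambda>\<xi>. ?c * gauss s \<xi>) has_integral (?c * (\<integral>\<xi>. indicator ?S \<xi> * gauss s \<xi> \<partial>lborel))) ?S"
    by (simp only: has_integral_restrict_UNIV)
  have c0: "0 \<le> ?c" using \<delta>(1) by simp
  have "?c * (\<integral>\<xi>. indicator ?S \<xi> * gauss s \<xi> \<partial>lborel) \<le> measure lebesgue (bary ` ?S)"
  proof (rule has_integral_le[OF I2 I1])
    fix \<xi> assume \<xi>: "\<xi> \<in> ?S"
    have "?c * gauss s \<xi> \<le> ?c * 1" using c0 by (intro mult_left_mono) auto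
    also have "\<dots> \<le> det (cov \<xi>)" using typical_det[OF s small \<delta> \<xi>] by simp
    finally show "?c * gauss s \<xi> \<le> \<bar>det (matrix (\<lambda>\<eta>. cov \<xi> *v \<eta>))\<bar>" by (simp add: matrix_of_matrix_vector_mul)
  qed
  also have "\<dots> \<le> measure lebesgue Q"
    using img lm Q(1) by (intro measure_mono_fmeasurable) (auto simp: fmeasurableD lmeasurable_compact)
  finally show ?thesis using mult_left_mono[OF typical_mass[OF s] c0] by linarith
qed
end

section \<open>Coordinates and the Haar measure of the sphere\<close>

lemma lborel_orthogonal_transformation:
  fixes f :: "real^'n::{finite,wellorder} \<Rightarrow> real^'n::_"
  assumes f: "orthogonal_transformation f"
  shows "distr lborel borel f = lborel"
proof -
  have lin: "linear f" using f by (rule orthogonal_transformation_linear)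
  have "orthogonal_matrix (matrix f)" using f by (simp add: orthogonal_transformation_matrix)
  then have d: "\<bar>det (matrix f)\<bar> = 1" using det_orthogonal_matrix by fastforce
  then have "det (matrix f) \<noteq> 0" by auto
  from lborel_linear_image[OF lin this] show ?thesis by (simp add: d density_1)
qed

text \<open>An enumeration \<open>e\<close> of the index type identifies \<open>real^'n\<close> with the functions on the natural numbers
  that vanish from \<open>n\<close> on; \<open>d\<close> is the inverse of \<open>e\<close>.\<close>

locale enumeration =
  fixes e :: "nat \<Rightarrow> 'n::{finite,wellorder}" and n :: nat
  assumes bij: "bij_betw e {..<n} UNIV"
begin

definition d :: "'n \<Rightarrow> nat" where "d = the_inv_into {..<n} e"

lemma d_lt [simp]: "d k < n"
  using bij the_inv_into_into[of e "{..<n}" k "{..<n}"] by (auto simp: d_def bij_betw_def)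

lemma e_d [simp]: "e (d k) = k"
  using bij f_the_inv_into_f[of e "{..<n}" k] by (auto simp: d_def bij_betw_def)

lemma d_e [simp]: "i < n \<Longrightarrow> d (e i) = i"
  using bij the_inv_into_f_f[of e "{..<n}" i] by (auto simp: d_def bij_betw_def)

lemma e_eq_iff: "i < n \<Longrightarrow> j < n \<Longrightarrow> e i = e j \<longleftrightarrow> i = j"
  by (metis d_e)

lemma sum_e: "(\<Sum>i<n. f (e i)) = (\<Sum>k\<in>UNIV. f k)"
  by (rule sum.reindex_bij_betw[OF bij])

lemma card_n: "CARD('n) = n"
  using bij_betw_same_card[OF bij] by simp

definition to_vec :: "(nat \<Rightarrow> real) \<Rightarrow> real^'n::_" where "to_vec x = (\<chi> k. x (d k))"

definition to_fun :: "real^'n::_ \<Rightarrow> nat \<Rightarrow> real" where "to_fun v = (\<lambda>i. if i < n then v $ e i else 0)"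

lemma to_vec_nth [simp]: "to_vec x $ k = x (d k)" by (simp add: to_vec_def)

lemma to_vec_to_fun [simp]: "to_vec (to_fun v) = v"
  by (simp add: vec_eq_iff to_fun_def)

lemma to_fun_space [simp]: "to_fun v \<in> space_n n"
  by (simp add: topspace_Euclidean_space to_fun_def)

lemma to_fun_to_vec: "x \<in> space_n n \<Longrightarrow> to_fun (to_vec x) = x"
  by (auto simp: topspace_Euclidean_space to_fun_def fun_eq_iff)

lemma to_fun_lt: "i < n \<Longrightarrow> to_fun v i = v $ e i" by (simp add: to_fun_def)

lemma to_fun_inj: "to_fun u = to_fun v \<longleftrightarrow> u = v"
  by (metis to_vec_to_fun)

lemma inner_to_vec: "inner_n n x y = to_vec x \<bullet> to_vec y"
proof -
  have "to_vec x \<bullet> to_vec y = (\<Sum>k\<in>UNIV. x (d k) * y (d k))" by (simp add: inner_vec_def)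
  also have "\<dots> = (\<Sum>i<n. x (d (e i)) * y (d (e i)))" by (rule sum_e[symmetric])
  also have "\<dots> = inner_n n x y" by (simp add: inner_n_def)
  finally show ?thesis ..
qed

lemma sphere_to_fun: "norm v = 1 \<Longrightarrow> to_fun v \<in> sphere_n n"
  by (simp add: sphere_n_def inner_to_vec norm_eq_sqrt_inner)

lemma sphere_to_vec: "x \<in> sphere_n n \<Longrightarrow> norm (to_vec x) = 1" "x \<in> sphere_n n \<Longrightarrow> x \<in> space_n n"
  by (simp_all add: sphere_n_def inner_to_vec norm_eq_sqrt_inner)

lemma to_vec_continuous: "continuous_on S to_vec"
  unfolding to_vec_def by (intro continuous_intros continuous_on_subset[OF continuous_on_product_coordinates]) auto

lemma to_fun_continuous: "continuous_on S to_fun"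
proof (rule continuous_on_coordinatewise_then_product)
  show "continuous_on S (\<lambda>x. to_fun x i)" for i
    by (cases "i < n") (auto simp: to_fun_def intro!: continuous_intros)
qed

lemma to_vec_measurable [measurable]: "to_vec \<in> borel_measurable borel"
  by (intro borel_measurable_continuous_onI to_vec_continuous)

lemma to_fun_measurable [measurable]: "to_fun \<in> borel_measurable borel"
  by (intro borel_measurable_continuous_onI to_fun_continuous)

lemma lebesgue_n_eq: "lebesgue_n n = distr lborel borel to_fun"
proof -
  interpret product_sigma_finite "\<lambda>_::nat. lborel :: real measure" ..
  let ?P = "\<Pi>\<^sub>M i\<in>{..<n}. (lborel :: real measure)"
  note measurable_extend_zero [measurable]
  have eq: "lborel = distr ?P borel (\<lambda>x. to_vec (extend_zero n x))"
  proof (rule lborel_eqI)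
    fix l u :: "real^'n::_" assume le: "\<And>b. b \<in> Basis \<Longrightarrow> l \<bullet> b \<le> u \<bullet> b"
    have le': "l $ k \<le> u $ k" for k
    proof -
      have "axis k 1 \<in> (Basis :: (real^'n::_) set)" by (auto simp: Basis_vec_def)
      from le[OF this] show ?thesis by (simp add: inner_axis)
    qed
    have "emeasure (distr ?P borel (\<lambda>x. to_vec (extend_zero n x))) (box l u)
       = emeasure ?P ((\<lambda>x. to_vec (extend_zero n x)) -` box l u \<inter> space ?P)"
      by (rule emeasure_distr) auto
    also have "(\<lambda>x. to_vec (extend_zero n x)) -` box l u \<inter> space ?P = (\<Pi>\<^sub>E i\<in>{..<n}. {l $ e i <..< u $ e i})"
    proof -
      have "(\<forall>k. l $ k < x (d k) \<and> x (d k) < u $ k) \<longleftrightarrow> (\<forall>i<n. l $ e i < x i \<and> x i < u $ e i)" for x :: "nat \<Rightarrow> real"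
        by (metis d_e d_lt e_d)
      then show ?thesis
        by (auto simp: space_PiM PiE_def Pi_def mem_box_cart extend_zero_def)
    qed
    also have "emeasure ?P \<dots> = (\<Prod>i<n. emeasure lborel {l $ e i <..< u $ e i})"
      by (rule emeasure_PiM) simp_all
    also have "\<dots> = (\<Prod>i<n. ennreal (u $ e i - l $ e i))" using le' by simp
    also have "\<dots> = (\<Prod>k\<in>UNIV. ennreal (u $ k - l $ k))" by (rule prod.reindex_bij_betw[OF bij])
    also have "\<dots> = ennreal (\<Prod>k\<in>UNIV. u $ k - l $ k)" using le' by (intro prod_ennreal) auto
    also have "(\<Prod>k\<in>UNIV. u $ k - l $ k) = (\<Prod>b\<in>Basis. (u - l) \<bullet> b)"
    proof -
      have B: "(Basis :: (real^'n::_) set) = (\<lambda>k. axis k 1) ` UNIV" by (auto simp: Basis_vec_def)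
      have inj: "inj (\<lambda>k::'n. axis k (1::real))" by (auto simp: inj_on_def axis_eq_axis)
      have "(\<Prod>b\<in>Basis. (u - l) \<bullet> b) = (\<Prod>k\<in>UNIV. (u - l) \<bullet> axis k 1)"
        unfolding B by (subst prod.reindex[OF inj]) (simp add: comp_def)
      then show ?thesis by (simp add: inner_axis)
    qed
    finally show "emeasure (distr ?P borel (\<lambda>x. to_vec (extend_zero n x))) (box l u) = ennreal (\<Prod>b\<in>Basis. (u - l) \<bullet> b)" .
  qed simp
  have ez: "to_fun (to_vec (extend_zero n x)) = extend_zero n x" for x
    by (rule to_fun_to_vec) (simp add: topspace_Euclidean_space extend_zero_def)
  show ?thesis
    unfolding lebesgue_n_def by (subst eq, subst distr_distr) (auto simp: comp_def ez)
qed

lemma lebesgue_n_vimage: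
  assumes "A \<in> sets borel" shows "emeasure (lebesgue_n n) A = emeasure lborel (to_fun -` A)"
  unfolding lebesgue_n_eq using assms by (subst emeasure_distr) auto

lemma sphere_n_borel [measurable]: "sphere_n n \<in> sets borel"
proof -
  have "sphere_n n = {x. (\<forall>i\<in>{n..}. x i = 0) \<and> norm (to_vec x) = 1}"
    by (auto simp: sphere_n_def topspace_Euclidean_space inner_to_vec norm_eq_sqrt_inner)
  moreover have "closed {x :: nat \<Rightarrow> real. x i = 0}" for i
    by (intro closed_Collect_eq continuous_on_product_coordinates continuous_on_const)
  then have "closed (\<Inter>i\<in>{n..}. {x :: nat \<Rightarrow> real. x i = 0})" by (intro closed_INT ballI)
  moreover have "closed {x. norm (to_vec x) = 1}"
    by (intro closed_Collect_eq continuous_intros to_vec_continuous)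
  ultimately have "closed ((\<Inter>i\<in>{n..}. {x :: nat \<Rightarrow> real. x i = 0}) \<inter> {x. norm (to_vec x) = 1})" by (intro closed_Int)
  moreover have "sphere_n n = (\<Inter>i\<in>{n..}. {x :: nat \<Rightarrow> real. x i = 0}) \<inter> {x. norm (to_vec x) = 1}"
    using \<open>sphere_n n = _\<close> by auto
  ultimately show ?thesis by (simp add: borel_closed)
qed

lemma mat_apply_to_fun: "mat_apply n A (to_fun v) = to_fun ((\<chi> k l. A (d k) (d l)) *v v)"
proof
  fix i
  show "mat_apply n A (to_fun v) i = to_fun ((\<chi> k l. A (d k) (d l)) *v v) i"
  proof (cases "i < n")
    case True
    have "(\<Sum>j<n. A i j * to_fun v j) = (\<Sum>j<n. A i (d (e j)) * v $ (e j))"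
      by (intro sum.cong) (auto simp: to_fun_def)
    also have "\<dots> = (\<Sum>l\<in>UNIV. A i (d l) * v $ l)" by (rule sum_e)
    finally show ?thesis using True by (simp add: mat_apply_def to_fun_lt matrix_vector_mult_def)
  qed (simp add: mat_apply_def to_fun_def)
qed

lemma orthogonal_to_matrix:
  assumes "orthogonal_n n A" shows "orthogonal_matrix (\<chi> k l. A (d k) (d l))"
proof -
  have "(\<Sum>m\<in>UNIV. A (d m) (d k) * A (d m) (d l)) = (if k = l then 1 else 0)" for k l
  proof -
    have "(\<Sum>m\<in>UNIV. A (d m) (d k) * A (d m) (d l)) = (\<Sum>i<n. A (d (e i)) (d k) * A (d (e i)) (d l))"
      by (rule sum_e[symmetric])
    also have "\<dots> = (\<Sum>i<n. A i (d k) * A i (d l))" by simp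
    also have "\<dots> = (if d k = d l then 1 else 0)" using assms by (simp add: orthogonal_n_def)
    also have "\<dots> = (if k = l then 1 else 0)" by (metis e_d)
    finally show ?thesis .
  qed
  then show ?thesis
    by (simp add: orthogonal_matrix vec_eq_iff matrix_matrix_mult_def transpose_def mat_def)
qed

lemma orthogonal_from_transformation:
  fixes f :: "real^'n::_ \<Rightarrow> real^'n::_"
  assumes f: "orthogonal_transformation f"
  obtains A where "orthogonal_n n A" "\<And>v. mat_apply n A (to_fun v) = to_fun (f v)"
proof
  define A where "A = (\<lambda>i j. matrix f $ e i $ e j)"
  have m: "(\<chi> k l. A (d k) (d l)) = matrix f" by (simp add: A_def vec_eq_iff)
  have lin: "linear f" using f by (rule orthogonal_transformation_linear)
  show "mat_apply n A (to_fun v) = to_fun (f v)" for v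
    unfolding mat_apply_to_fun m using matrix_vector_mul(2)[OF lin] by metis
  have "orthogonal_matrix (matrix f)" using f by (simp add: orthogonal_transformation_matrix)
  then have "(\<Sum>m\<in>UNIV. matrix f $ m $ k * matrix f $ m $ l) = (if k = l then 1 else 0)" for k l
    unfolding orthogonal_matrix by (simp add: vec_eq_iff matrix_matrix_mult_def transpose_def mat_def)
  then show "orthogonal_n n A"
    unfolding orthogonal_n_def A_def
    by (simp add: sum_e[of "\<lambda>m. matrix f $ m $ e _ * matrix f $ m $ e _"] e_eq_iff)
qed

text \<open>Both laws are transported to \<open>real^'n\<close>, where uniqueness is known, and recovered from there.  The
  inverse map is extended by a fixed point of the sphere, since its target is the sphere.\<close>

lemma haar_sphere_unique:
  assumes "is_haar_sphere n \<sigma>" "is_haar_sphere n \<sigma>'"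
  shows "\<sigma> = \<sigma>'"
proof -
  define L where "L = (\<lambda>\<sigma>::(nat \<Rightarrow> real) measure. distr \<sigma> borel to_vec)"
  have sp: "space \<sigma> = sphere_n n" if "is_haar_sphere n \<sigma>" for \<sigma>
    using that sets_eq_imp_space_eq[of \<sigma> "restrict_space borel (sphere_n n)"]
    by (simp add: is_haar_sphere_def space_restrict_space)
  have tv: "to_vec \<in> \<sigma> \<rightarrow>\<^sub>M borel" if "is_haar_sphere n \<sigma>" for \<sigma>
  proof -
    have "to_vec \<in> restrict_space borel (sphere_n n) \<rightarrow>\<^sub>M borel" by (intro measurable_restrict_space1) measurable
    then show ?thesis using that measurable_cong_sets[of \<sigma> "restrict_space borel (sphere_n n)"] by (auto simp: is_haar_sphere_def)
  qed
  have L: "prob_space (L \<sigma>)" "sets (L \<sigma>) = sets borel" "AE x in L \<sigma>. norm x = 1"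
      "\<And>f. orthogonal_transformation f \<Longrightarrow> distr (L \<sigma>) borel f = L \<sigma>"
    and recover: "\<sigma> = distr (L \<sigma>) (restrict_space borel (sphere_n n)) (\<lambda>v. if norm v = 1 then to_fun v else to_fun (axis (e 0) 1))"
    if h: "is_haar_sphere n \<sigma>" for \<sigma>
  proof -
    interpret prob_space \<sigma> using h by (simp add: is_haar_sphere_def)
    show "prob_space (L \<sigma>)" unfolding L_def by (rule prob_space_distr[OF tv[OF h]])
    show "sets (L \<sigma>) = sets borel" by (simp add: L_def)
    show "AE x in L \<sigma>. norm x = 1"
      unfolding L_def using sp[OF h] by (subst AE_distr_iff[OF tv[OF h]]) (auto simp: sphere_to_vec)
    have hs: "sets \<sigma> = sets (restrict_space borel (sphere_n n))" using h by (simp add: is_haar_sphere_def)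
    show "distr (L \<sigma>) borel f = L \<sigma>" if f: "orthogonal_transformation f" for f :: "real^'n::_ \<Rightarrow> real^'n::_"
    proof -
      obtain A where A: "orthogonal_n n A" "\<And>v. mat_apply n A (to_fun v) = to_fun (f v)"
        using orthogonal_from_transformation[OF f] by metis
      have [measurable]: "f \<in> borel_measurable borel"
        using f by (intro borel_measurable_continuous_onI linear_continuous_on)
          (simp add: orthogonal_transformation_linear linear_linear)
      have inv: "distr \<sigma> \<sigma> (mat_apply n A) = \<sigma>" using h A(1) by (auto simp: is_haar_sphere_def)
      have ap: "mat_apply n A x = to_fun (f (to_vec x))" if "x \<in> sphere_n n" for x
        using A(2)[of "to_vec x"] to_fun_to_vec[OF sphere_to_vec(2)[OF that]] by simp
      have mm: "mat_apply n A \<in> \<sigma> \<rightarrow>\<^sub>M \<sigma>"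
      proof -
        have "(\<lambda>x. to_fun (f (to_vec x))) \<in> \<sigma> \<rightarrow>\<^sub>M borel"
          using tv[OF h] by measurable
        then have "(\<lambda>x. to_fun (f (to_vec x))) \<in> \<sigma> \<rightarrow>\<^sub>M restrict_space borel (sphere_n n)"
        proof (rule measurable_restrict_space2[rotated])
          show "(\<lambda>x. to_fun (f (to_vec x))) \<in> space \<sigma> \<rightarrow> sphere_n n"
            using f by (auto simp: sp[OF h] sphere_to_vec orthogonal_transformation_norm intro!: sphere_to_fun)
        qed
        then have "mat_apply n A \<in> \<sigma> \<rightarrow>\<^sub>M restrict_space borel (sphere_n n)"
          by (subst measurable_cong[of _ _ "\<lambda>x. to_fun (f (to_vec x))"]) (auto simp: ap sp[OF h])
        then show ?thesis using measurable_cong_sets[OF refl hs] by auto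
      qed
      have "distr (L \<sigma>) borel f = distr \<sigma> borel (f \<circ> to_vec)"
        unfolding L_def by (intro distr_distr tv h) measurable
      also have "\<dots> = distr \<sigma> borel (to_vec \<circ> mat_apply n A)"
        by (intro distr_cong) (auto simp: sp[OF h] ap)
      also have "\<dots> = distr (distr \<sigma> \<sigma> (mat_apply n A)) borel to_vec"
        by (intro distr_distr[symmetric] tv h mm)
      finally show ?thesis unfolding inv L_def .
    qed
    let ?g = "\<lambda>v. if norm v = 1 then to_fun v else to_fun (axis (e 0) 1)"
    have g: "?g \<in> borel \<rightarrow>\<^sub>M restrict_space borel (sphere_n n)"
      by (intro measurable_restrict_space2) (auto intro!: sphere_to_fun)
    have "distr (L \<sigma>) (restrict_space borel (sphere_n n)) ?g = distr \<sigma> (restrict_space borel (sphere_n n)) (?g \<circ> to_vec)"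
      unfolding L_def by (intro distr_distr tv h g)
    also have "\<dots> = distr \<sigma> \<sigma> (\<lambda>x. x)"
      by (intro distr_cong) (auto simp: sp[OF h] hs sphere_to_vec to_fun_to_vec)
    finally show "\<sigma> = distr (L \<sigma>) (restrict_space borel (sphere_n n)) ?g" by simp
  qed
  have "L \<sigma> = L \<sigma>'"
    by (rule invariant_sphere_measure_unique) (use L[OF assms(1)] L[OF assms(2)] in auto)
  then show ?thesis using recover[OF assms(1)] recover[OF assms(2)] by simp
qed

context
  fixes s :: real
  assumes s: "0 < s"
begin

definition radial_mass :: real where "radial_mass = (\<integral>(x::real^'n::_). norm x * gauss s x \<partial>lborel)"

lemma radial_mass_pos: "0 < radial_mass"
proof -
  note i = gauss_norm_moment(1)[OF s, where 'n='n]
  have "0 \<le> radial_mass" unfolding radial_mass_def by (intro integral_nonneg_AE AE_I2) (auto simp: less_imp_le)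
  moreover have "radial_mass \<noteq> 0"
  proof
    assume "radial_mass = 0"
    then have "AE (x::real^'n::_) in lborel. norm x * gauss s x = 0"
      unfolding radial_mass_def by (subst (asm) integral_nonneg_eq_0_iff_AE[OF i]) (auto simp: less_imp_le)
    moreover have "AE (x::real^'n::_) in lborel. x \<noteq> 0" by (rule AE_lborel_singleton)
    ultimately have "AE (x::real^'n::_) in lborel. False" by eventually_elim (simp add: less_imp_neq[symmetric] gauss_pos[THEN less_imp_neq, symmetric])
    then have "emeasure lborel (UNIV :: (real^'n::_) set) = 0" using AE_iff_null_sets[of UNIV "lborel :: (real^'n::_) measure"] by (simp add: AE_iff_measurable[OF _ refl])
    then show False by simp
  qed
  ultimately show ?thesis by simp
qed

text \<open>The Gaussian weight is multiplied by \<open>norm x\<close> on purpose: the mean of a positively homogeneous function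
  of \<open>x / norm x\<close> under this law is then a Gaussian integral of the function itself, and no polar
  coordinates are needed.\<close>

definition radial_law :: "(real^'n::_) measure" where
  "radial_law = density lborel (\<lambda>x. ennreal (norm x * gauss s x / radial_mass))"

lemma sets_radial_law [simp, measurable_cong]: "sets radial_law = sets borel" by (simp add: radial_law_def)

lemma prob_space_radial_law: "prob_space radial_law"
proof
  have "emeasure radial_law (space radial_law) = (\<integral>\<^sup>+x. ennreal (norm x * gauss s (x::real^'n::_) / radial_mass) \<partial>lborel)"
    by (simp add: radial_law_def emeasure_density)
  also have "\<dots> = ennreal (\<integral>(x::real^'n::_). norm x * gauss s x / radial_mass \<partial>lborel)"
    using gauss_norm_moment(1)[OF s, where 'n='n] radial_mass_pos
    by (intro nn_integral_eq_integral) (auto simp: less_imp_le)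
  also have "\<dots> = 1" using radial_mass_pos by (simp flip: radial_mass_def)
  finally show "emeasure radial_law (space radial_law) = 1" .
qed

lemma radial_law_orthogonal:
  assumes f: "orthogonal_transformation f"
  shows "distr radial_law borel f = radial_law"
proof -
  have [measurable]: "f \<in> borel_measurable borel"
    using f by (intro borel_measurable_continuous_onI linear_continuous_on)
      (simp add: orthogonal_transformation_linear linear_linear)
  define w where "w = (\<lambda>x::real^'n::_. ennreal (norm x * gauss s x / radial_mass))"
  have [measurable]: "w \<in> borel_measurable borel" by (simp add: w_def)
  have wf: "w (f x) = w x" for x by (simp add: w_def gauss_def orthogonal_transformation_norm[OF f])
  have "radial_law = density (distr lborel borel f) w"
    by (simp add: radial_law_def w_def lborel_orthogonal_transformation[OF f])
  also have "\<dots> = distr (density lborel (\<lambda>x. w (f x))) borel f" by (rule density_distr) measurable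
  also have "\<dots> = distr radial_law borel f" unfolding wf by (simp add: radial_law_def w_def)
  finally show ?thesis ..
qed

definition normalise :: "real^'n::_ \<Rightarrow> nat \<Rightarrow> real" where
  "normalise v = (if v = 0 then to_fun (axis (e 0) 1) else to_fun (v /\<^sub>R norm v))"

lemma normalise_sphere: "normalise v \<in> sphere_n n"
  by (auto simp: normalise_def intro!: sphere_to_fun)

lemma normalise_measurable_borel: "normalise \<in> borel \<rightarrow>\<^sub>M borel"
  unfolding normalise_def by measurable

lemma normalise_measurable [measurable]: "normalise \<in> borel \<rightarrow>\<^sub>M restrict_space borel (sphere_n n)"
  by (intro measurable_restrict_space2 normalise_measurable_borel) (auto simp: normalise_sphere)

definition haar :: "(nat \<Rightarrow> real) measure" where
  "haar = distr radial_law (restrict_space borel (sphere_n n)) normalise"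

lemma is_haar: "is_haar_sphere n haar"
  unfolding is_haar_sphere_def
proof (intro conjI allI impI)
  interpret prob_space radial_law by (rule prob_space_radial_law)
  show "prob_space haar" unfolding haar_def by (rule prob_space_distr) measurable
  show sets: "sets haar = sets (restrict_space borel (sphere_n n))" by (simp add: haar_def)
  fix A assume A: "orthogonal_n n A"
  define F :: "real^'n::_^'n::_" where "F = (\<chi> k l. A (d k) (d l))"
  have F: "orthogonal_transformation (\<lambda>v. F *v v)"
    using orthogonal_to_matrix[OF A] by (simp add: F_def orthogonal_transformation_matrix matrix_of_matrix_vector_mul)
  have [measurable]: "(\<lambda>v. F *v v) \<in> borel_measurable borel"
    by (intro borel_measurable_continuous_onI matrix_vector_mult_linear_continuous_on)
  have nf: "norm (F *v v) = norm v" for v using orthogonal_transformation_norm[OF F] by simp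
  have ma: "mat_apply n A x = to_fun (F *v to_vec x)" if "x \<in> sphere_n n" for x
    using mat_apply_to_fun[of A "to_vec x"] to_fun_to_vec[OF sphere_to_vec(2)[OF that]] by (simp add: F_def)
  have mm: "mat_apply n A \<in> restrict_space borel (sphere_n n) \<rightarrow>\<^sub>M restrict_space borel (sphere_n n)"
  proof -
    have "(\<lambda>x. to_fun (F *v to_vec x)) \<in> restrict_space borel (sphere_n n) \<rightarrow>\<^sub>M restrict_space borel (sphere_n n)"
      by (intro measurable_restrict_space2 measurable_restrict_space1)
        (auto simp: space_restrict_space nf sphere_to_vec intro!: sphere_to_fun)
    then show ?thesis
      by (subst measurable_cong[of _ _ "\<lambda>x. to_fun (F *v to_vec x)"]) (auto simp: ma space_restrict_space)
  qed
  have "distr haar haar (mat_apply n A) = distr haar (restrict_space borel (sphere_n n)) (mat_apply n A)"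
    by (intro distr_cong) (auto simp: sets)
  also have "\<dots> = distr radial_law (restrict_space borel (sphere_n n)) (mat_apply n A \<circ> normalise)"
    unfolding haar_def by (intro distr_distr mm) measurable
  also have "\<dots> = distr radial_law (restrict_space borel (sphere_n n)) (normalise \<circ> (\<lambda>v. F *v v))"
  proof (rule distr_cong_AE)
    have "AE (v::real^'n::_) in lborel. v \<noteq> 0" by (rule AE_lborel_singleton)
    then have "AE v in radial_law. v \<noteq> 0" unfolding radial_law_def by (subst AE_density) auto
    then show "AE v in radial_law. (mat_apply n A \<circ> normalise) v = (normalise \<circ> (\<lambda>v. F *v v)) v"
    proof eventually_elim
      case (elim v)
      then have "F *v v \<noteq> 0" using nf[of v] by auto
      then show ?case using elim ma[OF normalise_sphere, of v]
        by (simp add: normalise_def nf matrix_vector_mult_scaleR)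
    qed
    show "mat_apply n A \<circ> normalise \<in> radial_law \<rightarrow>\<^sub>M restrict_space borel (sphere_n n)"
      by (rule measurable_comp[OF _ mm]) measurable
    show "normalise \<circ> (\<lambda>v. F *v v) \<in> radial_law \<rightarrow>\<^sub>M restrict_space borel (sphere_n n)"
      unfolding comp_def by measurable
  qed auto
  also have "\<dots> = distr (distr radial_law borel (\<lambda>v. F *v v)) (restrict_space borel (sphere_n n)) normalise"
    by (intro distr_distr[symmetric]) measurable
  also have "\<dots> = haar" by (simp add: radial_law_orthogonal[OF F] haar_def)
  finally show "distr haar haar (mat_apply n A) = haar" .
qed

lemma haar_sphere_eq: "haar_sphere n = haar"
  unfolding haar_sphere_def using is_haar haar_sphere_unique by (intro the_equality) auto

lemma haar_integral_homogeneous: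
  fixes f :: "(nat \<Rightarrow> real) \<Rightarrow> real"
  assumes f [measurable]: "f \<in> borel_measurable borel"
    and hom: "\<And>v c. 0 < c \<Longrightarrow> f (to_fun (c *\<^sub>R v)) = c * f (to_fun v)"
    and zero: "f (to_fun 0) = 0"
  shows "(\<integral>x. f x \<partial>haar_sphere n) * radial_mass = (\<integral>v. f (to_fun v) * gauss s v \<partial>lborel)"
proof -
  have fr: "f \<in> borel_measurable (restrict_space borel (sphere_n n))" by (intro measurable_restrict_space1) measurable
  have [measurable]: "(\<lambda>v. f (normalise v)) \<in> borel_measurable borel"
    using measurable_compose[OF normalise_measurable fr] .
  have "(\<integral>x. f x \<partial>haar_sphere n) = (\<integral>v. f (normalise v) \<partial>radial_law)"
    unfolding haar_sphere_eq haar_def by (rule integral_distr[OF _ fr]) measurable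
  also have "\<dots> = (\<integral>v. (norm v * gauss s v / radial_mass) *\<^sub>R f (normalise v) \<partial>lborel)"
    unfolding radial_law_def using radial_mass_pos by (intro integral_density) (auto simp: less_imp_le)
  also have "\<dots> = (\<integral>v. (f (to_fun v) * gauss s v) / radial_mass \<partial>lborel)"
  proof (intro Bochner_Integration.integral_cong refl)
    fix v :: "real^'n::_"
    have "norm v * f (normalise v) = f (to_fun v)"
      using hom[of "norm v" "v /\<^sub>R norm v"] zero by (cases "v = 0") (auto simp: normalise_def)
    then show "(norm v * gauss s v / radial_mass) *\<^sub>R f (normalise v) = (f (to_fun v) * gauss s v) / radial_mass"
      by (simp add: mult_ac)
  qed
  finally show ?thesis using radial_mass_pos by simp
qed
end
end

section \<open>Gauges\<close>

context enumeration
begin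

definition gauge_fun :: "(real^'n::_) set \<Rightarrow> real^'n::_ \<Rightarrow> real" where
  "gauge_fun C v = gauge_norm (to_fun ` C) (to_fun v)"

lemma scaled_image: "to_fun v \<in> (\<lambda>y i. l * y i) ` to_fun ` C \<longleftrightarrow> v \<in> (\<lambda>y. l *\<^sub>R y) ` C"
proof -
  have eq: "(\<lambda>i. l * to_fun y i) = to_fun (l *\<^sub>R y)" for y by (auto simp: to_fun_def fun_eq_iff)
  show ?thesis unfolding image_image eq by (auto simp: image_iff to_fun_inj)
qed

lemma gauge_fun_Inf: "gauge_fun C v = Inf {l. 0 \<le> l \<and> v \<in> (\<lambda>y. l *\<^sub>R y) ` C}"
  by (simp add: gauge_fun_def gauge_norm_def scaled_image)

context
  fixes C :: "(real^'n::_) set" and r :: real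
  assumes compact: "compact C" and convex: "convex C" and r: "0 < r" "cball 0 r \<subseteq> C"
begin

lemma scaled_mono:
  assumes "0 \<le> l" "l \<le> m" "v \<in> (\<lambda>y. l *\<^sub>R y) ` C" shows "v \<in> (\<lambda>y. m *\<^sub>R y) ` C"
proof (cases "m = 0")
  case False
  then have m: "0 < m" using assms by simp
  obtain y where y: "y \<in> C" "v = l *\<^sub>R y" using assms by blast
  have 0: "0 \<in> C" using r by auto
  have "(1 - l / m) *\<^sub>R 0 + (l / m) *\<^sub>R y \<in> C"
    using m assms by (intro convexD[OF convex 0 y(1)]) auto
  then have "(l / m) *\<^sub>R y \<in> C" by simp
  moreover have "v = m *\<^sub>R ((l / m) *\<^sub>R y)" using m y by simp
  ultimately show ?thesis by blast
qed (use assms in auto)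

lemma gauge_member: "v \<in> (\<lambda>y. (norm v / r) *\<^sub>R y) ` C"
proof (cases "v = 0")
  case True
  have "0 \<in> C" using r by auto
  then show ?thesis using True by (auto intro!: image_eqI[of _ _ 0])
next
  case False
  have "(r / norm v) *\<^sub>R v \<in> C" using r False by (intro subsetD[OF r(2)]) simp
  moreover have "v = (norm v / r) *\<^sub>R ((r / norm v) *\<^sub>R v)" using False r by simp
  ultimately show ?thesis by blast
qed

lemma gauge_ne: "{l. 0 \<le> l \<and> v \<in> (\<lambda>y. l *\<^sub>R y) ` C} \<noteq> {}"
proof -
  have "norm v / r \<in> {l. 0 \<le> l \<and> v \<in> (\<lambda>y. l *\<^sub>R y) ` C}"
    using gauge_member[of v] r by (simp only: mem_Collect_eq) simp
  then show ?thesis by blast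
qed

lemma gauge_bdd: "bdd_below {l. 0 \<le> l \<and> v \<in> (\<lambda>y. l *\<^sub>R y) ` C}"
  by (auto intro: bdd_belowI[of _ 0])

lemma gauge_nonneg: "0 \<le> gauge_fun C v"
  unfolding gauge_fun_Inf by (intro cInf_greatest gauge_ne) auto

lemma gauge_upper: "0 \<le> l \<Longrightarrow> v \<in> (\<lambda>y. l *\<^sub>R y) ` C \<Longrightarrow> gauge_fun C v \<le> l"
  unfolding gauge_fun_Inf by (intro cInf_lower gauge_bdd) auto

lemma gauge_le_norm: "gauge_fun C v \<le> norm v / r"
  using r by (intro gauge_upper gauge_member) auto

lemma gauge_zero: "gauge_fun C 0 = 0"
  using gauge_le_norm[of 0] gauge_nonneg[of 0] by simp

lemma gauge_less:
  assumes "gauge_fun C v < a" obtains l where "0 \<le> l" "l < a" "v \<in> (\<lambda>y. l *\<^sub>R y) ` C"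
proof -
  have "\<exists>l\<in>{l. 0 \<le> l \<and> v \<in> (\<lambda>y. l *\<^sub>R y) ` C}. l < a"
    using assms unfolding gauge_fun_Inf by (subst (asm) cInf_less_iff[OF gauge_ne gauge_bdd])
  then show thesis using that by blast
qed

lemma gauge_less_member: "gauge_fun C v < a \<Longrightarrow> v \<in> (\<lambda>y. a *\<^sub>R y) ` C"
  by (erule gauge_less) (rule scaled_mono, auto)

lemma gauge_homogeneous:
  assumes c: "0 < c" shows "gauge_fun C (c *\<^sub>R v) = c * gauge_fun C v"
proof -
  have le: "gauge_fun C (c *\<^sub>R v) \<le> c * gauge_fun C v" if c: "0 < c" for c v
  proof (rule field_le_epsilon)
    fix \<epsilon> :: real assume \<epsilon>: "0 < \<epsilon>"
    have "gauge_fun C v < gauge_fun C v + \<epsilon> / c" using \<epsilon> c by simp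
    then have "v \<in> (\<lambda>y. (gauge_fun C v + \<epsilon> / c) *\<^sub>R y) ` C" by (rule gauge_less_member)
    then obtain y where y: "y \<in> C" "v = (gauge_fun C v + \<epsilon> / c) *\<^sub>R y" by blast
    have "c *\<^sub>R v = (c * gauge_fun C v + \<epsilon>) *\<^sub>R y"
      using c by (subst y(2)) (simp add: distrib_left)
    then have "c *\<^sub>R v \<in> (\<lambda>y. (c * gauge_fun C v + \<epsilon>) *\<^sub>R y) ` C" using y(1) by blast
    then show "gauge_fun C (c *\<^sub>R v) \<le> c * gauge_fun C v + \<epsilon>"
      using c \<epsilon> gauge_nonneg[of v] by (intro gauge_upper) auto
  qed
  have "gauge_fun C ((1 / c) *\<^sub>R (c *\<^sub>R v)) \<le> (1 / c) * gauge_fun C (c *\<^sub>R v)" using c by (intro le) auto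
  then have "c * gauge_fun C v \<le> gauge_fun C (c *\<^sub>R v)" using c by (simp add: field_simps)
  then show ?thesis using le[OF c, of v] by simp
qed

text \<open>The gauge of a point is below \<open>a\<close> exactly when the point lies in \<open>q C\<close> for some rational \<open>q\<close> in
  \<open>[0, a)\<close>, and there are countably many of these closed sets.\<close>

lemma gauge_measurable [measurable]: "gauge_fun C \<in> borel_measurable borel"
proof (rule borel_measurableI_less)
  fix a :: real
  have "{v \<in> space borel. gauge_fun C v < a} = (\<Union>q\<in>{q\<in>\<rat>. 0 \<le> q \<and> q < a}. (\<lambda>y. q *\<^sub>R y) ` C)"
  proof (intro set_eqI iffI)
    fix v assume "v \<in> {v \<in> space borel. gauge_fun C v < a}"
    then obtain l where l: "0 \<le> l" "l < a" "v \<in> (\<lambda>y. l *\<^sub>R y) ` C" using gauge_less[of v a] by auto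
    obtain q where q: "q \<in> \<rat>" "l < q" "q < a" using Rats_dense_in_real[OF l(2)] by blast
    have "v \<in> (\<lambda>y. q *\<^sub>R y) ` C" using scaled_mono[OF l(1) _ l(3), of q] q by simp
    then show "v \<in> (\<Union>q\<in>{q\<in>\<rat>. 0 \<le> q \<and> q < a}. (\<lambda>y. q *\<^sub>R y) ` C)" using q l(1) by (intro UN_I[of q]) auto
  next
    fix v assume "v \<in> (\<Union>q\<in>{q\<in>\<rat>. 0 \<le> q \<and> q < a}. (\<lambda>y. q *\<^sub>R y) ` C)"
    then obtain q where "0 \<le> q" "q < a" "v \<in> (\<lambda>y. q *\<^sub>R y) ` C" by blast
    then show "v \<in> {v \<in> space borel. gauge_fun C v < a}" using gauge_upper[of q v] by auto
  qed
  also have "\<dots> \<in> sets borel"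
  proof (rule sets.countable_UN'')
    show "countable {q\<in>\<rat>. 0 \<le> q \<and> q < (a::real)}" using countable_rat by (rule countable_subset[rotated]) auto
    show "(\<lambda>y. q *\<^sub>R y) ` C \<in> sets borel" if "q \<in> {q\<in>\<rat>. 0 \<le> q \<and> q < a}" for q
      using compact_scaling[OF compact, of q] by (simp add: compact_imp_closed borel_closed)
  qed
  finally show "{v \<in> space borel. gauge_fun C v < a} \<in> sets borel" .
qed

lemma haar_gauge:
  assumes s: "0 < s"
  shows "(\<integral>x. gauge_norm (to_fun ` C) x \<partial>haar_sphere n) * radial_mass s = (\<integral>v. gauge_fun C v * gauss s v \<partial>lborel)"
    and "0 \<le> (\<integral>x. gauge_norm (to_fun ` C) x \<partial>haar_sphere n)"
    and "integrable lborel (\<lambda>v. gauge_fun C v * gauss s v)"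
proof -
  have sp: "space (haar_sphere n) = sphere_n n"
    using haar_sphere_eq[OF s] by (simp add: haar_def[OF s] space_restrict_space)
  have eq: "gauge_norm (to_fun ` C) x = gauge_fun C (to_vec x)" if "x \<in> space (haar_sphere n)" for x
    using that to_fun_to_vec[OF sphere_to_vec(2)] by (simp add: gauge_fun_def sp)
  have c: "(\<integral>x. gauge_norm (to_fun ` C) x \<partial>haar_sphere n) = (\<integral>x. gauge_fun C (to_vec x) \<partial>haar_sphere n)"
    by (intro Bochner_Integration.integral_cong refl eq)
  show "(\<integral>x. gauge_norm (to_fun ` C) x \<partial>haar_sphere n) * radial_mass s = (\<integral>v. gauge_fun C v * gauss s v \<partial>lborel)"
    unfolding c using haar_integral_homogeneous[OF s, of "\<lambda>x. gauge_fun C (to_vec x)"]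
    by (simp add: gauge_homogeneous gauge_zero)
  show "0 \<le> (\<integral>x. gauge_norm (to_fun ` C) x \<partial>haar_sphere n)"
    unfolding c by (intro integral_nonneg_AE AE_I2 gauge_nonneg)
  show "integrable lborel (\<lambda>v. gauge_fun C v * gauss s v)"
  proof (rule gauss_weight_integrable[OF s, where c="1 / r"])
    fix v :: "real^'n::_"
    have "\<bar>gauge_fun C v\<bar> \<le> 1 / r * norm v" using gauge_le_norm[of v] gauge_nonneg[of v] by simp
    also have "\<dots> \<le> 1 / r * (1 + norm v)\<^sup>2"
      using r by (intro mult_left_mono) (auto simp: power2_eq_square algebra_simps)
    finally show "\<bar>gauge_fun C v\<bar> \<le> 1 / r * (1 + norm v)\<^sup>2" .
  qed measurable
qed

end

end

section \<open>Isotropic convex bodies\<close>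

locale isotropic_body = enumeration e n for e :: "nat \<Rightarrow> 'n::{finite,wellorder}" and n +
  fixes K :: "(nat \<Rightarrow> real) set"
  assumes isotropic: "isotropic_convex_body n K"
begin

lemma body: "convex_body n K" and law: "isotropic_law n (uniform_measure (lebesgue_n n) K)"
  using isotropic by (auto simp: isotropic_convex_body_def)

lemma K_compact: "compact K" and K_space: "K \<subseteq> space_n n"
proof -
  have c: "compactin (Euclidean_space n) K" using body by (simp add: convex_body_def)
  show "K \<subseteq> space_n n" using compactin_subset_topspace[OF c] by simp
  show "compact K" using c unfolding Euclidean_space_def compactin_subtopology
    by (simp add: euclidean_product_topology)
qed

definition Kv :: "(real^'n::_) set" where "Kv = to_vec ` K"

lemma mem_Kv: "to_fun v \<in> K \<longleftrightarrow> v \<in> Kv"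
  using K_space by (auto simp: Kv_def image_iff to_fun_to_vec intro!: bexI[of _ "to_fun v"])

lemma K_eq: "K = to_fun ` Kv"
  using K_space by (auto simp: Kv_def image_image to_fun_to_vec subset_iff intro!: image_eqI)

lemma Kv_compact: "compact Kv"
  unfolding Kv_def by (intro compact_continuous_image to_vec_continuous K_compact)

lemma Kv_convex: "convex Kv"
proof (rule convexI)
  fix u v :: "real^'n::_" and a b :: real assume uv: "u \<in> Kv" "v \<in> Kv" and ab: "0 \<le> a" "0 \<le> b" "a + b = 1"
  have "(\<lambda>i. (1 - b) * to_fun u i + b * to_fun v i) \<in> K"
    using body uv ab by (auto simp: convex_body_def mem_Kv)
  moreover have "(\<lambda>i. (1 - b) * to_fun u i + b * to_fun v i) = to_fun (a *\<^sub>R u + b *\<^sub>R v)"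
    using ab by (auto simp: to_fun_def fun_eq_iff)
  ultimately show "a *\<^sub>R u + b *\<^sub>R v \<in> Kv" by (simp add: mem_Kv)
qed

lemma Kv_ball: obtains r where "0 < r" "cball 0 r \<subseteq> Kv"
proof -
  have "(\<lambda>_. 0) \<in> (Euclidean_space n) interior_of K" using body by (simp add: convex_body_def)
  then obtain U where U: "openin (Euclidean_space n) U" "(\<lambda>_. 0) \<in> U" "U \<subseteq> K" by (auto simp: interior_of_def)
  then obtain T where T: "open T" "U = T \<inter> {x. \<forall>i\<ge>n. x i = 0}"
    unfolding Euclidean_space_def openin_subtopology by (auto simp: euclidean_product_topology)
  have op: "open (to_fun -` T)" using T(1) to_fun_continuous[of UNIV] by (rule open_vimage)
  have "to_fun 0 = (\<lambda>_. 0)" by (auto simp: to_fun_def)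
  then have "0 \<in> to_fun -` T" using U T by auto
  then obtain r where r: "0 < r" "cball 0 r \<subseteq> to_fun -` T" using op open_contains_cball by blast
  have "to_fun -` T \<subseteq> Kv" using U(3) T(2) to_fun_space by (auto simp: topspace_Euclidean_space mem_Kv[symmetric])
  then show thesis using r that by blast
qed

lemma Kv_borel [measurable]: "Kv \<in> sets borel"
  by (simp add: Kv_compact compact_imp_closed borel_closed)

lemma K_borel [measurable]: "K \<in> sets borel"
  by (simp add: K_compact compact_imp_closed borel_closed)

definition vol :: real where "vol = measure lborel Kv"

lemma Kv_finite: "emeasure lborel Kv < \<infinity>"
  using Kv_compact by (rule emeasure_compact_finite)

lemma emeasure_Kv: "emeasure lborel Kv = ennreal vol"
  using Kv_finite unfolding vol_def by (intro emeasure_eq_ennreal_measure) auto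

lemma vol_pos: "0 < vol"
proof -
  obtain r where r: "0 < r" "cball 0 r \<subseteq> Kv" by (rule Kv_ball)
  have "0 < measure lborel (ball (0::real^'n::_) r)" using r(1) by (simp add: content_ball_pos)
  also have "\<dots> \<le> vol"
    unfolding vol_def using r Kv_finite by (intro measure_mono_fmeasurable) (auto simp: fmeasurable_def)
  finally show ?thesis .
qed

lemma emeasure_K: "emeasure (lebesgue_n n) K = ennreal vol"
proof -
  have "to_fun -` K = Kv" by (auto simp: mem_Kv)
  then show ?thesis using lebesgue_n_vimage[OF K_borel] emeasure_Kv by simp
qed

lemma measure_K: "measure (lebesgue_n n) K = vol"
  using emeasure_K vol_pos by (simp add: measure_def)

text \<open>The uniform law on the body, as a density rather than by \<^const>\<open>uniform_measure\<close>, so that it can be moved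
  between the two coordinate systems.\<close>

definition \<nu> :: "(real^'n::_) measure" where "\<nu> = density lborel (\<lambda>x. ennreal (indicator Kv x / vol))"

lemma sets_nu [simp, measurable_cong]: "sets \<nu> = sets borel" by (simp add: \<nu>_def)

lemma indicator_div: "indicator A x / ennreal vol = ennreal (indicator A x / vol)"
  using vol_pos by (auto simp: indicator_def divide_ennreal[symmetric] split: if_splits)

lemma uniform_K: "uniform_measure (lebesgue_n n) K = distr \<nu> borel to_fun"
proof -
  have "uniform_measure (lebesgue_n n) K = density (distr lborel borel to_fun) (\<lambda>x. ennreal (indicator K x / vol))"
    by (simp add: uniform_measure_def emeasure_K indicator_div lebesgue_n_eq[symmetric])
  also have "\<dots> = distr (density lborel (\<lambda>x. ennreal (indicator K (to_fun x) / vol))) borel to_fun"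
    by (rule density_distr) measurable
  also have "(\<lambda>x. ennreal (indicator K (to_fun x) / vol)) = (\<lambda>x. ennreal (indicator Kv x / vol))"
    by (auto simp: indicator_def mem_Kv)
  finally show ?thesis by (simp add: \<nu>_def)
qed

lemma prob_space_uniform: "prob_space (uniform_measure (lebesgue_n n) K)"
  using emeasure_K vol_pos by (intro prob_space_uniform_measure) auto

lemma prob_space_nu: "prob_space \<nu>"
proof
  show "emeasure \<nu> (space \<nu>) = 1"
  proof -
    have "emeasure \<nu> (space \<nu>) = (\<integral>\<^sup>+x. indicator Kv x / ennreal vol \<partial>lborel)"
      by (simp add: \<nu>_def emeasure_density indicator_div)
    also have "\<dots> = (\<integral>\<^sup>+x. indicator Kv x \<partial>lborel) / ennreal vol"
      by (rule nn_integral_divide) simp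
    also have "\<dots> = 1" using vol_pos by (simp add: emeasure_Kv divide_ennreal flip: ennreal_1)
    finally show ?thesis .
  qed
qed

lemma log_concave_uniform: "log_concave_law n (uniform_measure (lebesgue_n n) K)"
  unfolding log_concave_law_def
proof (intro conjI exI[of _ "\<lambda>x. if x \<in> K then ereal (ln vol) else \<infinity>"] prob_space_uniform ballI)
  show "(\<lambda>x. if x \<in> K then ereal (ln vol) else \<infinity>) \<in> borel_measurable borel"
    by measurable
  show "(if x \<in> K then ereal (ln vol) else \<infinity>) \<noteq> -\<infinity>" for x by simp
  show "uniform_measure (lebesgue_n n) K = density (lebesgue_n n) (\<lambda>x. exp_neg (if x \<in> K then ereal (ln vol) else \<infinity>))"
    unfolding uniform_measure_def
  proof (rule arg_cong[where f="density (lebesgue_n n)"], rule ext)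
    fix x
    show "indicator K x / emeasure (lebesgue_n n) K = exp_neg (if x \<in> K then ereal (ln vol) else \<infinity>)"
      using vol_pos by (simp add: emeasure_K indicator_div exp_neg_def exp_minus exp_ln inverse_eq_divide)
  qed
  fix x y :: "nat \<Rightarrow> real" and t :: real assume t: "t \<in> {0<..<1}"
  show "(if (\<lambda>i. (1 - t) * x i + t * y i) \<in> K then ereal (ln vol) else \<infinity>)
      \<le> ereal (1 - t) * (if x \<in> K then ereal (ln vol) else \<infinity>) + ereal t * (if y \<in> K then ereal (ln vol) else \<infinity>)"
  proof (cases "x \<in> K \<and> y \<in> K")
    case True
    then have "(\<lambda>i. (1 - t) * x i + t * y i) \<in> K" using body t by (auto simp: convex_body_def)
    then show ?thesis using True by (simp add: algebra_simps)
  next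
    case False
    then have "ereal (1 - t) * (if x \<in> K then ereal (ln vol) else \<infinity>) + ereal t * (if y \<in> K then ereal (ln vol) else \<infinity>) = \<infinity>"
      using t by (auto simp: ereal_mult_infty)
    then show ?thesis by (simp only: ereal_less_eq(1))
  qed
qed

lemma nu_transfer:
  fixes f :: "(nat \<Rightarrow> real) \<Rightarrow> real"
  assumes [measurable]: "f \<in> borel_measurable borel"
  shows "(\<integral>x. f x \<partial>uniform_measure (lebesgue_n n) K) = (\<integral>x. f (to_fun x) \<partial>\<nu>)"
    "integrable (uniform_measure (lebesgue_n n) K) f \<longleftrightarrow> integrable \<nu> (\<lambda>x. f (to_fun x))"
  unfolding uniform_K by (auto intro!: integral_distr integrable_distr_eq)

lemma nu_moments:
  shows "(\<integral>x. v \<bullet> x \<partial>\<nu>) = 0" "(\<integral>x. (v \<bullet> x)\<^sup>2 \<partial>\<nu>) = v \<bullet> v"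
    "integrable \<nu> (\<lambda>x. v \<bullet> x)" "integrable \<nu> (\<lambda>x. (v \<bullet> x)\<^sup>2)"
    "norm v = 1 \<Longrightarrow> integrable \<nu> (\<lambda>x. (v \<bullet> x) ^ 4)" "norm v = 1 \<Longrightarrow> (\<integral>x. (v \<bullet> x) ^ 4 \<partial>\<nu>) \<le> 40000"
proof -
  have su: "sets (uniform_measure (lebesgue_n n) K) = sets borel" by simp
  note sq = isotropic_inner_square[OF prob_space_uniform su law, of "to_fun v"]
  have i: "inner_n n (to_fun x) (to_fun v) = v \<bullet> x" for x by (simp add: inner_to_vec inner_commute)
  show "(\<integral>x. v \<bullet> x \<partial>\<nu>) = 0" "(\<integral>x. (v \<bullet> x)\<^sup>2 \<partial>\<nu>) = v \<bullet> v"
    "integrable \<nu> (\<lambda>x. v \<bullet> x)" "integrable \<nu> (\<lambda>x. (v \<bullet> x)\<^sup>2)"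
    using sq by (simp_all add: nu_transfer i)
  assume "norm v = 1"
  then have "inner_n n (to_fun v) (to_fun v) = 1" by (simp add: i norm_eq_1)
  note q = isotropic_log_concave_fourth_moment[OF log_concave_uniform law this]
  show "integrable \<nu> (\<lambda>x. (v \<bullet> x) ^ 4)" "(\<integral>x. (v \<bullet> x) ^ 4 \<partial>\<nu>) \<le> 40000"
    using q by (simp_all add: nu_transfer i)
qed

lemma nu_norm: "integrable \<nu> (\<lambda>x. (norm x)\<^sup>2)" "(\<integral>x. (norm x)\<^sup>2 \<partial>\<nu>) = real n"
proof -
  have eq: "(norm x)\<^sup>2 = (\<Sum>k\<in>UNIV. (axis k 1 \<bullet> x)\<^sup>2)" for x :: "real^'n::_"
  proof -
    have "x \<bullet> x = (\<Sum>k\<in>UNIV. x $ k * x $ k)" by (simp only: inner_vec_def inner_real_def)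
    then show ?thesis unfolding power2_norm_eq_inner inner_axis' by (simp only: power2_eq_square inner_real_def mult_1_left)
  qed
  show "integrable \<nu> (\<lambda>x. (norm x)\<^sup>2)" unfolding eq by (intro Bochner_Integration.integrable_sum nu_moments)
  show "(\<integral>x. (norm x)\<^sup>2 \<partial>\<nu>) = real n" unfolding eq
    by (subst Bochner_Integration.integral_sum) (auto intro: nu_moments simp: nu_moments card_n inner_axis_axis)
qed

lemma nu_tail:
  assumes t: "0 < t"
  shows "measure \<nu> {x. t * sqrt (real n) < norm x} \<le> 1 / t\<^sup>2" 
proof -
  interpret prob_space \<nu> by (rule prob_space_nu)
  have n0: "0 < real n" using card_n by (metis of_nat_0_less_iff zero_less_card_finite)
  have "measure \<nu> {x\<in>space \<nu>. t\<^sup>2 * real n \<le> (norm x)\<^sup>2} \<le> (\<integral>x. (norm x)\<^sup>2 \<partial>\<nu>) / (t\<^sup>2 * real n)"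
    using t n0 by (intro integral_Markov_inequality_measure[where A="{}"] nu_norm) auto
  also have "\<dots> = 1 / t\<^sup>2" using n0 by (simp add: nu_norm)
  finally have 1: "measure \<nu> {x\<in>space \<nu>. t\<^sup>2 * real n \<le> (norm x)\<^sup>2} \<le> 1 / t\<^sup>2" .
  have "measure \<nu> {x. t * sqrt (real n) < norm x} \<le> measure \<nu> {x\<in>space \<nu>. t\<^sup>2 * real n \<le> (norm x)\<^sup>2}"
  proof (rule finite_measure_mono)
    show "{x. t * sqrt (real n) < norm x} \<subseteq> {x\<in>space \<nu>. t\<^sup>2 * real n \<le> (norm x)\<^sup>2}"
    proof safe
      fix x :: "real^'n::_" assume "t * sqrt (real n) < norm x"
      then have "(t * sqrt (real n))\<^sup>2 \<le> (norm x)\<^sup>2" using t by (intro power_mono) auto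
      then show "t\<^sup>2 * real n \<le> (norm x)\<^sup>2" by (simp add: power_mult_distrib)
    qed (simp add: \<nu>_def)
  qed measurable
  with 1 show ?thesis by simp
qed

text \<open>Chebyshev's inequality leaves at most the fraction \<open>1 / 1000\<^sup>2\<close> of the body outside this ball.\<close>

definition radius :: real where "radius = 1000 * sqrt (real n)"

definition Q :: "(real^'n::_) set" where "Q = Kv \<inter> cball 0 radius"

definition body_measure :: "(real^'n::_) measure" where "body_measure = density lborel (indicator Q)"

lemma Q_compact: "compact Q" and Q_convex: "convex Q" and Q_subset: "Q \<subseteq> Kv"
  by (auto simp: Q_def Kv_compact Kv_convex intro: compact_Int_closed convex_Int)

lemma Q_borel [measurable]: "Q \<in> sets borel"
  by (simp add: Q_compact compact_imp_closed borel_closed)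

lemma AE_Kv: "AE x in \<nu>. x \<in> Kv"
  unfolding \<nu>_def by (subst AE_density) (auto simp: indicator_def)

lemma nu_outside_Q: "measure \<nu> (- Q) \<le> 1 / 1000000"
proof -
  interpret prob_space \<nu> by (rule prob_space_nu)
  have "measure \<nu> (- Q) \<le> measure \<nu> {x. 1000 * sqrt (real n) < norm x}"
    using AE_Kv by (intro finite_measure_mono_AE) (auto elim!: eventually_mono simp: Q_def radius_def)
  also have "\<dots> \<le> 1 / 1000\<^sup>2" by (rule nu_tail) simp
  finally show ?thesis by simp
qed

lemma nu_Q: "1 - 1 / 1000000 \<le> measure \<nu> Q"
proof -
  interpret prob_space \<nu> by (rule prob_space_nu)
  have "measure \<nu> (space \<nu> - Q) = 1 - measure \<nu> Q" by (intro prob_compl) auto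
  moreover have "space \<nu> - Q = - Q" by (auto simp: \<nu>_def)
  ultimately show ?thesis using nu_outside_Q by simp
qed

lemma nu_integral: 
  fixes f :: "real^'n::_ \<Rightarrow> real" assumes [measurable]: "f \<in> borel_measurable borel"
  shows "(\<integral>x. f x \<partial>\<nu>) = (\<integral>x. indicator Kv x * f x \<partial>lborel) / vol"
proof -
  have "(\<integral>x. f x \<partial>\<nu>) = (\<integral>x. (indicator Kv x / vol) *\<^sub>R f x \<partial>lborel)"
    unfolding \<nu>_def using vol_pos by (intro integral_density) (auto simp: indicator_def)
  then show ?thesis by simp
qed

lemma body_integral:
  fixes f :: "real^'n::_ \<Rightarrow> real" assumes [measurable]: "f \<in> borel_measurable borel"
  shows "(\<integral>x. f x \<partial>body_measure) = vol * (\<integral>x. indicator Q x * f x \<partial>\<nu>)"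
proof -
  have "(\<integral>x. f x \<partial>body_measure) = (\<integral>x. indicator Q x *\<^sub>R f x \<partial>lborel)"
    unfolding body_measure_def ennreal_indicator[symmetric] by (intro integral_density) auto
  also have "\<dots> = (\<integral>x. indicator Kv x * (indicator Q x * f x) \<partial>lborel)"
    using Q_subset by (intro Bochner_Integration.integral_cong) (auto simp: indicator_def)
  finally show ?thesis using vol_pos by (simp add: nu_integral)
qed

lemma emeasure_Q_pos: "0 < emeasure lborel Q"
proof -
  have "measure \<nu> Q > 0" using nu_Q by simp
  moreover have "measure \<nu> Q = (\<integral>x. indicator Kv x * indicator Q x \<partial>lborel) / vol"
    using nu_integral[of "indicator Q"] by simp
  ultimately have "(\<integral>x. indicator Kv x * indicator Q x \<partial>lborel) > (0::real)"
    using vol_pos by (simp only: zero_less_divide_iff) simp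
  moreover have "(\<lambda>x. indicator Kv x * indicator Q x :: real) = indicator Q" using Q_subset by (auto simp: indicator_def fun_eq_iff)
  ultimately have "0 < measure lborel Q" by simp
  then show ?thesis by (simp add: measure_def zero_less_iff_neq_zero) (metis enn2real_0 less_irrefl)
qed

sublocale compact_measure body_measure radius
proof (rule compact_measure.intro)
  have "emeasure lborel Q < \<infinity>" using Q_compact by (rule emeasure_compact_finite)
  then show "finite_measure body_measure"
    by (intro finite_measureI) (simp add: body_measure_def emeasure_density)
  show "compact_measure_axioms body_measure radius"
  proof
  show "sets body_measure = sets borel" by (simp add: body_measure_def)
  show "AE x in body_measure. norm x \<le> radius"
    unfolding body_measure_def by (subst AE_density) (measurable, auto simp: Q_def indicator_def)
  fix v :: "real^'n::_" and c assume v: "v \<noteq> 0"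
  show "\<not> (AE x in body_measure. v \<bullet> x = c)"
  proof
    assume "AE x in body_measure. v \<bullet> x = c"
    then have 1: "AE x in lborel. x \<in> Q \<longrightarrow> v \<bullet> x = c"
      unfolding body_measure_def by (subst (asm) AE_density) (auto simp: indicator_def split: if_splits elim: eventually_mono)
    have "negligible {x. v \<bullet> x = c}" using v by (intro negligible_hyperplane) auto
    then have "{x. v \<bullet> x = c} \<in> null_sets lebesgue" by (simp add: negligible_iff_null_sets)
    then have "{x. v \<bullet> x = c} \<in> null_sets lborel"
      using null_sets_completion_iff[of "{x. v \<bullet> x = c}" lborel] by simp
    then have "AE x in lborel. \<not> v \<bullet> x = c" by (auto dest: AE_not_in)
    with 1 have "AE x in lborel. x \<notin> Q" by eventually_elim auto
    then have "emeasure lborel Q = 0" by (subst (asm) AE_iff_measurable[OF _ refl]) auto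
    then show False using emeasure_Q_pos by simp
  qed
  qed
qed

lemma AE_Q: "AE x in body_measure. x \<in> Q"
  unfolding body_measure_def by (subst AE_density) (auto simp: indicator_def)

lemma mean_zero:
  assumes [measurable]: "\<phi> \<in> borel_measurable borel"
  shows "mean \<phi> 0 = (\<integral>x. indicator Q x * \<phi> x \<partial>\<nu>) / measure \<nu> Q"
proof -
  have mom: "mom \<phi> 0 = vol * (\<integral>x. indicator Q x * \<phi> x \<partial>\<nu>)" if "\<phi> \<in> borel_measurable borel" for \<phi>
    unfolding mom_def inner_zero_left exp_zero mult_1_right by (rule body_integral[OF that])
  show ?thesis
    unfolding mean_def using mom[OF assms] mom[of "\<lambda>_. 1"] vol_pos by simp
qed

text \<open>Cutting off the part of the body outside the ball changes the second moment in a direction by at most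
  the square root of the fourth moment times the mass cut off, which is \<open>sqrt (40000 / 1000000) = 2 / 10\<close>,
  and the first moment by at most \<open>1 / 1000\<close>.\<close>

lemma cov_zero_unit:
  assumes v: "norm v = 1"
  shows "1 / 2 \<le> v \<bullet> (cov 0 *v v)"
proof -
  interpret N: prob_space \<nu> by (rule prob_space_nu)
  note m = nu_moments[of v]
  have vv: "v \<bullet> v = 1" using v by (simp add: norm_eq_1)
  define p where "p = measure \<nu> Q"
  have p: "1 - 1 / 1000000 \<le> p" "p \<le> 1" using nu_Q by (auto simp: p_def)
  have iQ: "integrable \<nu> (indicator (- Q) :: _ \<Rightarrow> real)" by (intro N.integrable_const_bound[where B=1]) auto
  have i2: "integrable \<nu> (\<lambda>x. indicator Q x * (v \<bullet> x)\<^sup>2)"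
    by (rule Bochner_Integration.integrable_bound[OF m(4)]) (auto simp: indicator_def)
  have i1: "integrable \<nu> (\<lambda>x. indicator Q x * (v \<bullet> x))"
    by (rule Bochner_Integration.integrable_bound[OF m(3)]) (auto simp: indicator_def)
  have a2: "8 / 10 \<le> (\<integral>x. indicator Q x * (v \<bullet> x)\<^sup>2 \<partial>\<nu>)"
  proof -
    \<comment> \<open>Cauchy--Schwarz in pointwise form: \<open>2 u \<le> u\<^sup>2 / 200000 + 200000\<close> with \<open>u = (v \<bullet> x)\<^sup>2\<close>; the constant balances the two moments.\<close>
    have pt: "(v \<bullet> x)\<^sup>2 \<le> indicator Q x * (v \<bullet> x)\<^sup>2 + (1 / 400000 * (v \<bullet> x)^4 + 100000 * indicator (- Q) x)" for x
    proof (cases "x \<in> Q")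
      case False
      have "0 \<le> ((v \<bullet> x)\<^sup>2 - 200000)\<^sup>2" by simp
      then have "400000 * (v \<bullet> x)\<^sup>2 \<le> (v \<bullet> x)^4 + 40000000000" by (simp add: power2_eq_square power4_eq_xxxx algebra_simps)
      then show ?thesis using False by simp
    qed simp
    have "1 \<le> (\<integral>x. indicator Q x * (v \<bullet> x)\<^sup>2 + (1 / 400000 * (v \<bullet> x)^4 + 100000 * indicator (- Q) x) \<partial>\<nu>)"
      using m(2) vv integral_mono[OF m(4) _ pt] m(5)[OF v] i2 iQ by simp
    also have "\<dots> = (\<integral>x. indicator Q x * (v \<bullet> x)\<^sup>2 \<partial>\<nu>) + (1 / 400000 * (\<integral>x. (v \<bullet> x)^4 \<partial>\<nu>) + 100000 * measure \<nu> (- Q))"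
      using m(5)[OF v] i2 iQ by simp
    also have "\<dots> \<le> (\<integral>x. indicator Q x * (v \<bullet> x)\<^sup>2 \<partial>\<nu>) + (1 / 400000 * 40000 + 100000 * (1 / 1000000))"
      using m(6)[OF v] nu_outside_Q by (intro add_left_mono add_mono mult_left_mono) auto
    finally show ?thesis by simp
  qed
  have a1: "\<bar>\<integral>x. indicator Q x * (v \<bullet> x) \<partial>\<nu>\<bar> \<le> 1 / 1000"
  proof -
    have j: "integrable \<nu> (\<lambda>x. indicator (- Q) x * (v \<bullet> x))"
      by (rule Bochner_Integration.integrable_bound[OF m(3)]) (auto simp: indicator_def)
    have "(\<integral>x. indicator Q x * (v \<bullet> x) \<partial>\<nu>) + (\<integral>x. indicator (- Q) x * (v \<bullet> x) \<partial>\<nu>) = (\<integral>x. indicator Q x * (v \<bullet> x) + indicator (- Q) x * (v \<bullet> x) \<partial>\<nu>)"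
      using i1 j by simp
    also have "\<dots> = (\<integral>x. v \<bullet> x \<partial>\<nu>)" by (intro Bochner_Integration.integral_cong) (auto simp: indicator_def)
    finally have eq: "(\<integral>x. indicator Q x * (v \<bullet> x) \<partial>\<nu>) = - (\<integral>x. indicator (- Q) x * (v \<bullet> x) \<partial>\<nu>)" using m(1) by simp
    have pt: "\<bar>indicator (- Q) x * (v \<bullet> x)\<bar> \<le> 1 / 2000 * (v \<bullet> x)\<^sup>2 + 500 * indicator (- Q) x" for x
    proof (cases "x \<in> Q")
      case False
      have "0 \<le> (\<bar>v \<bullet> x\<bar> - 1000)\<^sup>2" by simp
      then have "2000 * \<bar>v \<bullet> x\<bar> \<le> (v \<bullet> x)\<^sup>2 + 1000000" by (simp add: power2_diff)
      then show ?thesis using False by simp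
    qed simp
    have "\<bar>\<integral>x. indicator (- Q) x * (v \<bullet> x) \<partial>\<nu>\<bar> \<le> (\<integral>x. \<bar>indicator (- Q) x * (v \<bullet> x)\<bar> \<partial>\<nu>)" by (rule integral_abs_bound)
    also have "\<dots> \<le> (\<integral>x. 1 / 2000 * (v \<bullet> x)\<^sup>2 + 500 * indicator (- Q) x \<partial>\<nu>)"
      by (intro integral_mono pt integrable_abs j Bochner_Integration.integrable_add integrable_mult_right m iQ)
    also have "\<dots> = 1 / 2000 * 1 + 500 * measure \<nu> (- Q)" using m(2,4) vv iQ by simp
    also have "\<dots> \<le> 1 / 1000" using nu_outside_Q by simp
    finally show ?thesis unfolding eq by simp
  qed
  have c: "v \<bullet> (cov 0 *v v) = mean (\<lambda>x. (v \<bullet> x)\<^sup>2) 0 - (mean (\<lambda>x. v \<bullet> x) 0)\<^sup>2"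
    unfolding cov_bilinear
    by (simp add: inner_diff_right left_diff_distrib right_diff_distrib mean_diff mean_add mean_cmult mean_multc inner_bary power2_eq_square)
  have "8 / 10 \<le> mean (\<lambda>x. (v \<bullet> x)\<^sup>2) 0"
  proof -
    have "(\<integral>x. indicator Q x * (v \<bullet> x)\<^sup>2 \<partial>\<nu>) * p \<le> (\<integral>x. indicator Q x * (v \<bullet> x)\<^sup>2 \<partial>\<nu>) * 1"
      using p a2 by (intro mult_left_mono) auto
    then have "(\<integral>x. indicator Q x * (v \<bullet> x)\<^sup>2 \<partial>\<nu>) \<le> mean (\<lambda>x. (v \<bullet> x)\<^sup>2) 0"
      using p by (simp add: mean_zero p_def[symmetric] pos_le_divide_eq)
    then show ?thesis using a2 by simp
  qed
  moreover have "(mean (\<lambda>x. v \<bullet> x) 0)\<^sup>2 \<le> (1 / 10)\<^sup>2"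
  proof -
    have "\<bar>mean (\<lambda>x. v \<bullet> x) 0\<bar> = \<bar>\<integral>x. indicator Q x * (v \<bullet> x) \<partial>\<nu>\<bar> / p" using p by (simp add: mean_zero p_def[symmetric])
    also have "\<dots> \<le> 1 / 10" using a1 p by (simp add: pos_divide_le_eq)
    finally have "\<bar>mean (\<lambda>x. v \<bullet> x) 0\<bar> \<le> \<bar>1 / 10\<bar>" by simp
    then show ?thesis by (rule abs_le_square_iff[THEN iffD1])
  qed
  ultimately show ?thesis unfolding c by (simp add: power_divide)
qed

lemma cov_zero: "1 / 2 * (v \<bullet> v) \<le> v \<bullet> (cov 0 *v v)"
proof (cases "v = 0")
  case False
  define u where "u = v /\<^sub>R norm v"
  have u: "norm u = 1" "v = norm v *\<^sub>R u" using False by (auto simp: u_def)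
  have "v \<bullet> (cov 0 *v v) = (norm v)\<^sup>2 * (u \<bullet> (cov 0 *v u))"
    by (subst (1 2) u(2)) (simp add: matrix_vector_mult_scaleR power2_eq_square)
  moreover have "(norm v)\<^sup>2 * (1 / 2) \<le> (norm v)\<^sup>2 * (u \<bullet> (cov 0 *v u))"
    by (intro mult_left_mono cov_zero_unit u) auto
  ultimately show ?thesis by (simp add: power2_norm_eq_inner)
qed simp
end

context isotropic_body
begin

text \<open>The law of \<open>B (x - b)\<close> under the tilt has a density of the form \<open>exp (- H)\<close> with \<open>H\<close> affine on a convex
  set and infinite outside, and \<open>B\<close> is chosen so that this law is isotropic.  It is therefore one of the
  laws over which \<^const>\<open>tau_n\<close> takes its supremum.\<close>

lemma tilted_third_moments:
  fixes B :: "real^'n::_^'n::_"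
  assumes B: "B ** cov \<xi> ** transpose B = mat 1" and \<theta>: "norm \<theta> = 1"
  shows "(\<Sum>i\<in>UNIV. \<Sum>j\<in>UNIV. (mean (\<lambda>x. (B *v (x - bary \<xi>)) $ i * (B *v (x - bary \<xi>)) $ j
         * (\<theta> \<bullet> (B *v (x - bary \<xi>)))) \<xi>)\<^sup>2) \<le> (tau_n n)\<^sup>2"
proof -
  define C where "C = cov \<xi> ** transpose B"
  define b where "b = bary \<xi>"
  define Y where "Y = (\<lambda>x. B *v (x - b))"
  define X where "X = (\<lambda>y. C *v y + b)"
  have BC: "B ** C = mat 1" using B by (simp add: C_def matrix_mul_assoc)
  then have CB: "C ** B = mat 1" by (simp add: matrix_left_right_inverse)
  have XY: "X (Y x) = x" for x by (simp add: X_def Y_def matrix_vector_mul_assoc CB)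
  define D where "D = \<bar>det B\<bar>"
  have "det B * det C = 1" using BC by (metis det_mul det_I)
  then have dB: "det B \<noteq> 0" by auto
  then have D: "0 < D" by (simp add: D_def)
  define Z where "Z = mom (\<lambda>_. 1) \<xi>"
  have Z: "0 < Z" by (simp add: Z_def mom_pos)
  have fB [measurable]: "(\<lambda>x. B *v x) \<in> borel_measurable borel" and fC [measurable]: "(\<lambda>x. C *v x) \<in> borel_measurable borel"
    by (intro borel_measurable_continuous_onI matrix_vector_mult_linear_continuous_on)+
  have [measurable]: "Y \<in> borel_measurable borel" unfolding Y_def by measurable
  have [measurable]: "X \<in> borel_measurable borel" unfolding X_def by measurable
  have distr_B: "distr lborel borel (\<lambda>x. B *v x) = density lborel (\<lambda>_. ennreal (1 / D))"
  proof -
    have "lborel = density (distr lborel borel (\<lambda>x. B *v x)) (\<lambda>_. ennreal D)"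
      using lborel_linear_image[of "\<lambda>x. B *v x"] dB by (simp add: matrix_of_matrix_vector_mul D_def)
    then have "density lborel (\<lambda>_. ennreal (1 / D)) = density (density (distr lborel borel (\<lambda>x. B *v x)) (\<lambda>_. ennreal D)) (\<lambda>_. ennreal (1 / D))"
      by simp
    also have "\<dots> = density (distr lborel borel (\<lambda>x. B *v x)) (\<lambda>_. ennreal D * ennreal (1 / D))"
      by (rule density_density_eq) auto
    also have "ennreal D * ennreal (1 / D) = 1" using D by (simp flip: ennreal_mult)
    finally show ?thesis by (simp add: density_1)
  qed
  have distr_Y: "distr lborel borel Y = density lborel (\<lambda>_. ennreal (1 / D))"
  proof -
    have Yc: "Y = (+) (- (B *v b)) \<circ> (\<lambda>x. B *v x)" by (auto simp: Y_def fun_eq_iff matrix_vector_mult_diff_distrib)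
    have "distr lborel borel Y = distr (distr lborel borel (\<lambda>x. B *v x)) borel ((+) (- (B *v b)))"
      unfolding Yc by (rule distr_distr[symmetric]) measurable
    also have "\<dots> = density (distr lborel borel ((+) (- (B *v b)))) (\<lambda>_. ennreal (1 / D))"
      unfolding distr_B by (rule density_distr[symmetric]) measurable
    finally show ?thesis unfolding lborel_distr_plus .
  qed
  define g where "g = (\<lambda>x. indicator Q x * exp (\<xi> \<bullet> x) / Z)"
  have g0: "0 \<le> g x" for x using Z by (simp add: g_def)
  have [measurable]: "g \<in> borel_measurable borel" unfolding g_def by measurable
  define T where "T = density lborel (\<lambda>x. ennreal (g x))"
  have [simp, measurable_cong]: "sets T = sets borel" by (simp add: T_def)
  have mean_T: "mean \<phi> \<xi> = (\<integral>x. \<phi> x \<partial>T)" if [measurable]: "\<phi> \<in> borel_measurable borel" for \<phi>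
  proof -
    have "mom \<phi> \<xi> = (\<integral>x. \<phi> x * exp (\<xi> \<bullet> x) \<partial>body_measure)" by (rule mom_def)
    also have "\<dots> = (\<integral>x. indicator Q x *\<^sub>R (\<phi> x * exp (\<xi> \<bullet> x)) \<partial>lborel)"
      unfolding body_measure_def ennreal_indicator[symmetric] by (intro integral_density) auto
    also have "\<dots> / Z = (\<integral>x. g x *\<^sub>R \<phi> x \<partial>lborel)"
      by (subst integral_divide_zero[symmetric]) (simp add: g_def mult_ac)
    also have "\<dots> = (\<integral>x. \<phi> x \<partial>T)" unfolding T_def using g0 by (intro integral_density[symmetric]) auto
    finally show ?thesis by (simp add: mean_def Z_def)
  qed
  have prob_T: "prob_space T"
  proof
    have "integrable body_measure (\<lambda>x. 1 * exp (\<xi> \<bullet> x))" by (rule integrable_mom) simp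
    then have "integrable lborel (\<lambda>x. indicator Q x *\<^sub>R exp (\<xi> \<bullet> x))"
      unfolding body_measure_def ennreal_indicator[symmetric] by (subst (asm) integrable_density) auto
    then have ig: "integrable lborel g" unfolding g_def by simp
    have "(\<integral>x. g x \<partial>lborel) = (\<integral>x. g x *\<^sub>R 1 \<partial>lborel)" by simp
    also have "\<dots> = (\<integral>x. 1 \<partial>T)" unfolding T_def using g0 by (intro integral_density[symmetric]) auto
    also have "\<dots> = mean (\<lambda>_. 1) \<xi>" by (rule mean_T[symmetric]) simp
    also have "\<dots> = 1" by simp
    finally have "(\<integral>x. g x \<partial>lborel) = 1" .
    moreover have "emeasure T (space T) = (\<integral>\<^sup>+x. ennreal (g x) \<partial>lborel)" by (simp add: T_def emeasure_density)
    ultimately show "emeasure T (space T) = 1" using ig g0 by (simp add: nn_integral_eq_integral)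
  qed
  define h where "h = (\<lambda>y. g (X y) / D)"
  have [measurable]: "h \<in> borel_measurable borel" unfolding h_def by measurable
  have distr_TY: "distr T borel Y = density lborel (\<lambda>y. ennreal (h y))"
  proof -
    have "T = density lborel (\<lambda>x. ennreal (g (X (Y x))))" by (simp add: T_def XY)
    then have "distr T borel Y = distr (density lborel (\<lambda>x. ennreal (g (X (Y x))))) borel Y" by simp
    also have "\<dots> = density (distr lborel borel Y) (\<lambda>y. ennreal (g (X y)))"
      by (rule density_distr[symmetric]) measurable
    also have "\<dots> = density lborel (\<lambda>y. ennreal (1 / D) * ennreal (g (X y)))"
      unfolding distr_Y by (rule density_density_eq) auto
    also have "(\<lambda>y. ennreal (1 / D) * ennreal (g (X y))) = (\<lambda>y. ennreal (h y))"
      using D g0 by (simp add: h_def flip: ennreal_mult)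
    finally show ?thesis .
  qed
  define \<mu> where "\<mu> = distr T borel (\<lambda>x. to_fun (Y x))"
  have \<mu>_density: "\<mu> = density (lebesgue_n n) (\<lambda>x. ennreal (h (to_vec x)))"
  proof -
    have "\<mu> = distr (distr T borel Y) borel to_fun"
      unfolding \<mu>_def by (subst distr_distr) (auto simp: comp_def)
    also have "\<dots> = distr (density lborel (\<lambda>y. ennreal (h (to_vec (to_fun y))))) borel to_fun"
      by (simp add: distr_TY)
    also have "\<dots> = density (distr lborel borel to_fun) (\<lambda>x. ennreal (h (to_vec x)))"
      by (rule density_distr[symmetric]) measurable
    finally show ?thesis by (simp add: lebesgue_n_eq)
  qed
  have X_mid: "X ((1 - t) *\<^sub>R u + t *\<^sub>R v) = (1 - t) *\<^sub>R X u + t *\<^sub>R X v" for t u v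
    by (simp add: X_def matrix_vector_right_distrib matrix_vector_mult_scaleR algebra_simps)
  have tv_mid: "to_vec (\<lambda>i. (1 - t) * x i + t * y i) = (1 - t) *\<^sub>R to_vec x + t *\<^sub>R to_vec y" for t x y
    by (simp add: vec_eq_iff)
  have log_concave: "log_concave_law n \<mu>"
  proof -
    define H where "H = (\<lambda>x. if X (to_vec x) \<in> Q then ereal (ln (Z * D) - \<xi> \<bullet> X (to_vec x)) else \<infinity>)"
    have "H \<in> borel_measurable borel" unfolding H_def by measurable
    moreover have "H x \<noteq> -\<infinity>" for x by (simp add: H_def)
    moreover have "H (\<lambda>i. (1 - t) * x i + t * y i) \<le> ereal (1 - t) * H x + ereal t * H y" if t: "t \<in> {0<..<1}" for x y t
    proof (cases "X (to_vec x) \<in> Q \<and> X (to_vec y) \<in> Q")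
      case True
      let ?u = "X (to_vec x)" and ?v = "X (to_vec y)"
      have "(1 - t) *\<^sub>R ?u + t *\<^sub>R ?v \<in> Q" using True t by (intro convexD[OF Q_convex]) auto
      moreover have "ln (Z * D) - \<xi> \<bullet> ((1 - t) *\<^sub>R ?u + t *\<^sub>R ?v) = (1 - t) * (ln (Z * D) - \<xi> \<bullet> ?u) + t * (ln (Z * D) - \<xi> \<bullet> ?v)"
        by (simp add: inner_add_right algebra_simps)
      ultimately show ?thesis using True by (simp add: H_def tv_mid X_mid)
    next
      case False
      then have "ereal (1 - t) * H x + ereal t * H y = \<infinity>"
        using t by (auto simp: H_def ereal_mult_infty)
      then show ?thesis by (simp only: ereal_less_eq(1))
    qed
    moreover have "\<mu> = density (lebesgue_n n) (\<lambda>x. exp_neg (H x))"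
    proof -
      have "ennreal (h (to_vec x)) = exp_neg (H x)" for x
        using Z D by (simp add: h_def g_def H_def exp_neg_def exp_diff)
      then show ?thesis unfolding \<mu>_density by simp
    qed
    moreover have "prob_space \<mu>"
      unfolding \<mu>_def by (intro prob_space.prob_space_distr[OF prob_T]) measurable
    ultimately show ?thesis unfolding log_concave_law_def by blast
  qed
  have int_\<mu>: "(\<integral>x. f x \<partial>\<mu>) = mean (\<lambda>x. f (to_fun (Y x))) \<xi>" if [measurable]: "f \<in> borel_measurable borel" for f :: "(nat \<Rightarrow> real) \<Rightarrow> real"
    unfolding \<mu>_def by (subst integral_distr) (auto simp: mean_T)
  have [measurable]: "(\<lambda>x::nat \<Rightarrow> real. x i) \<in> borel_measurable borel" for i by measurable
  have Yk: "Y x $ k = B $ k \<bullet> (x - bary \<xi>)" for x k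
    by (simp add: Y_def b_def matrix_vector_mul_component)
  have m0: "mean_n \<mu> i = 0" if "i < n" for i
    unfolding mean_n_def using that by (subst int_\<mu>) (auto simp: to_fun_lt Yk mean_centered)
  have iso: "isotropic_law n \<mu>"
    unfolding isotropic_law_def
  proof (intro conjI allI impI m0)
    fix i j assume ij: "i < n" "j < n"
    have "cov_n \<mu> i j = mean (\<lambda>x. Y x $ e i * Y x $ e j) \<xi>"
      unfolding cov_n_def m0[OF ij(1)] m0[OF ij(2)] using ij by (subst int_\<mu>) (auto simp: to_fun_lt)
    also have "\<dots> = B $ e i \<bullet> (cov \<xi> *v B $ e j)" unfolding Yk cov_bilinear ..
    also have "\<dots> = (B ** cov \<xi> ** transpose B) $ e i $ e j"
      unfolding matrix_conjugation_component by (simp add: row_def)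
    also have "\<dots> = (if i = j then 1 else 0)" unfolding B using ij by (simp add: mat_def e_eq_iff)
    finally show "cov_n \<mu> i j = (if i = j then 1 else 0)" .
  qed
  have "(\<Sum>i<n. \<Sum>j<n. (\<integral>x. x i * x j * inner_n n x (to_fun \<theta>) \<partial>\<mu>)\<^sup>2) \<le> (tau_n n)\<^sup>2"
    by (rule third_moments_le_tau(1)[OF log_concave iso sphere_to_fun[OF \<theta>]])
  moreover have "(\<integral>x. x i * x j * inner_n n x (to_fun \<theta>) \<partial>\<mu>) = mean (\<lambda>x. Y x $ e i * Y x $ e j * (\<theta> \<bullet> Y x)) \<xi>"
    if "i < n" "j < n" for i j
    using that by (subst int_\<mu>) (auto simp: to_fun_lt inner_to_vec inner_commute)
  ultimately have "(\<Sum>i<n. \<Sum>j<n. (mean (\<lambda>x. Y x $ e i * Y x $ e j * (\<theta> \<bullet> Y x)) \<xi>)\<^sup>2) \<le> (tau_n n)\<^sup>2" by simp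
  also have "(\<Sum>i<n. \<Sum>j<n. (mean (\<lambda>x. Y x $ e i * Y x $ e j * (\<theta> \<bullet> Y x)) \<xi>)\<^sup>2)
     = (\<Sum>i<n. \<Sum>l\<in>UNIV. (mean (\<lambda>x. Y x $ e i * Y x $ l * (\<theta> \<bullet> Y x)) \<xi>)\<^sup>2)"
    by (intro sum.cong refl sum_e)
  also have "\<dots> = (\<Sum>k\<in>UNIV. \<Sum>l\<in>UNIV. (mean (\<lambda>x. Y x $ k * Y x $ l * (\<theta> \<bullet> Y x)) \<xi>)\<^sup>2)"
    by (rule sum_e)
  finally show ?thesis by (simp add: Y_def b_def)
qed

lemma tau_n_nonneg: "0 \<le> tau_n n"
proof -
  have "to_fun (axis (e 0) 1) \<in> sphere_n n" by (intro sphere_to_fun) simp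
  then show ?thesis by (rule third_moments_le_tau(2)[OF log_concave_uniform law])
qed

sublocale tilted_body body_measure radius "tau_n n"
  by (rule tilted_body.intro[OF compact_measure_axioms], rule tilted_body_axioms.intro)
    (auto intro: tau_n_nonneg tilted_third_moments)

lemma n_pos: "0 < n" using card_n by (metis zero_less_card_finite)

section \<open>Bounds for a single body\<close>

lemma small_step:
  assumes "3000 * s * tau_n n \<le> 2" shows "3 * s * radius * tau_n n * sqrt (real CARD('n)) \<le> 2 * real CARD('n)"
proof -
  have "3 * s * radius * tau_n n * sqrt (real CARD('n)) = (3000 * s * tau_n n) * (sqrt (real n) * sqrt (real n))"
    by (simp add: radius_def card_n)
  also have "\<dots> = (3000 * s * tau_n n) * real n" by simp
  also have "\<dots> \<le> 2 * real n" using assms by (intro mult_right_mono) auto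
  finally show ?thesis by (simp add: card_n)
qed

lemma sqrt_2pi: "24 / 10 \<le> sqrt (2 * pi)" "sqrt (2 * pi) \<le> 3"
proof -
  show "24 / 10 \<le> sqrt (2 * pi)" using pi_gt3 by (intro real_le_rsqrt) (simp add: power_divide)
  show "sqrt (2 * pi) \<le> 3" using pi_less_4 by (intro real_le_lsqrt) auto
qed

text \<open>The number \<open>5\<close> comes from \<open>e \<le> 3\<close> and \<open>sqrt (2 * pi) \<ge> 24 / 10\<close>, and the loss of half of the Gaussian mass
  is absorbed by \<open>1 / 2 \<ge> (1 / 2) ^ n\<close>.\<close>

lemma volume_lower:
  assumes s: "0 < s" and small: "3000 * s * tau_n n \<le> 2"
  shows "(s / 5) ^ n \<le> vol"
proof -
  have half: "0 < (1 / 2 :: real)" by simp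
  have "(1 / 2 / exp 1) ^ n * ((s * sqrt (2 * pi)) ^ n / 2) \<le> measure lebesgue Q"
    using volume_lower_bound[OF s small_step[OF small] half cov_zero Q_compact Q_convex AE_Q] by (simp add: card_n)
  also have "\<dots> = measure lborel Q" by (simp add: measure_completion)
  also have "\<dots> \<le> vol"
    unfolding vol_def using Q_subset Kv_finite by (intro measure_mono_fmeasurable) (auto simp: fmeasurable_def)
  finally have 1: "(1 / 2 / exp 1) ^ n * ((s * sqrt (2 * pi)) ^ n / 2) \<le> vol" .
  have "s / 5 \<le> 1 / 2 / exp 1 * (s * sqrt (2 * pi)) * (1 / 2)"
  proof -
    have "(1 / 5) * (4 * exp 1) \<le> sqrt (2 * pi)" using exp_le sqrt_2pi by linarith
    then have "1 / 5 \<le> sqrt (2 * pi) / (4 * exp 1)" by (simp add: pos_le_divide_eq)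
    then have "s * (1 / 5) \<le> s * (sqrt (2 * pi) / (4 * exp 1))" using s by (intro mult_left_mono) auto
    then show ?thesis by (simp add: field_simps)
  qed
  then have "(s / 5) ^ n \<le> (1 / 2 / exp 1 * (s * sqrt (2 * pi)) * (1 / 2)) ^ n" using s by (intro power_mono) auto
  also have "\<dots> = (1 / 2 / exp 1) ^ n * (s * sqrt (2 * pi)) ^ n * (1 / 2) ^ n" by (simp only: power_mult_distrib)
  also have "\<dots> \<le> (1 / 2 / exp 1) ^ n * (s * sqrt (2 * pi)) ^ n * (1 / 2)"
  proof (rule mult_left_mono)
    show "(1 / 2 :: real) ^ n \<le> 1 / 2" using power_decreasing[of 1 n "1 / 2 :: real"] n_pos by simp
  qed (use s in simp)
  finally show ?thesis using 1 by simp
qed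

text \<open>At least three quarters of the body lie in the ball of radius \<open>2 * sqrt n\<close>, on which the standard Gaussian
  weight is at least \<open>exp (- 2 n)\<close>.\<close>

lemma volume_upper: "vol \<le> 36 ^ n"
proof -
  interpret N: prob_space \<nu> by (rule prob_space_nu)
  let ?C = "cball (0::real^'n::_) (2 * sqrt (real n))"
  have "measure \<nu> (space \<nu> - ?C) = 1 - measure \<nu> ?C" by (intro N.prob_compl) auto
  moreover have "space \<nu> - ?C = {x. 2 * sqrt (real n) < norm x}" by (auto simp: \<nu>_def)
  ultimately have "3 / 4 \<le> measure \<nu> ?C" using nu_tail[of 2] by simp
  also have "measure \<nu> ?C = (\<integral>x. indicator Kv x * indicator ?C x \<partial>lborel) / vol"
    using nu_integral[OF borel_measurable_indicator, of ?C] by simp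
  finally have "3 / 4 * vol \<le> (\<integral>x. indicator Kv x * indicator ?C x \<partial>lborel)"
    using vol_pos by (simp add: pos_le_divide_eq)
  also have "\<dots> \<le> (\<integral>(x::real^'n::_). exp (2 * real n) * gauss 1 x \<partial>lborel)"
  proof (rule integral_mono_AE)
    show "integrable lborel (\<lambda>x. indicator Kv x * indicator ?C x :: real)"
    proof (rule Bochner_Integration.integrable_bound)
      show "integrable lborel (indicator Kv :: _ \<Rightarrow> real)" using Kv_finite by simp
    qed (auto simp: indicator_def)
    show "integrable lborel (\<lambda>x::real^'n::_. exp (2 * real n) * gauss 1 x)" by (intro integrable_mult_right gauss_integrable) simp
    show "AE x in lborel. indicator Kv x * indicator ?C x \<le> exp (2 * real n) * gauss 1 x"
    proof (rule AE_I2)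
      fix x :: "real^'n::_"
      show "indicator Kv x * indicator ?C x \<le> exp (2 * real n) * gauss 1 x"
      proof (cases "x \<in> ?C")
        case True
        then have "(norm x)\<^sup>2 \<le> (2 * sqrt (real n))\<^sup>2" by (intro power_mono) auto
        then have "0 \<le> 2 * real n + (- (norm x)\<^sup>2 / 2)" by (simp add: power_mult_distrib)
        then have "exp 0 \<le> exp (2 * real n + (- (norm x)\<^sup>2 / 2))" by (rule exp_le_cancel_iff[THEN iffD2])
        then have "1 \<le> exp (2 * real n) * gauss 1 x"
          unfolding gauss_def exp_add exp_zero one_power2 mult_1_right .
        then show ?thesis by (simp add: indicator_def)
      qed (simp add: less_imp_le)
    qed
  qed
  also have "\<dots> = exp (2 * real n) * sqrt (2 * pi) ^ n" using gauss_integral[of 1, where 'n='n] by (simp add: card_n)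
  also have "exp (2 * real n) = (exp 1 ^ 2) ^ n"
  proof -
    have "exp (real 2 * 1) = exp (1::real) ^ 2" by (rule exp_of_nat_mult)
    moreover have "exp (real n * 2) = exp (2::real) ^ n" by (rule exp_of_nat_mult)
    ultimately show ?thesis by (simp add: mult.commute)
  qed
  also have "(exp 1 ^ 2) ^ n * sqrt (2 * pi) ^ n \<le> 9 ^ n * (3::real) ^ n"
  proof (intro mult_mono power_mono)
    show "exp 1 ^ 2 \<le> (9::real)" using power_mono[OF exp_le, of 2] by simp
  qed (use sqrt_2pi in auto)
  also have "9 ^ n * (3::real) ^ n = 27 ^ n" by (subst power_mult_distrib[symmetric]) simp
  finally have "vol \<le> 4 / 3 * 27 ^ n" by simp
  also have "\<dots> \<le> (4 / 3) ^ n * 27 ^ n"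
  proof (rule mult_right_mono)
    show "4 / 3 \<le> (4 / 3 :: real) ^ n" using power_increasing[of 1 n "4 / 3 :: real"] n_pos by simp
  qed simp
  also have "\<dots> = 36 ^ n" by (subst power_mult_distrib[symmetric]) simp
  finally show ?thesis .
qed

text \<open>If \<open>tau_n n\<close> vanished, every step \<open>s\<close> would be admissible in the lower bound on the volume.\<close>

lemma tau_pos: "0 < tau_n n"
proof (rule ccontr)
  assume "\<not> 0 < tau_n n"
  then have t: "tau_n n = 0" using tau_n_nonneg by simp
  have "(5 * (vol + 1) / 5) ^ n \<le> vol" using vol_pos by (intro volume_lower) (auto simp: t)
  then have "(vol + 1) ^ n \<le> vol" by (simp only: nonzero_mult_div_cancel_left[of 5] zero_neq_numeral[symmetric] not_False_eq_True)
  moreover have "vol + 1 \<le> (vol + 1) ^ n" using power_increasing[of 1 n "vol + 1"] n_pos vol_pos by simp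
  ultimately show False by simp
qed

text \<open>The largest admissible step.\<close>

definition step :: real where "step = 1 / (1500 * tau_n n)"

lemma step: "0 < step" "3000 * step * tau_n n \<le> 2"
  using tau_pos by (auto simp: step_def)

lemma tau_lower: "1 / 270000 \<le> tau_n n"
proof -
  have "(step / 5) ^ n \<le> 36 ^ n" using volume_lower[OF step] volume_upper by simp
  then have "step / 5 \<le> 36" using n_pos step(1) by (subst (asm) power_mono_iff) auto
  then show ?thesis using tau_pos by (simp add: step_def field_simps)
qed

lemma isotropic_const_le: "isotropic_const n K \<le> 7500 * tau_n n"
proof -
  have "isotropic_const n K = vol powr (- 1 / real n)" by (simp add: isotropic_const_def measure_K)
  also have "\<dots> \<le> ((step / 5) ^ n) powr (- 1 / real n)"
    using volume_lower[OF step] step(1) vol_pos by (intro powr_mono2') auto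
  also have "\<dots> = (step / 5) powr (-1)"
    using step(1) n_pos by (simp add: powr_powr flip: powr_realpow)
  also have "\<dots> = 7500 * tau_n n" using tau_pos by (simp add: step_def powr_minus field_simps)
  finally show ?thesis .
qed

text \<open>The gauge of the polar body is at least the scalar product with any point of the body, in particular
  with the barycentre of a tilt; so its Gaussian mean inherits the lower bound of \<open>width_lower_bound\<close>.\<close>

lemma M_star_ge: "sqrt (real n) / (18000 * tau_n n) \<le> M_star n K"
proof -
  define P where "P = {y::real^'n::_. \<forall>x\<in>Kv. x \<bullet> y \<le> 1}"
  obtain r where r: "0 < r" "cball 0 r \<subseteq> Kv" by (rule Kv_ball)
  obtain R where R: "0 < R" "Kv \<subseteq> cball 0 R"
  proof -
    obtain R where R: "0 < R" "\<And>x. x \<in> Kv \<Longrightarrow> norm x \<le> R"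
      using compact_imp_bounded[OF Kv_compact] unfolding bounded_pos by blast
    have "Kv \<subseteq> cball 0 R" using R(2) by (simp add: subset_iff)
    with R(1) show thesis by (rule that)
  qed
  have polar: "polar_body n K = to_fun ` P"
  proof (intro set_eqI iffI)
    fix y assume y: "y \<in> polar_body n K"
    then have "to_vec y \<in> P" unfolding P_def polar_body_def Kv_def by (auto simp: inner_to_vec)
    then show "y \<in> to_fun ` P" using y to_fun_to_vec[of y] by (intro image_eqI[of _ _ "to_vec y"]) (auto simp: polar_body_def)
  next
    fix y assume "y \<in> to_fun ` P"
    then show "y \<in> polar_body n K" by (auto simp: P_def polar_body_def Kv_def inner_to_vec)
  qed
  have P_eq: "P = (\<Inter>x\<in>Kv. {y. x \<bullet> y \<le> 1})" by (auto simp: P_def)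
  have closed: "closed P" unfolding P_eq by (intro closed_INT ballI closed_halfspace_le)
  have convex: "convex P" unfolding P_eq by (intro convex_INT convex_halfspace_le)
  have "norm y \<le> 1 / r" if y: "y \<in> P" for y
  proof (cases "y = 0")
    case False
    have "(r / norm y) *\<^sub>R y \<in> Kv" using r False by (intro subsetD[OF r(2)]) simp
    then have "((r / norm y) *\<^sub>R y) \<bullet> y \<le> 1" using y by (auto simp: P_def)
    then have "r * norm y \<le> 1" using False by (simp add: power2_norm_eq_inner[symmetric] power2_eq_square)
    then show ?thesis using r by (simp add: field_simps)
  qed (use r in simp)
  then have "bounded P" by (auto simp: bounded_iff)
  then have compact: "compact P" using closed by (simp add: compact_eq_bounded_closed)
  have ball: "cball 0 (1 / R) \<subseteq> P"
  proof
    fix y :: "real^'n::_" assume y: "y \<in> cball 0 (1 / R)"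
    have "x \<bullet> y \<le> 1" if "x \<in> Kv" for x
    proof -
      have "x \<bullet> y \<le> norm x * norm y" by (rule norm_cauchy_schwarz)
      also have "\<dots> \<le> R * (1 / R)" using that R y by (intro mult_mono) auto
      finally show ?thesis using R by simp
    qed
    then show "y \<in> P" by (simp add: P_def)
  qed
  have R': "0 < 1 / R" using R by simp
  note G = compact convex R' ball
  have sup: "x \<bullet> v \<le> gauge_fun P v" if x: "x \<in> Kv" for x v
    unfolding gauge_fun_Inf
  proof (rule cInf_greatest[OF gauge_ne[OF G]])
    fix l assume "l \<in> {l. 0 \<le> l \<and> v \<in> (\<lambda>y. l *\<^sub>R y) ` P}"
    then obtain y where y: "0 \<le> l" "y \<in> P" "v = l *\<^sub>R y" by auto
    have "l * (x \<bullet> y) \<le> l * 1" using y x by (intro mult_left_mono) (auto simp: P_def)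
    then show "x \<bullet> v \<le> l" using y by simp
  qed
  let ?W = "(step * sqrt (2 * pi)) ^ n"
  have W: "0 < ?W" using step(1) by simp
  have half: "0 < (1 / 2 :: real)" by simp
  have "step\<^sup>2 * (real n * (1 / 2) / exp 1) * (?W / 2) \<le> (\<integral>\<xi>. (\<xi> \<bullet> bary \<xi>) * gauss step \<xi> \<partial>lborel)"
    using width_lower_bound[OF step(1) small_step[OF step(2)] half cov_zero] by (simp add: card_n)
  also have "\<dots> \<le> (\<integral>\<xi>. gauge_fun P \<xi> * gauss step \<xi> \<partial>lborel)"
  proof (rule integral_mono[OF bary_gauss(1)[OF step(1)] haar_gauge(3)[OF G step(1)]])
    fix \<xi> :: "real^'n::_"
    have "bary \<xi> \<in> Q" by (rule bary_in_convex[OF compact_imp_closed[OF Q_compact] Q_convex AE_Q])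
    then have "\<xi> \<bullet> bary \<xi> \<le> gauge_fun P \<xi>" using sup[of "bary \<xi>" \<xi>] Q_subset by (auto simp: inner_commute)
    then show "(\<xi> \<bullet> bary \<xi>) * gauss step \<xi> \<le> gauge_fun P \<xi> * gauss step \<xi>"
      by (intro mult_right_mono) (auto simp: less_imp_le)
  qed
  also have "\<dots> = M_star n K * radial_mass step"
    using haar_gauge(1)[OF G step(1)] by (simp add: M_star_def polar)
  also have "\<dots> \<le> M_star n K * (step * sqrt (real n) * ?W)"
  proof (rule mult_left_mono)
    show "radial_mass step \<le> step * sqrt (real n) * ?W"
      using gauss_norm_moment(2)[OF step(1), where 'n='n] by (simp add: radial_mass_def[OF step(1)] card_n)
    show "0 \<le> M_star n K" using haar_gauge(2)[OF G step(1)] by (simp add: M_star_def polar)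
  qed
  finally have "(step * ?W) * (step * real n / (4 * exp 1)) \<le> (step * ?W) * (M_star n K * sqrt (real n))"
    by (simp add: power2_eq_square field_simps)
  then have "step * real n / (4 * exp 1) \<le> M_star n K * sqrt (real n)"
    by (rule mult_left_le_imp_le) (use step(1) W in simp)
  also have "step * real n / (4 * exp 1) = (step * sqrt (real n) / (4 * exp 1)) * sqrt (real n)" by simp
  finally have "step * sqrt (real n) / (4 * exp 1) \<le> M_star n K"
    by (rule mult_right_le_imp_le) (use n_pos in simp)
  moreover have "step * sqrt (real n) / 12 \<le> step * sqrt (real n) / (4 * exp 1)"
    using step(1) exp_le by (intro divide_left_mono) auto
  ultimately show ?thesis by (simp add: step_def)
qed

text \<open>If the mean of the gauge were small, then by Markov's inequality half of the Gaussian mass would lie in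
  a small multiple of the body, whose volume is too small for that.\<close>

lemma M_mean_ge: "1 / (60 * sqrt (real n)) \<le> M_mean n K"
proof (rule ccontr)
  assume "\<not> ?thesis"
  then have lt: "M_mean n K < 1 / (60 * sqrt (real n))" by simp
  obtain r where r: "0 < r" "cball 0 r \<subseteq> Kv" by (rule Kv_ball)
  note G = Kv_compact Kv_convex r
  have one: "0 < (1::real)" by simp
  let ?W = "sqrt (2 * pi) ^ n"
  \<comment> \<open>Any positive value below \<open>1 / 30\<close> serves as the second argument; it only prevents \<open>a\<close> from being zero.\<close>
  define a where "a = max (2 * M_mean n K * sqrt (real n)) (1 / 60)"
  have sn: "0 < sqrt (real n)" using n_pos by simp
  have "2 * M_mean n K * sqrt (real n) < 1 / 30" using lt sn by (simp add: field_simps)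
  then have a: "0 < a" "a < 1 / 30" "2 * M_mean n K * sqrt (real n) \<le> a" by (auto simp: a_def)
  have m0: "0 \<le> M_mean n K" using haar_gauge(2)[OF G one] by (simp add: M_mean_def K_eq[symmetric])
  have "(\<integral>v. gauge_fun Kv v * gauss 1 v \<partial>lborel) = M_mean n K * radial_mass 1"
    using haar_gauge(1)[OF G one] by (simp add: M_mean_def K_eq[symmetric])
  also have "\<dots> \<le> M_mean n K * (sqrt (real n) * ?W)"
    using gauss_norm_moment(2)[OF one, where 'n='n] m0 by (intro mult_left_mono) (auto simp: radial_mass_def[OF one] card_n)
  also have "\<dots> \<le> (a / 2) * ?W" using mult_right_mono[OF a(3), of ?W] by simp
  finally have small: "(\<integral>v. gauge_fun Kv v * gauss 1 v \<partial>lborel) \<le> (a / 2) * ?W" .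
  let ?A = "(\<lambda>y. a *\<^sub>R y) ` Kv"
  have cA: "compact ?A" by (rule compact_scaling[OF Kv_compact])
  then have [measurable]: "?A \<in> sets borel" by (simp add: compact_imp_closed borel_closed)
  have mA: "measure lborel ?A = a ^ n * vol"
  proof -
    have "measure lebesgue ((\<lambda>x. a *\<^sub>R x + 0) ` Kv) = \<bar>a\<bar> ^ DIM(real^'n::_) * measure lebesgue Kv"
      by (rule measure_lebesgue_affine)
    then show ?thesis using a by (simp add: measure_completion vol_def card_n)
  qed
  have iA: "integrable lborel (indicator ?A :: _ \<Rightarrow> real)"
    using emeasure_compact_finite[OF cA] by simp
  have "(\<integral>(v::real^'n::_). gauss 1 v \<partial>lborel) \<le> (\<integral>v. indicator ?A v + (1 / a) * (gauge_fun Kv v * gauss 1 v) \<partial>lborel)"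
  proof (rule integral_mono)
    fix v :: "real^'n::_"
    show "gauss 1 v \<le> indicator ?A v + (1 / a) * (gauge_fun Kv v * gauss 1 v)"
    proof (cases "gauge_fun Kv v < a")
      case True
      then have "v \<in> ?A" by (rule gauge_less_member[OF G])
      moreover have "0 \<le> (1 / a) * (gauge_fun Kv v * gauss 1 v)"
        using a gauge_nonneg[OF G, of v] by (simp add: less_imp_le)
      ultimately show ?thesis using gauss_le_one[of 1 v] by (simp only: indicator_simps)
    next
      case False
      then have "1 \<le> (1 / a) * gauge_fun Kv v" using a by (simp add: field_simps)
      then have "1 * gauss 1 v \<le> ((1 / a) * gauge_fun Kv v) * gauss 1 v" by (intro mult_right_mono) (auto simp: less_imp_le)
      moreover have "0 \<le> (indicator ?A v :: real)" by simp
      ultimately show ?thesis by (simp only: mult.assoc mult_1_left)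
    qed
  qed (intro gauss_integrable one Bochner_Integration.integrable_add iA integrable_mult_right haar_gauge(3)[OF G one])+
  also have "\<dots> = measure lborel ?A + (1 / a) * (\<integral>v. gauge_fun Kv v * gauss 1 v \<partial>lborel)"
    using iA haar_gauge(3)[OF G one] by simp
  also have "\<dots> \<le> a ^ n * vol + (1 / a) * ((a / 2) * ?W)"
    unfolding mA using small a by (intro add_left_mono mult_left_mono) auto
  finally have "?W \<le> a ^ n * vol + (1 / a) * ((a / 2) * ?W)"
    using gauss_integral[OF one, where 'n='n] by (simp add: card_n)
  then have "?W / 2 \<le> a ^ n * vol" using a by simp
  also have "\<dots> \<le> a ^ n * 36 ^ n" using volume_upper a by (intro mult_left_mono) auto
  also have "\<dots> = (a * 36) ^ n" by (simp add: power_mult_distrib)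
  also have "\<dots> < (12 / 10) ^ n" using a n_pos by (intro power_strict_mono) auto
  finally have "?W / 2 < (12 / 10) ^ n" .
  moreover have "(12 / 10) ^ n \<le> ?W / 2"
  proof -
    have "(12 / 10 :: real) ^ n = (24 / 10) ^ n * (1 / 2) ^ n" by (subst power_mult_distrib[symmetric]) simp
    also have "\<dots> \<le> ?W * (1 / 2)"
    proof (intro mult_mono power_mono sqrt_2pi)
      show "(1 / 2 :: real) ^ n \<le> 1 / 2" using power_decreasing[of 1 n "1 / 2 :: real"] n_pos by simp
    qed auto
    finally show ?thesis by simp
  qed
  ultimately show False by simp
qed

theorem bounds:
  assumes n: "2 \<le> n"
  shows "M_mean n K \<ge> (1 / 40000000) / (sqrt (real n * ln (real n)) * tau_n n)"
    "M_star n K \<ge> (1 / 40000000) * sqrt (real n) / (sqrt (ln (real n)) * tau_n n)"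
    "isotropic_const n K \<le> 60000 * tau_n n * ln (real n) powr (3 / 2)"
proof -
  let ?t = "tau_n n" and ?l = "ln (real n)"
  have l: "1 / 4 \<le> ?l"
  proof -
    have "ln (1 / 2) \<le> 1 / 2 - (1 :: real)" by (rule ln_le_minus_one) simp
    then have "(1 / 2 :: real) \<le> ln 2" by (simp add: ln_div)
    also have "ln 2 \<le> ?l" using n by (intro ln_mono) auto
    finally show ?thesis by simp
  qed
  have ssl: "0 < sqrt ?l" using l by simp
  have sl: "1 / 2 \<le> sqrt ?l" using l by (intro real_le_rsqrt) (simp add: power_divide)
  have sn: "0 < sqrt (real n)" using n by simp
  show "M_mean n K \<ge> (1 / 40000000) / (sqrt (real n * ?l) * ?t)"
  proof -
    have "sqrt (real n) * (1 / 2) * (1 / 270000) \<le> sqrt (real n) * sqrt ?l * ?t"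
      using sl tau_lower sn by (intro mult_mono) auto
    then have "(1 / 40000000) / (sqrt (real n) * sqrt ?l * ?t) \<le> (1 / 40000000) / (sqrt (real n) * (1 / 2) * (1 / 270000))"
    proof (rule divide_left_mono)
      have "0 < sqrt (real n) * (1 / 2) * (1 / 270000)" using sn by simp
      then show "0 < (sqrt (real n) * sqrt ?l * ?t) * (sqrt (real n) * (1 / 2) * (1 / 270000))"
        by (rule mult_pos_pos[OF mult_pos_pos[OF mult_pos_pos[OF sn ssl] tau_pos]])
    qed simp
    also have "\<dots> \<le> 1 / (60 * sqrt (real n))" using sn by (simp add: field_simps)
    also have "\<dots> \<le> M_mean n K" by (rule M_mean_ge)
    finally show ?thesis by (simp add: real_sqrt_mult)
  qed
  show "M_star n K \<ge> (1 / 40000000) * sqrt (real n) / (sqrt ?l * ?t)"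
  proof -
    have "(1 / 2) * ?t \<le> sqrt ?l * ?t" using sl tau_pos by (intro mult_right_mono) auto
    then have "(1 / 40000000) * sqrt (real n) / (sqrt ?l * ?t) \<le> (1 / 40000000) * sqrt (real n) / ((1 / 2) * ?t)"
    proof (rule divide_left_mono)
      have "0 < (1 / 2) * ?t" using tau_pos by simp
      then show "0 < (sqrt ?l * ?t) * ((1 / 2) * ?t)" by (rule mult_pos_pos[OF mult_pos_pos[OF ssl tau_pos]])
    qed simp
    also have "\<dots> \<le> sqrt (real n) / (18000 * ?t)" using sn tau_pos by (simp add: field_simps)
    also have "\<dots> \<le> M_star n K" by (rule M_star_ge)
    finally show ?thesis .
  qed
  show "isotropic_const n K \<le> 60000 * ?t * ?l powr (3 / 2)"
  proof -
    have "(1 / 2) ^ 3 \<le> (sqrt ?l) ^ 3" using sl by (intro power_mono) auto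
    moreover have "?l powr (3 / 2) = (sqrt ?l) ^ 3"
      using l by (simp add: powr_half_sqrt[symmetric] powr_powr flip: powr_realpow)
    ultimately have "1 / 8 \<le> ?l powr (3 / 2)" by (simp add: power_divide)
    then have "60000 * ?t * (1 / 8) \<le> 60000 * ?t * ?l powr (3 / 2)" using tau_pos by (intro mult_left_mono) auto
    then show ?thesis using isotropic_const_le by simp
  qed
qed
end

section \<open>From a type of indices to a number\<close>

text \<open>The constants are explicit numbers because the critical dimension below is chosen after them.\<close>
definition corollary_bounds :: "nat \<Rightarrow> bool" where
  "corollary_bounds n \<longleftrightarrow> (\<forall>K. isotropic_convex_body n K \<longrightarrow>
     M_mean n K \<ge> (1 / 40000000) / (sqrt (real n * ln (real n)) * tau_n n) \<and>
     M_star n K \<ge> (1 / 40000000) * sqrt (real n) / (sqrt (ln (real n)) * tau_n n) \<and>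
     isotropic_const n K \<le> 60000 * tau_n n * ln (real n) powr (3 / 2))"

lemma corollary_bounds_if_card:
  assumes "CARD('n::{finite,wellorder}) = n" "2 \<le> n"
  shows "corollary_bounds n"
  unfolding corollary_bounds_def
proof (intro allI impI)
  fix K assume K: "isotropic_convex_body n K"
  have "card {..<n} = card (UNIV :: 'n set)" using assms(1) by simp
  then obtain e :: "nat \<Rightarrow> 'n" where e: "bij_betw e {..<n} UNIV"
    using bij_betw_iff_card[of "{..<n}" "UNIV :: 'n set"] by auto
  interpret isotropic_body e n K
    by unfold_locales (use e K in auto)
  show "M_mean n K \<ge> (1 / 40000000) / (sqrt (real n * ln (real n)) * tau_n n) \<and>
     M_star n K \<ge> (1 / 40000000) * sqrt (real n) / (sqrt (ln (real n)) * tau_n n) \<and>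
     isotropic_const n K \<le> 60000 * tau_n n * ln (real n) powr (3 / 2)"
    using bounds[OF assms(2)] by blast
qed

text \<open>A dimension at which the bounds fail, if there is one.  A type whose cardinality is this number lets
  the bounds for \<open>real^'n\<close> refute such a failure, although types cannot depend on a variable \<open>n\<close>.\<close>

definition critical_dim :: nat where
  "critical_dim = (if \<exists>n\<ge>2. \<not> corollary_bounds n then SOME n. 2 \<le> n \<and> \<not> corollary_bounds n else 2)"

lemma critical_dim_ge: "2 \<le> critical_dim"
  unfolding critical_dim_def using someI_ex[of "\<lambda>n. 2 \<le> n \<and> \<not> corollary_bounds n"] by auto

typedef critical_index = "{..<critical_dim}"
  using critical_dim_ge by (intro exI[of _ 0]) auto

instantiation critical_index :: "{finite, wellorder}"
begin

definition "i \<le> j \<longleftrightarrow> Rep_critical_index i \<le> Rep_critical_index j"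
definition "i < j \<longleftrightarrow> Rep_critical_index i < Rep_critical_index j"

instance
proof
  have "finite (Abs_critical_index ` {..<critical_dim})" by simp
  also have "Abs_critical_index ` {..<critical_dim} = UNIV"
    using type_definition.Abs_image[OF type_definition_critical_index] .
  finally show "finite (UNIV :: critical_index set)" .
  fix P :: "critical_index \<Rightarrow> bool" and a
  assume step: "\<And>x. (\<And>y. y < x \<Longrightarrow> P y) \<Longrightarrow> P x"
  show "P a"
    by (induction a rule: measure_induct_rule[of Rep_critical_index]) (auto intro: step simp: less_critical_index_def)
qed (auto simp: less_eq_critical_index_def less_critical_index_def Rep_critical_index_inject)

end

lemma card_critical_index: "CARD(critical_index) = critical_dim"
  using type_definition.card[OF type_definition_critical_index] by simp

lemma corollary_bounds_all:
  assumes "2 \<le> n" shows "corollary_bounds n"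
proof (rule ccontr)
  assume "\<not> corollary_bounds n"
  then have ex: "\<exists>n. 2 \<le> n \<and> \<not> corollary_bounds n" using assms by blast
  then have "critical_dim = (SOME n. 2 \<le> n \<and> \<not> corollary_bounds n)" by (auto simp: critical_dim_def)
  then have "\<not> corollary_bounds critical_dim" using someI_ex[OF ex] by simp
  then show False using corollary_bounds_if_card[OF card_critical_index critical_dim_ge] by simp
qed

theorem corollary2:
  shows "\<exists>c C :: real. c > 0 \<and> C > 0 \<and>
    (\<forall>n :: nat. n \<ge> 2 \<longrightarrow> (\<forall>K :: (nat \<Rightarrow> real) set. isotropic_convex_body n K \<longrightarrow>
       M_mean n K \<ge> c / (sqrt (real n * ln (real n)) * tau_n n) \<and>
       M_star n K \<ge> c * sqrt (real n) / (sqrt (ln (real n)) * tau_n n) \<and>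
       isotropic_const n K \<le> C * tau_n n * ln (real n) powr (3 / 2)))"
  using corollary_bounds_all unfolding corollary_bounds_def
  by (intro exI[of _ "1 / 40000000"] exI[of _ 60000]) simp

end
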